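(* Let $N\ge 1$ and $0<\gamma_2<\gamma_1<\min\{N,2\}$. Then there exists a constant $\tilde c_0>0$ depending only on $\gamma_1,\gamma_2$ and $N$ such that, for any $c>\tilde c_0$, $m(c)<0$ and the strict subadditivity inequality $$m(c)<m(c_1)+m(c_2)$$ holds whenever $c=c_1+c_2$ and $0<c_1,c_2<c$. In addition, for any $c>\tilde c_0$, any minimizing sequence for $m(c)$ is compact in $H^1(\mathbb{R}^N)$ up to translations, and there exists a minimizer of $m(c)$, i.e. some $u\in S(c)$ with $E(u)=m(c)$.
   Context: For $\gamma\in(0,N)$ and $u\in H^1(\mathbb{R}^N)$ write $D_\gamma(u):=\int_{\mathbb{R}^N}\int_{\mathbb{R}^N}\frac{|u(x)|^2|u(y)|^2}{|x-y|^{\gamma}}\,dx\,dy$. The energy is $E(u):=\frac12\int_{\mathbb{R}^N}|\nabla u|^2\,dx+\frac14 D_{\gamma_2}(u)-\frac14 D_{\gamma_1}(u)$. For $c>0$, $S(c):=\{u\in H^1(\mathbb{R}^N):\int_{\mathbb{R}^N}|u|^2\,dx=c\}$ and $m(c):=\inf_{u\in S(c)}E(u)$. A minimizing sequence for $m(c)$ is a sequence $\{u_n\}\subset S(c)$ with $E(u_n)\to m(c)$; it is compact up to translations if there is a sequence $\{y_n\}\subset\mathbb{R}^N$ such that $\{u_n(\cdot+y_n)\}$ has a subsequence converging strongly in $H^1(\mathbb{R}^N)$. *)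

theory Defs
  imports "HOL-Analysis.Analysis"
begin

section \<open>The Sobolev space \<open>H\<^sup>1\<close> of complex-valued functions on \<open>\<real>\<^sup>N\<close>\<close>

text \<open>Classes of functions modulo null sets are handled through Borel representatives; every
  notion below depends on a function only up to equality almost everywhere.\<close>

primrec C_k :: "nat \<Rightarrow> (real^'n \<Rightarrow> real) \<Rightarrow> bool" where
  "C_k 0 f \<longleftrightarrow> continuous_on UNIV f"
| "C_k (Suc k) f \<longleftrightarrow> (\<forall>x. f differentiable (at x)) \<and>
     (\<forall>v. C_k k (\<lambda>x. frechet_derivative f (at x) v))"

definition test_function :: "(real^'n \<Rightarrow> real) \<Rightarrow> bool" where
  "test_function \<phi> \<longleftrightarrow> (\<forall>k. C_k k \<phi>) \<and> compact (closure {x. \<phi> x \<noteq> 0})"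

definition L2 :: "(real^'n \<Rightarrow> 'b::euclidean_space) set" where
  "L2 = {f \<in> borel_measurable lborel. integrable lborel (\<lambda>x. (norm (f x))\<^sup>2)}"

definition has_weak_gradient :: "(real^'n \<Rightarrow> complex) \<Rightarrow> (real^'n \<Rightarrow> complex^'n) \<Rightarrow> bool" where
  "has_weak_gradient u g \<longleftrightarrow> (\<forall>\<phi> i. test_function \<phi> \<longrightarrow>
     (LINT x|lborel. frechet_derivative \<phi> (at x) (axis i 1) *\<^sub>R u x) =
       - (LINT x|lborel. \<phi> x *\<^sub>R (g x $ i)))"

definition H1 :: "(real^'n \<Rightarrow> complex) set" where
  "H1 = {u \<in> L2. \<exists>g \<in> L2. has_weak_gradient u g}"

text \<open>The weak gradient is unique only up to a null set, hence the choice.\<close>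

definition weak_gradient :: "(real^'n \<Rightarrow> complex) \<Rightarrow> real^'n \<Rightarrow> complex^'n" where
  "weak_gradient u = (SOME g. g \<in> L2 \<and> has_weak_gradient u g)"

definition H1_norm :: "(real^'n \<Rightarrow> complex) \<Rightarrow> real" where
  "H1_norm u = sqrt ((LINT x|lborel. (norm (weak_gradient u x))\<^sup>2) +
                     (LINT x|lborel. (norm (u x))\<^sup>2))"

definition converges_in_H1 :: "(nat \<Rightarrow> real^'n \<Rightarrow> complex) \<Rightarrow> (real^'n \<Rightarrow> complex) \<Rightarrow> bool" where
  "converges_in_H1 w v \<longleftrightarrow> (\<forall>n. w n \<in> H1) \<and> v \<in> H1 \<and>
     (\<lambda>n. H1_norm (\<lambda>x. w n x - v x)) \<longlonglongrightarrow> 0"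

section \<open>The constrained minimization problem\<close>

text \<open>On the diagonal the kernel takes the value \<open>0\<close> instead of \<open>\<infinity>\<close>; this is a null set.\<close>

definition D_energy :: "real \<Rightarrow> (real^'n \<Rightarrow> complex) \<Rightarrow> real" where
  "D_energy \<gamma> u = (LINT x|lborel. LINT y|lborel.
     (norm (u x))\<^sup>2 * (norm (u y))\<^sup>2 / norm (x - y) powr \<gamma>)"

definition energy :: "real \<Rightarrow> real \<Rightarrow> (real^'n \<Rightarrow> complex) \<Rightarrow> real" where
  "energy \<gamma>1 \<gamma>2 u = 1/2 * (LINT x|lborel. (norm (weak_gradient u x))\<^sup>2)
     + 1/4 * D_energy \<gamma>2 u - 1/4 * D_energy \<gamma>1 u"

definition mass_sphere :: "real \<Rightarrow> (real^'n \<Rightarrow> complex) set" where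
  "mass_sphere c = {u \<in> H1. (LINT x|lborel. (norm (u x))\<^sup>2) = c}"

text \<open>The type argument carries the dimension. The real-valued infimum is the mathematical one
  because, for \<open>0 < \<gamma>2 < \<gamma>1 < min N 2\<close> and \<open>c > 0\<close>, the energy is finite and bounded below on the
  nonempty set \<open>mass_sphere c\<close>.\<close>

definition min_energy :: "'n::finite itself \<Rightarrow> real \<Rightarrow> real \<Rightarrow> real \<Rightarrow> real" where
  "min_energy _ \<gamma>1 \<gamma>2 c = (INF u \<in> (mass_sphere c :: (real^'n \<Rightarrow> complex) set). energy \<gamma>1 \<gamma>2 u)"

definition minimizing_sequence ::
    "real \<Rightarrow> real \<Rightarrow> real \<Rightarrow> (nat \<Rightarrow> real^'n \<Rightarrow> complex) \<Rightarrow> bool" where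
  "minimizing_sequence \<gamma>1 \<gamma>2 c u \<longleftrightarrow> (\<forall>n. u n \<in> mass_sphere c) \<and>
     (\<lambda>n. energy \<gamma>1 \<gamma>2 (u n)) \<longlonglongrightarrow> min_energy TYPE('n) \<gamma>1 \<gamma>2 c"

definition compact_up_to_translations :: "(nat \<Rightarrow> real^'n \<Rightarrow> complex) \<Rightarrow> bool" where
  "compact_up_to_translations u \<longleftrightarrow> (\<exists>y :: nat \<Rightarrow> real^'n. \<exists>r v. strict_mono r \<and>
     converges_in_H1 ((\<lambda>n x. u n (x + y n)) \<circ> r) v)"

end

theory Submission
  imports Defs "HOL-Library.Diagonal_Subsequence"
begin

text \<open>Write \<open>A u\<close> for the squared norm of the gradient and \<open>D\<^sub>1\<close>, \<open>D\<^sub>2\<close> for the two double integrals.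
  Rescaling \<open>u\<close>, of mass \<open>a\<close>, to mass \<open>c\<close> turns \<open>m c \<le> E\<close> into
  \<open>D\<^sub>1 u / 4 \<le> (a / c) * A u / 2 + D\<^sub>2 u / 4 + (a / c)\<^sup>2 * (- m c)\<close>.
  For \<open>a \<le> c\<close> this says \<open>m a \<ge> (a / c)\<^sup>2 * m c\<close>, which is strict subadditivity as soon as \<open>m c < 0\<close>,
  and a bump of small support and large mass has negative energy.

  The same inequality gives tightness without a vanishing/dichotomy analysis. Apply it to
  \<open>\<chi>\<^sub>w u\<close> with \<open>\<chi>\<^sub>w x = \<phi> (x / R - w)\<close> and \<open>\<integral> \<phi> ^ 4 = 1\<close>, and integrate over \<open>w\<close>. All terms
  become integrals against \<open>k (x, y) = \<integral> \<chi>\<^sub>w x ^ 2 * \<chi>\<^sub>w y ^ 2 dw\<close>, which satisfies \<open>0 \<le> k \<le> 1\<close>, vanishes for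
  \<open>R \<le> \<bar>x - y\<bar>\<close> and differs from \<open>1\<close> by \<open>O (\<bar>x - y\<bar>\<^sup>2 / R\<^sup>2)\<close>. Hence for near-minimizers
  \<open>\<integral>\<integral> \<bar>u x\<bar>\<^sup>2 \<bar>u y\<bar>\<^sup>2 k\<close> is almost \<open>c\<^sup>2\<close>, so one ball of radius \<open>R\<close> carries almost all of the mass.

  A weak gradient controls translations, \<open>\<parallel>u (\<cdot> + h) - u\<parallel> \<le> \<bar>h\<bar> \<parallel>\<nabla>u\<parallel>\<close>; this yields both the Hardy-type
  bound for the Riesz potentials and, with tightness, \<open>L\<^sup>2\<close> compactness. Gradients then converge as well,
  by the parallelogram law and the lower bound for the energy of the midpoint of two near-minimizers.\<close>

section \<open>Test functions\<close>

text \<open>The gradient term is linear and both double integrals are quadratic in the mass; this is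
  why negativity holds above a threshold on \<open>c\<close>. The same count explains the fourth
  power in the normalisation of the cutoff: every term of the scaling inequality is, or is bounded
  by, a double integral over two densities, and each density of \<open>\<chi>_w u\<close> brings one
  squared cutoff. On the right-hand side \<open>k \<le> 1\<close> suffices, also for
  \<open>D2\<close>, which has the harmless sign. Only \<open>D1\<close> must be recovered in full;
  its error is of order \<open>R powr (- \<gamma>1)\<close>, because the quadratic defect of
  \<open>k\<close> compensates the singularity as \<open>\<gamma>1 < 2\<close>. The term with
  \<open>- m c\<close> becomes a multiple of the largest mass of a ball of radius \<open>R\<close>,
  and an energy near \<open>m c\<close> forces that mass to be near \<open>c\<close>.

  The potentials are bounded uniformly in the pole and with a free length scale. The scale makes the
  energy coercive; the uniformity makes both double integrals Lipschitz in \<open>L2\<close> on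
  bounded subsets of \<open>H1\<close>, which is what passes them to the midpoint and to the
  limit.\<close>

lemma frechet_derivative_worksI:
  "f differentiable F \<Longrightarrow> (f has_derivative frechet_derivative f F) F"
  by (simp add: frechet_derivative_works)

section \<open>Closure properties of the classes \<open>C_k\<close>\<close>

lemma C_k_Suc_D:
  assumes "C_k (Suc k) f" shows "C_k k f"
  using assms
proof (induction k arbitrary: f)
  case 0
  then show ?case by (auto intro!: differentiable_imp_continuous_on simp: differentiable_on_def differentiable_at_withinI)
next
  case (Suc k)
  have "f differentiable at x" for x using Suc.prems by simp
  moreover have "C_k k (\<lambda>x. frechet_derivative f (at x) v)" for v
    using Suc.prems by (intro Suc.IH) simp
  ultimately show ?case by simp
qed

lemma C_k_const: "C_k k (\<lambda>x. c)"
  by (induction k arbitrary: c) (simp_all add: frechet_derivative_const)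

lemma C_k_bounded_linear:
  assumes "bounded_linear f" shows "C_k k f"
proof (cases k)
  case 0
  then show ?thesis using assms by (simp add: linear_continuous_on)
next
  case (Suc m)
  have d: "(f has_derivative f) (at x)" for x
    using assms by (rule bounded_linear_imp_has_derivative)
  have "frechet_derivative f (at x) v = f v" for x v
    using frechet_derivative_at[OF d] by metis
  then show ?thesis using Suc d by (auto simp: C_k_const differentiable_def)
qed

lemma C_k_add:
  assumes "C_k k f" "C_k k g" shows "C_k k (\<lambda>x. f x + g x)"
  using assms
proof (induction k arbitrary: f g)
  case 0
  then show ?case by (auto intro: continuous_on_add)
next
  case (Suc k)
  have d: "f differentiable at x" "g differentiable at x" for x using Suc.prems by auto
  have "frechet_derivative (\<lambda>x. f x + g x) (at x) v
      = frechet_derivative f (at x) v + frechet_derivative g (at x) v" for x v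
    using frechet_derivative_at[OF has_derivative_add[OF
        d(1)[THEN frechet_derivative_worksI] d(2)[THEN frechet_derivative_worksI]]]
    by metis
  then show ?case using Suc d by simp
qed

lemma frechet_derivative_mult_eq:
  fixes f g :: "real^'n \<Rightarrow> real"
  assumes "f differentiable at x" "g differentiable at x"
  shows "frechet_derivative (\<lambda>x. f x * g x) (at x) v
      = f x * frechet_derivative g (at x) v + frechet_derivative f (at x) v * g x"
  using frechet_derivative_at[OF has_derivative_mult[OF
        assms(1)[THEN frechet_derivative_worksI] assms(2)[THEN frechet_derivative_worksI]]]
    by metis

lemma C_k_mult:
  assumes "C_k k f" "C_k k g" shows "C_k k (\<lambda>x. f x * g x)"
  using assms
proof (induction k arbitrary: f g)
  case 0
  then show ?case by (auto intro: continuous_on_mult)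
next
  case (Suc k)
  have d: "f differentiable at x" "g differentiable at x" for x using Suc.prems by auto
  have fg: "C_k k f" "C_k k g" using Suc.prems by (blast intro: C_k_Suc_D)+
  show ?case using Suc.prems fg by (auto simp: frechet_derivative_mult_eq d intro!: C_k_add Suc.IH)
qed

lemma C_k_prod:
  assumes "finite I" "\<And>i. i \<in> I \<Longrightarrow> C_k k (f i)" shows "C_k k (\<lambda>x. \<Prod>i\<in>I. f i x)"
  using assms by (induction I rule: finite_induct) (auto simp: C_k_const intro: C_k_mult)

lemma frechet_derivative_affine:
  fixes f :: "real^'n \<Rightarrow> real"
  assumes "f differentiable at (r *\<^sub>R x + a)"
  shows "((\<lambda>x. f (r *\<^sub>R x + a)) has_derivative (\<lambda>v. r * frechet_derivative f (at (r *\<^sub>R x + a)) v)) (at x)"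
proof -
  have "((\<lambda>x. r *\<^sub>R x + a) has_derivative (\<lambda>v. r *\<^sub>R v)) (at x)"
    by (auto intro!: derivative_eq_intros)
  from has_derivative_compose[OF this frechet_derivative_worksI[OF assms]]
  have "((\<lambda>x. f (r *\<^sub>R x + a)) has_derivative (\<lambda>v. frechet_derivative f (at (r *\<^sub>R x + a)) (r *\<^sub>R v))) (at x)" .
  moreover have "frechet_derivative f (at (r *\<^sub>R x + a)) (r *\<^sub>R v) = r * frechet_derivative f (at (r *\<^sub>R x + a)) v" for v
    using linear_frechet_derivative[OF assms] by (simp add: linear_cmul)
  ultimately show ?thesis by simp
qed

lemma C_k_affine:
  assumes "C_k k f" shows "C_k k (\<lambda>x. f (r *\<^sub>R x + a))"
  using assms
proof (induction k arbitrary: f)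
  case 0
  then show ?case
    by (auto intro!: continuous_on_compose2[of UNIV f] continuous_intros)
next
  case (Suc k)
  have d: "f differentiable at x" for x using Suc.prems by auto
  have e: "frechet_derivative (\<lambda>x. f (r *\<^sub>R x + a)) (at x) v
      = r * frechet_derivative f (at (r *\<^sub>R x + a)) v" for x v
    using frechet_derivative_at[OF frechet_derivative_affine[OF d]] by metis
  have "(\<lambda>x. f (r *\<^sub>R x + a)) differentiable at x" for x
    using frechet_derivative_affine[OF d] differentiable_def by blast
  moreover have "C_k k (\<lambda>x. r * frechet_derivative f (at (r *\<^sub>R x + a)) v)" for v
    using Suc.prems by (intro C_k_mult C_k_const Suc.IH[of "\<lambda>x. frechet_derivative f (at x) v"]) auto
  ultimately show ?case by (simp add: e)
qed

text \<open>The outer function comes as a whole family closed under differentiation: the chain rule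
  turns \<open>F j\<close> into \<open>F (Suc j)\<close> times a derivative of \<open>q\<close>, so
  the induction on \<open>k\<close> has to run over all \<open>j\<close> at once.\<close>

lemma C_k_compose:
  fixes F :: "nat \<Rightarrow> real \<Rightarrow> real"
  assumes F: "\<And>j t. (F j has_real_derivative F (Suc j) t) (at t)"
    and q: "\<And>k. C_k k q"
  shows "C_k k (\<lambda>x. F j (q x))"
proof (induction k arbitrary: j)
  case 0
  have "continuous_on UNIV (F j)"
    using F by (meson DERIV_continuous continuous_at_imp_continuous_on)
  moreover have "continuous_on UNIV q" using q[of 0] by simp
  ultimately show ?case by (auto intro: continuous_on_compose2[of UNIV "F j"])
next
  case (Suc k)
  have d: "q differentiable at x" for x using q[of "Suc 0"] by auto
  have D: "((\<lambda>x. F j (q x)) has_derivative (\<lambda>v. F (Suc j) (q x) * frechet_derivative q (at x) v)) (at x)" for x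
    using has_derivative_compose[OF frechet_derivative_worksI[OF d] F[unfolded has_field_derivative_def]]
    by simp
  have e: "frechet_derivative (\<lambda>x. F j (q x)) (at x) v = F (Suc j) (q x) * frechet_derivative q (at x) v" for x v
    using frechet_derivative_at[OF D] by metis
  have "C_k k (\<lambda>x. frechet_derivative q (at x) v)" for v
    using q[of "Suc k"] by simp
  then show ?case using D by (auto simp: e differentiable_def intro!: C_k_mult Suc.IH)
qed

text \<open>The functions \<open>p (1 / t) * exp (- 1 / t)\<close>, extended by \<open>0\<close>, are closed under differentiation.\<close>

definition expinv_poly :: "real poly \<Rightarrow> real \<Rightarrow> real" where
  "expinv_poly p t = (if t \<le> 0 then 0 else poly p (1 / t) * exp (- (1 / t)))"

lemma poly_mult_exp_minus_at_top: "((\<lambda>s. poly p s * exp (- s)) \<longlongrightarrow> (0::real)) at_top"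
proof -
  have "((\<lambda>s. \<Sum>i\<le>degree p. coeff p i * (s ^ i / exp s)) \<longlongrightarrow> (\<Sum>i\<le>degree p. coeff p i * 0)) at_top"
    by (intro tendsto_sum tendsto_mult tendsto_const tendsto_power_div_exp_0)
  then show ?thesis
    by (simp add: poly_altdef sum_distrib_right exp_minus divide_inverse mult.assoc)
qed

text \<open>With s = 1/t one has d/dt = - s^2 d/ds, and the derivative of p(s) exp(-s) in s is (p' -
  p)(s) exp(-s); the factor \<open>[:0,0,1:]\<close> is s^2. At 0 only the right-hand difference
  quotient has content, and it vanishes because the exponential beats every power of s.\<close>

lemma expinv_poly_derivative:
  "(expinv_poly p has_real_derivative expinv_poly ([:0,0,1:] * (p - pderiv p)) t) (at t)"
proof -
  consider "t < 0" | "t = 0" | "t > 0" by linarith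
  then show ?thesis
  proof cases
    case 1
    have "((\<lambda>_. 0) has_real_derivative 0) (at t)" by simp
    then have "(expinv_poly p has_real_derivative 0) (at t)"
      by (rule has_field_derivative_transform_within_open[where S="{..<0}"])
         (use 1 in \<open>auto simp: expinv_poly_def\<close>)
    then show ?thesis using 1 by (simp add: expinv_poly_def)
  next
    case 3
    have "((\<lambda>t. poly p (1 / t) * exp (- (1 / t))) has_real_derivative
        poly ([:0,0,1:] * (p - pderiv p)) (1/t) * exp (- (1 / t))) (at t)"
      using 3 by (auto intro!: derivative_eq_intros simp: field_simps power2_eq_square)
    then have "(expinv_poly p has_real_derivative poly ([:0,0,1:] * (p - pderiv p)) (1/t) * exp (- (1 / t))) (at t)"
      by (rule has_field_derivative_transform_within_open[where S="{0<..}"])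
         (use 3 in \<open>auto simp: expinv_poly_def\<close>)
    then show ?thesis using 3 by (simp add: expinv_poly_def)
  next
    case 2
    have r: "((\<lambda>h. expinv_poly p h / h) \<longlongrightarrow> 0) (at_right 0)"
    proof -
      \<comment> \<open>Division by \<open>h\<close> multiplies the polynomial by s = 1/h, so the
        quotient is again of the form treated by \<open>poly_mult_exp_minus_at_top\<close>.\<close>
      have "((\<lambda>h. poly ([:0,1:] * p) (inverse h) * exp (- inverse h)) \<longlongrightarrow> (0::real)) (at_right 0)"
        using poly_mult_exp_minus_at_top filterlim_inverse_at_top_right
        by (rule filterlim_compose)
      then show ?thesis
        by (rule Lim_transform_eventually)
          (auto simp: eventually_at_right_field expinv_poly_def field_simps intro!: exI[of _ 1])
    qed
    have l: "((\<lambda>h. expinv_poly p h / h) \<longlongrightarrow> 0) (at_left 0)"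
      by (rule Lim_transform_eventually[of "\<lambda>_. 0"])
        (auto simp: eventually_at_left_field expinv_poly_def intro!: exI[of _ "-1"])
    have "((\<lambda>h. expinv_poly p h / h) \<longlongrightarrow> 0) (at 0)"
      using l r by (simp add: filterlim_at_split)
    then have "(expinv_poly p has_real_derivative 0) (at 0)"
      by (simp add: DERIV_def expinv_poly_def)
    then show ?thesis using 2 by (simp add: expinv_poly_def)
  qed
qed

definition bump :: "real \<Rightarrow> real" where
  "bump t = (if t \<le> 0 then 0 else exp (- (1 / t)))"

lemma bump_nonneg: "0 \<le> bump t" and bump_le_1: "bump t \<le> 1"
  and bump_eq_0_iff: "bump t = 0 \<longleftrightarrow> t \<le> 0"
  by (auto simp: bump_def)

lemma C_k_bump:
  assumes "\<And>k. C_k k q" shows "C_k k (\<lambda>x. bump (q x))"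
proof -
  \<comment> \<open>\<open>P j\<close> is the polynomial of the \<open>j\<close>-th derivative of
    \<open>bump\<close>, which itself is \<open>expinv_poly 1\<close>.\<close>
  define P where "P = (\<lambda>j. ((\<lambda>p. [:0,0,1:] * (p - pderiv p)) ^^ j) (1 :: real poly))"
  have "C_k k (\<lambda>x. expinv_poly (P 0) (q x))"
    using expinv_poly_derivative assms
    by (intro C_k_compose[of "\<lambda>j. expinv_poly (P j)" q k 0]) (auto simp: P_def simp del: mult_pCons_left)
  then show ?thesis by (simp add: P_def expinv_poly_def bump_def cong: if_cong)
qed

lemma bump_tendsto_1:
  assumes "t > 0" shows "(\<lambda>n. bump (real n * t)) \<longlonglongrightarrow> 1"
proof -
  have "(\<lambda>n. exp (- (inverse t * inverse (real n)))) \<longlonglongrightarrow> exp (- (inverse t * 0))"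
    by (intro tendsto_intros lim_inverse_n)
  then have "(\<lambda>n. exp (- (inverse t * inverse (real n)))) \<longlonglongrightarrow> 1" by simp
  then show ?thesis
    by (rule Lim_transform_eventually)
       (use assms in \<open>auto simp: bump_def field_simps mult_le_0_iff eventually_sequentially intro!: exI[of _ 1]\<close>)
qed

section \<open>Supports, bounds and Lipschitz constants of test functions\<close>

lemma test_function_C_k: "test_function \<phi> \<Longrightarrow> C_k k \<phi>"
  by (simp add: test_function_def)

lemma test_function_differentiable: "test_function \<phi> \<Longrightarrow> \<phi> differentiable (at x)"
  using test_function_C_k[of \<phi> "Suc 0"] by simp

lemma test_function_continuous: "test_function \<phi> \<Longrightarrow> continuous_on UNIV \<phi>"
  using test_function_C_k[of \<phi> 0] by simp

lemma test_functionI: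
  assumes "\<And>k. C_k k \<phi>" "bounded {x. \<phi> x \<noteq> 0}" shows "test_function \<phi>"
  using assms unfolding test_function_def by (simp add: bounded_closure compact_eq_bounded_closed)

lemma test_function_bounded_support: "test_function \<phi> \<Longrightarrow> bounded {x. \<phi> x \<noteq> 0}"
  by (auto simp: test_function_def intro: bounded_subset[OF compact_imp_bounded closure_subset])

lemma test_function_mult:
  assumes "\<And>k. C_k k f" "test_function \<phi>" shows "test_function (\<lambda>x. f x * \<phi> x)"
proof (rule test_functionI)
  show "bounded {x. f x * \<phi> x \<noteq> 0}"
    by (rule bounded_subset[OF test_function_bounded_support[OF assms(2)]]) auto
qed (intro C_k_mult assms test_function_C_k)

lemma test_function_affine:
  fixes \<phi> :: "real^'n \<Rightarrow> real"
  assumes "test_function \<phi>" "r \<noteq> 0" shows "test_function (\<lambda>x. \<phi> (r *\<^sub>R x + a))"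
proof (rule test_functionI)
  obtain B where B: "\<And>x. \<phi> x \<noteq> 0 \<Longrightarrow> norm x \<le> B"
    using test_function_bounded_support[OF assms(1)] by (auto simp: bounded_iff)
  have "norm x \<le> (B + norm a) / \<bar>r\<bar>" if "\<phi> (r *\<^sub>R x + a) \<noteq> 0" for x
  proof -
    have "\<bar>r\<bar> * norm x = norm ((r *\<^sub>R x + a) - a)" by simp
    also have "\<dots> \<le> B + norm a" using B[OF that] norm_triangle_ineq4[of "r *\<^sub>R x + a" a] by linarith
    finally show ?thesis using assms(2) by (simp add: field_simps)
  qed
  then show "bounded {x. \<phi> (r *\<^sub>R x + a) \<noteq> 0}" by (auto simp: bounded_iff)
qed (auto intro: C_k_affine assms test_function_C_k)

lemma test_function_derivative:
  fixes \<phi> :: "real^'n \<Rightarrow> real"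
  assumes "test_function \<phi>" shows "test_function (\<lambda>x. frechet_derivative \<phi> (at x) v)"
proof -
  have "frechet_derivative \<phi> (at x) v = 0" if "x \<notin> closure {x. \<phi> x \<noteq> 0}" for x
  proof -
    have "(\<phi> has_derivative (\<lambda>_. 0)) (at x)"
      by (rule has_derivative_transform_within_open[of "\<lambda>_. 0" _ _ _ "- closure {x. \<phi> x \<noteq> 0}"])
         (use that closure_subset[of "{x. \<phi> x \<noteq> 0}"] in auto)
    from frechet_derivative_at[OF this] show ?thesis by metis
  qed
  then have "{x. frechet_derivative \<phi> (at x) v \<noteq> 0} \<subseteq> closure {x. \<phi> x \<noteq> 0}" by auto
  then have "bounded {x. frechet_derivative \<phi> (at x) v \<noteq> 0}"
    by (rule bounded_subset[rotated]) (use assms in \<open>auto simp: test_function_def intro: compact_imp_bounded\<close>)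
  moreover have "C_k k (\<lambda>x. frechet_derivative \<phi> (at x) v)" for k
    using test_function_C_k[OF assms, of "Suc k"] by simp
  ultimately show ?thesis by (rule test_functionI[rotated])
qed

lemma test_function_measurable [measurable]: "test_function \<phi> \<Longrightarrow> \<phi> \<in> borel_measurable borel"
  by (simp add: borel_measurable_continuous_onI test_function_continuous)

lemma test_function_bound:
  fixes \<phi> :: "real^'n \<Rightarrow> real"
  assumes "test_function \<phi>" obtains B where "0 < B" "\<And>x. \<bar>\<phi> x\<bar> \<le> B"
proof -
  have "compact (\<phi> ` closure {x. \<phi> x \<noteq> 0})"
    using assms by (intro compact_continuous_image)
      (auto simp: test_function_def intro: continuous_on_subset[OF test_function_continuous])
  then have "bounded (\<phi> ` closure {x. \<phi> x \<noteq> 0})" by (rule compact_imp_bounded)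
  then obtain B where "0 < B" and B: "\<And>x. x \<in> closure {x. \<phi> x \<noteq> 0} \<Longrightarrow> \<bar>\<phi> x\<bar> \<le> B"
    unfolding bounded_pos by auto
  then have "\<bar>\<phi> x\<bar> \<le> B" for x
    using closure_subset[of "{x. \<phi> x \<noteq> 0}"] by (cases "\<phi> x = 0") auto
  with \<open>0 < B\<close> that show thesis by blast
qed

lemma test_function_integrable_bound:
  fixes \<phi> :: "real^'n \<Rightarrow> real" and f :: "real^'n \<Rightarrow> 'b::{banach, second_countable_topology}"
  assumes \<phi>: "test_function \<phi>" and [measurable]: "f \<in> borel_measurable borel"
    and f: "\<And>x. norm (f x) \<le> C * indicator {x. \<phi> x \<noteq> 0} x"
  shows "integrable lborel f"
proof -
  have m: "{x. \<phi> x \<noteq> 0} \<in> sets borel" using test_function_measurable[OF \<phi>] by measurable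
  obtain a b where "{x. \<phi> x \<noteq> 0} \<subseteq> cbox a b"
    using bounded_subset_cbox_symmetric[OF test_function_bounded_support[OF \<phi>]] by blast
  then have "emeasure lborel {x. \<phi> x \<noteq> 0} \<le> emeasure lborel (cbox a b)"
    by (intro emeasure_mono) auto
  also have "\<dots> < \<infinity>" using emeasure_lborel_cbox_finite[of a b] by simp
  finally have "integrable lborel (\<lambda>x. C * indicator {x. \<phi> x \<noteq> 0} x :: real)"
    using m by (intro integrable_mult_right) auto
  then show ?thesis
    by (rule Bochner_Integration.integrable_bound)
       (auto intro!: AE_I2 order_trans[OF f] simp: abs_mult mult_right_mono)
qed

lemma test_function_integrable_power:
  fixes \<phi> :: "real^'n \<Rightarrow> real"
  assumes "test_function \<phi>" "k > 0" shows "integrable lborel (\<lambda>x. \<phi> x ^ k)"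
proof -
  obtain B where B: "0 < B" "\<And>x. \<bar>\<phi> x\<bar> \<le> B" using test_function_bound[OF assms(1)] by blast
  note [measurable] = test_function_measurable[OF assms(1)]
  show ?thesis
    by (rule test_function_integrable_bound[OF assms(1), where C="B ^ k"])
       (use B assms(2) in \<open>auto simp: indicator_def power_abs power_mono zero_power\<close>)
qed

lemma test_function_derivative_bound:
  fixes \<phi> :: "real^'n \<Rightarrow> real"
  assumes "test_function \<phi>"
  obtains L where "0 < L" "\<And>x v. \<bar>frechet_derivative \<phi> (at x) v\<bar> \<le> L * norm v"
proof -
  have "\<forall>b. \<exists>B. 0 < B \<and> (\<forall>x. \<bar>frechet_derivative \<phi> (at x) b\<bar> \<le> B)"
    using test_function_bound[OF test_function_derivative[OF assms]] by metis
  then obtain B where B: "\<And>b. 0 < B b" "\<And>b x. \<bar>frechet_derivative \<phi> (at x) b\<bar> \<le> B b" by metis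
  define L where "L = (\<Sum>b\<in>(Basis::(real^'n) set). B b) + 1"
  have "\<bar>frechet_derivative \<phi> (at x) v\<bar> \<le> L * norm v" for x v
  proof -
    have l: "linear (frechet_derivative \<phi> (at x))"
      by (rule linear_frechet_derivative[OF test_function_differentiable[OF assms]])
    have "frechet_derivative \<phi> (at x) v = frechet_derivative \<phi> (at x) (\<Sum>b\<in>Basis. (v \<bullet> b) *\<^sub>R b)"
      by (simp add: euclidean_representation)
    also have "\<dots> = (\<Sum>b\<in>Basis. (v \<bullet> b) * frechet_derivative \<phi> (at x) b)"
      using l by (simp add: linear_sum linear_cmul)
    also have "\<bar>\<dots>\<bar> \<le> (\<Sum>b\<in>Basis. \<bar>v \<bullet> b\<bar> * \<bar>frechet_derivative \<phi> (at x) b\<bar>)"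
      by (rule order_trans[OF sum_abs]) (simp add: abs_mult)
    also have "\<dots> \<le> (\<Sum>b\<in>Basis. norm v * B b)"
      by (intro sum_mono mult_mono B Basis_le_norm) auto
    also have "\<dots> \<le> L * norm v" by (simp add: L_def distrib_right mult.commute[of _ "sum B Basis"] flip: sum_distrib_left)
    finally show ?thesis .
  qed
  moreover have "0 < L" unfolding L_def using B(1) by (simp add: sum_nonneg add_nonneg_pos less_imp_le)
  ultimately show thesis using that by blast
qed

lemma test_function_Lipschitz:
  fixes \<phi> :: "real^'n \<Rightarrow> real"
  assumes "test_function \<phi>"
  obtains L where "0 < L" "\<And>x y. \<bar>\<phi> x - \<phi> y\<bar> \<le> L * norm (x - y)"
proof -
  obtain L where L: "0 < L" "\<And>x v. \<bar>frechet_derivative \<phi> (at x) v\<bar> \<le> L * norm v"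
    using test_function_derivative_bound[OF assms] by metis
  have "norm (\<phi> x - \<phi> y) \<le> L * norm (x - y)" for x y
  proof (rule differentiable_bound[of UNIV])
    show "(\<phi> has_derivative frechet_derivative \<phi> (at z)) (at z within UNIV)" for z
      by (simp add: frechet_derivative_worksI test_function_differentiable[OF assms])
    show "onorm (frechet_derivative \<phi> (at z)) \<le> L" for z
      using L by (intro onorm_le) auto
  qed auto
  with L(1) that show thesis by (metis real_norm_def)
qed

section \<open>Square integrable functions\<close>

lemma nn_integral_translate:
  fixes a :: "'a::euclidean_space"
  assumes [measurable]: "f \<in> borel_measurable borel"
  shows "(\<integral>\<^sup>+x. f (x + a) \<partial>lborel) = (\<integral>\<^sup>+x. f x \<partial>lborel)"
  by (subst (2) lborel_distr_plus[symmetric, of a]) (simp add: nn_integral_distr add.commute)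

lemma nn_integral_reflect:
  fixes a :: "'a::euclidean_space"
  assumes [measurable]: "f \<in> borel_measurable borel"
  shows "(\<integral>\<^sup>+x. f (a - x) \<partial>lborel) = (\<integral>\<^sup>+x. f x \<partial>lborel)"
  by (subst (2) lborel_affine[of "-1" a]) (simp_all add: nn_integral_density nn_integral_distr)

lemma integral_translate:
  fixes a :: "'a::euclidean_space" and f :: "'a \<Rightarrow> 'b::{banach, second_countable_topology}"
  assumes [measurable]: "f \<in> borel_measurable borel"
  shows "(LINT x|lborel. f (x + a)) = (LINT x|lborel. f x)"
  by (subst (2) lborel_distr_plus[symmetric, of a]) (simp add: integral_distr add.commute)

lemma integrable_translate:
  fixes a :: "'a::euclidean_space" and f :: "'a \<Rightarrow> 'b::{banach, second_countable_topology}"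
  assumes "integrable lborel f"
  shows "integrable lborel (\<lambda>x. f (x + a))"
proof -
  have [measurable]: "f \<in> borel_measurable borel" using assms by auto
  have "(\<integral>\<^sup>+x. ennreal (norm (f (x + a))) \<partial>lborel) = (\<integral>\<^sup>+x. ennreal (norm (f x)) \<partial>lborel)"
    by (rule nn_integral_translate) measurable
  then show ?thesis using assms by (simp add: integrable_iff_bounded)
qed

text \<open>The value is 0 when the square is not integrable, so an upper bound on
  \<open>l2norm\<close> carries information only together with membership in
  \<open>L2\<close>.\<close>

definition l2norm :: "(real^'n \<Rightarrow> 'b::euclidean_space) \<Rightarrow> real" where
  "l2norm f = sqrt (LINT x|lborel. (norm (f x))\<^sup>2)"

lemma l2norm_nonneg [simp]: "0 \<le> l2norm f"
  by (simp add: l2norm_def)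

lemma l2norm_square: "(l2norm f)\<^sup>2 = (LINT x|lborel. (norm (f x))\<^sup>2)"
  by (simp add: l2norm_def)

lemma L2_measurable: "f \<in> L2 \<Longrightarrow> f \<in> borel_measurable borel"
  by (simp add: L2_def)

lemma L2_integrable: "f \<in> L2 \<Longrightarrow> integrable lborel (\<lambda>x. (norm (f x))\<^sup>2)"
  by (simp add: L2_def)

lemma L2_iff: "f \<in> L2 \<longleftrightarrow> f \<in> borel_measurable borel \<and> (\<integral>\<^sup>+x. ennreal ((norm (f x))\<^sup>2) \<partial>lborel) < \<infinity>"
  unfolding L2_def by (auto simp: integrable_iff_bounded)

lemma nn_integral_L2: "f \<in> L2 \<Longrightarrow> (\<integral>\<^sup>+x. ennreal ((norm (f x))\<^sup>2) \<partial>lborel) = ennreal ((l2norm f)\<^sup>2)"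
  unfolding l2norm_square by (intro nn_integral_eq_integral L2_integrable) auto

lemma l2norm_le_iff_nn:
  assumes "f \<in> L2" "0 \<le> C"
  shows "l2norm f \<le> C \<longleftrightarrow> (\<integral>\<^sup>+x. ennreal ((norm (f x))\<^sup>2) \<partial>lborel) \<le> ennreal (C\<^sup>2)"
  by (simp add: nn_integral_L2[OF assms(1)] assms(2))

lemma L2_bound:
  assumes "f \<in> borel_measurable borel" "integrable lborel h" "\<And>x. (norm (f x))\<^sup>2 \<le> h x"
  shows "f \<in> L2"
  unfolding L2_def using assms(1)
  by (auto intro!: Bochner_Integration.integrable_bound[OF assms(2)] AE_I2 order_trans[OF assms(3)])

lemma norm_add_square_le: "(norm (a + b))\<^sup>2 \<le> 2 * (norm a)\<^sup>2 + 2 * (norm (b::'a::real_normed_vector))\<^sup>2"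
proof -
  have "(norm (a + b))\<^sup>2 \<le> (norm a + norm b)\<^sup>2" by (intro power_mono norm_triangle_ineq) auto
  then show ?thesis using sum_squares_bound[of "norm a" "norm b"] by (simp add: power2_sum)
qed

lemma L2_add: assumes "f \<in> L2" "g \<in> L2" shows "(\<lambda>x. f x + g x) \<in> L2"
proof -
  note [measurable] = assms[THEN L2_measurable]
  have "integrable lborel (\<lambda>x. 2 * (norm (f x))\<^sup>2 + 2 * (norm (g x))\<^sup>2)"
    by (intro Bochner_Integration.integrable_add integrable_mult_right L2_integrable assms)
  then show ?thesis by (rule L2_bound[rotated]) (auto intro: norm_add_square_le)
qed

lemma L2_scaleR: assumes "f \<in> L2" shows "(\<lambda>x. c *\<^sub>R f x) \<in> L2"
proof -
  note [measurable] = assms[THEN L2_measurable]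
  have "integrable lborel (\<lambda>x. c\<^sup>2 * (norm (f x))\<^sup>2)"
    by (intro integrable_mult_right L2_integrable assms)
  then show ?thesis by (rule L2_bound[rotated]) (auto simp: power_mult_distrib)
qed

lemma L2_diff: assumes "f \<in> L2" "g \<in> L2" shows "(\<lambda>x. f x - g x) \<in> L2"
  using L2_add[OF assms(1) L2_scaleR[OF assms(2), of "-1"]] by simp

lemma L2_dominated:
  assumes "f \<in> borel_measurable borel" "g \<in> L2" "\<And>x. norm (f x) \<le> C * norm (g x)"
  shows "f \<in> L2"
proof -
  have "integrable lborel (\<lambda>x. C\<^sup>2 * (norm (g x))\<^sup>2)"
    by (intro integrable_mult_right L2_integrable assms)
  moreover have "(norm (f x))\<^sup>2 \<le> C\<^sup>2 * (norm (g x))\<^sup>2" for x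
    using power_mono[OF assms(3)[of x], of 2] by (simp add: power_mult_distrib)
  ultimately show ?thesis by (rule L2_bound[OF assms(1)])
qed

lemma L2_translate: assumes "f \<in> L2" shows "(\<lambda>x. f (x + a)) \<in> L2"
  using assms integrable_translate[OF L2_integrable[OF assms], of a] L2_measurable[OF assms]
  by (auto simp: L2_def)

lemma l2norm_translate: assumes "f \<in> L2" shows "l2norm (\<lambda>x. f (x + a)) = l2norm f"
  using L2_measurable[OF assms] unfolding l2norm_def
  by (subst integral_translate[where f="\<lambda>x. (norm (f x))\<^sup>2"]) auto

lemma l2norm_scaleR: "l2norm (\<lambda>x. c *\<^sub>R f x) = \<bar>c\<bar> * l2norm f"
  by (simp add: l2norm_def power_mult_distrib real_sqrt_mult)

lemma l2norm_minus_commute: "l2norm (\<lambda>x. f x - g x) = l2norm (\<lambda>x. g x - f x)"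
  by (simp add: l2norm_def norm_minus_commute)

lemma L2_integrable_mult:
  assumes "f \<in> L2" "g \<in> L2" shows "integrable lborel (\<lambda>x. norm (f x) * norm (g x))"
proof (rule Bochner_Integration.integrable_bound)
  show "integrable lborel (\<lambda>x. (norm (f x))\<^sup>2 + (norm (g x))\<^sup>2)"
    using assms by (auto intro: L2_integrable)
  have "norm (f x) * norm (g x) \<le> (norm (f x))\<^sup>2 + (norm (g x))\<^sup>2" for x
    using sum_squares_bound[of "norm (f x)" "norm (g x)"]
      mult_nonneg_nonneg[of "norm (f x)" "norm (g x)"] norm_ge_zero[of "f x"] norm_ge_zero[of "g x"] by linarith
  then show "AE x in lborel. norm (norm (f x) * norm (g x)) \<le> norm ((norm (f x))\<^sup>2 + (norm (g x))\<^sup>2)"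
    by simp
qed (use assms in \<open>auto dest!: L2_measurable\<close>)

lemma L2_Cauchy_Schwarz:
  assumes "f \<in> L2" "g \<in> L2"
  shows "(LINT x|lborel. norm (f x) * norm (g x)) \<le> l2norm f * l2norm g"
proof -
  note [measurable] = assms[THEN L2_measurable]
  have "ennreal ((LINT x|lborel. norm (f x) * norm (g x))\<^sup>2) = (\<integral>\<^sup>+x. ennreal (norm (f x)) * ennreal (norm (g x)) \<partial>lborel)\<^sup>2"
    by (simp add: nn_integral_eq_integral[OF L2_integrable_mult[OF assms]] ennreal_power flip: ennreal_mult)
  also have "\<dots> \<le> (\<integral>\<^sup>+x. (ennreal (norm (f x)))\<^sup>2 \<partial>lborel) * (\<integral>\<^sup>+x. (ennreal (norm (g x)))\<^sup>2 \<partial>lborel)"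
    by (rule Cauchy_Schwarz_nn_integral) auto
  also have "\<dots> = ennreal ((l2norm f * l2norm g)\<^sup>2)"
    by (simp add: ennreal_power nn_integral_L2 assms power_mult_distrib ennreal_mult)
  finally have "(LINT x|lborel. norm (f x) * norm (g x))\<^sup>2 \<le> (l2norm f * l2norm g)\<^sup>2"
    by simp
  then show ?thesis by (rule power2_le_imp_le) auto
qed

lemma
  fixes h :: "real^'n \<Rightarrow> 'c::{banach, second_countable_topology}"
  assumes "f \<in> L2" "g \<in> L2" "h \<in> borel_measurable borel" "\<And>x. norm (h x) \<le> norm (f x) * norm (g x)"
  shows L2_bilinear_integrable: "integrable lborel h"
    and L2_bilinear_le: "norm (LINT x|lborel. h x) \<le> l2norm f * l2norm g"
proof -
  show i: "integrable lborel h"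
    by (rule Bochner_Integration.integrable_bound[OF L2_integrable_mult[OF assms(1,2)]])
       (use assms in auto)
  have "norm (LINT x|lborel. h x) \<le> (LINT x|lborel. norm (h x))" by (rule integral_norm_bound)
  also have "\<dots> \<le> (LINT x|lborel. norm (f x) * norm (g x))"
    by (intro integral_mono integrable_norm i L2_integrable_mult assms)
  also have "\<dots> \<le> l2norm f * l2norm g" by (rule L2_Cauchy_Schwarz[OF assms(1,2)])
  finally show "norm (LINT x|lborel. h x) \<le> l2norm f * l2norm g" .
qed

lemma l2norm_triangle:
  assumes "f \<in> L2" "g \<in> L2" shows "l2norm (\<lambda>x. f x + g x) \<le> l2norm f + l2norm g"
proof (rule power2_le_imp_le)
  have "(l2norm (\<lambda>x. f x + g x))\<^sup>2 \<le> (LINT x|lborel. (norm (f x))\<^sup>2 + 2 * (norm (f x) * norm (g x)) + (norm (g x))\<^sup>2)"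
    unfolding l2norm_square
  proof (intro integral_mono)
    show "(norm (f x + g x))\<^sup>2 \<le> (norm (f x))\<^sup>2 + 2 * (norm (f x) * norm (g x)) + (norm (g x))\<^sup>2" for x
      using power_mono[OF norm_triangle_ineq[of "f x" "g x"], of 2] by (simp add: power2_sum)
  qed (intro Bochner_Integration.integrable_add integrable_mult_right L2_integrable L2_integrable_mult L2_add assms)+
  also have "\<dots> = (l2norm f)\<^sup>2 + 2 * (LINT x|lborel. norm (f x) * norm (g x)) + (l2norm g)\<^sup>2"
    using assms by (simp add: L2_integrable L2_integrable_mult l2norm_square)
  also have "\<dots> \<le> (l2norm f + l2norm g)\<^sup>2"
    using L2_Cauchy_Schwarz[OF assms] by (simp add: power2_sum)
  finally show "(l2norm (\<lambda>x. f x + g x))\<^sup>2 \<le> (l2norm f + l2norm g)\<^sup>2" .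
qed auto

lemma l2norm_diff_le:
  assumes "f \<in> L2" "g \<in> L2" shows "\<bar>l2norm f - l2norm g\<bar> \<le> l2norm (\<lambda>x. f x - g x)"
  using l2norm_triangle[OF L2_diff[OF assms] assms(2)] l2norm_triangle[OF L2_diff[OF assms(2,1)] assms(1)]
    l2norm_minus_commute[of f g] by simp

lemma l2norm_cong_AE:
  assumes "f \<in> borel_measurable borel" "g \<in> borel_measurable borel" "AE x in lborel. f x = g x"
  shows "l2norm f = l2norm g"
  unfolding l2norm_def using assms by (intro arg_cong[where f=sqrt] integral_cong_AE) auto

text \<open>Riesz-Fischer. A subsequence with rapidly decreasing increments converges almost
  everywhere, and Fatou's lemma carries the Cauchy estimate of the full sequence over to the
  pointwise limit.\<close>

lemma L2_complete:
  fixes f :: "nat \<Rightarrow> real^'n \<Rightarrow> 'b::euclidean_space"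
  assumes L2: "\<And>n. f n \<in> L2"
    and Cauchy: "\<And>e. e > 0 \<Longrightarrow> \<exists>M. \<forall>m\<ge>M. \<forall>n\<ge>M. l2norm (\<lambda>x. f m x - f n x) < e"
  obtains g where "g \<in> L2" "(\<lambda>n. l2norm (\<lambda>x. f n x - g x)) \<longlonglongrightarrow> 0"
proof -
  note [measurable] = L2[THEN L2_measurable]
  obtain M where M: "\<And>k m n. m \<ge> M k \<Longrightarrow> n \<ge> M k \<Longrightarrow> l2norm (\<lambda>x. f m x - f n x) < (1/2) ^ k"
    using Cauchy[of "(1/2) ^ _"] by (metis zero_less_power half_gt_zero_iff zero_less_one)
  \<comment> \<open>Partial sums make the indices monotone while keeping \<open>r k\<close> above
    \<open>M k\<close>.\<close>
  define r where "r k = (\<Sum>i\<le>k. M i)" for k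
  have r: "M k \<le> r k" "r k \<le> r (Suc k)" for k
    unfolding r_def by (auto intro: member_le_sum)
  define d where "d k x = f (r (Suc k)) x - f (r k) x" for k x
  have dL2: "d k \<in> L2" for k unfolding d_def by (intro L2_diff L2)
  note [measurable] = dL2[THEN L2_measurable]
  have d: "(\<integral>\<^sup>+x. ennreal ((norm (d k x))\<^sup>2) \<partial>lborel) \<le> ennreal ((1/4) ^ k)" for k
  proof -
    have "l2norm (d k) \<le> (1/2) ^ k" unfolding d_def using M[of k "r (Suc k)" "r k"] r[of k] by simp
    then have "(l2norm (d k))\<^sup>2 \<le> (1/4) ^ k"
      using power_mono[of "l2norm (d k)" "(1/2)^k" 2] by (simp add: power2_eq_square flip: power_mult_distrib)
    then show ?thesis by (simp add: nn_integral_L2[OF dL2])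
  qed
  \<comment> \<open>The squared increments decay like 4^-k, so a weight 2^k can be spent on them.
    Finiteness of the weighted sum at almost every point bounds \<open>d k x\<close> by a geometric
    sequence of ratio 1 / sqrt 2, and the telescoping series converges absolutely.\<close>
  have "(\<integral>\<^sup>+x. (\<Sum>k. ennreal (2 ^ k * (norm (d k x))\<^sup>2)) \<partial>lborel)
      = (\<Sum>k. ennreal (2 ^ k) * (\<integral>\<^sup>+x. ennreal ((norm (d k x))\<^sup>2) \<partial>lborel))"
    by (subst nn_integral_suminf) (auto simp: ennreal_mult nn_integral_cmult)
  also have "\<dots> \<le> (\<Sum>k. ennreal ((1/2) ^ k))"
  proof (intro suminf_le)
    fix k
    have "ennreal (2 ^ k) * (\<integral>\<^sup>+x. ennreal ((norm (d k x))\<^sup>2) \<partial>lborel) \<le> ennreal (2 ^ k) * ennreal ((1/4) ^ k)"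
      by (intro mult_left_mono d) auto
    also have "\<dots> = ennreal ((1/2) ^ k)" by (simp flip: ennreal_mult power_mult_distrib)
    finally show "ennreal (2 ^ k) * (\<integral>\<^sup>+x. ennreal ((norm (d k x))\<^sup>2) \<partial>lborel) \<le> ennreal ((1/2) ^ k)" .
  qed auto
  also have "\<dots> < \<infinity>" by (subst suminf_ennreal2) (auto simp: summable_geometric)
  finally have "(\<integral>\<^sup>+x. (\<Sum>k. ennreal (2 ^ k * (norm (d k x))\<^sup>2)) \<partial>lborel) \<noteq> \<infinity>" by simp
  then have fin: "AE x in lborel. (\<Sum>k. ennreal (2 ^ k * (norm (d k x))\<^sup>2)) \<noteq> \<infinity>"
    by (intro nn_integral_noteq_infinite) auto
  define g where "g x = lim (\<lambda>k. f (r k) x)" for x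
  have [measurable]: "g \<in> borel_measurable borel"
    unfolding g_def by (rule borel_measurable_lim_metric) auto
  have g: "AE x in lborel. (\<lambda>k. f (r k) x) \<longlonglongrightarrow> g x"
    using fin
  proof eventually_elim
    case (elim x)
    define a where "a k = ennreal (2 ^ k * (norm (d k x))\<^sup>2)" for k
    have "suminf a \<noteq> \<infinity>" using elim by (simp add: a_def[abs_def])
    then obtain C where C: "suminf a = ennreal C" "C \<ge> 0" by (cases "suminf a") auto
    have n: "norm (d k x) \<le> sqrt C * (1 / sqrt 2) ^ k" for k
    proof (rule power2_le_imp_le)
      have "a k \<le> suminf a" using sum_le_suminf[of a "{k}"] by simp
      then have "2 ^ k * (norm (d k x))\<^sup>2 \<le> C" using C by (simp add: a_def)
      moreover have "((1 / sqrt 2) ^ k)\<^sup>2 = 1 / 2 ^ k"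
        by (simp add: power_divide power_mult[symmetric] mult.commute[of k]) (simp add: power_mult)
      ultimately show "(norm (d k x))\<^sup>2 \<le> (sqrt C * (1 / sqrt 2) ^ k)\<^sup>2"
        using C by (simp add: power_mult_distrib field_simps)
      show "0 \<le> sqrt C * (1 / sqrt 2) ^ k" using C by simp
    qed
    have "norm (1 / sqrt 2 :: real) < 1" by simp
    then have "summable (\<lambda>k. sqrt C * (1 / sqrt 2) ^ k)"
      by (intro summable_mult summable_geometric)
    then have "summable (\<lambda>k. d k x)" by (rule summable_comparison_test') (rule n)
    then have "(\<lambda>n. \<Sum>k<n. d k x) \<longlonglongrightarrow> (\<Sum>k. d k x)" by (rule summable_LIMSEQ)
    then have "(\<lambda>n. (f (r n) x - f (r 0) x) + f (r 0) x) \<longlonglongrightarrow> (\<Sum>k. d k x) + f (r 0) x"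
      unfolding d_def using sum_lessThan_telescope[of "\<lambda>k. f (r k) x"] by (intro tendsto_add tendsto_const) simp
    then have "(\<lambda>n. f (r n) x) \<longlonglongrightarrow> (\<Sum>k. d k x) + f (r 0) x" by simp
    then show ?case unfolding g_def by (metis limI)
  qed
  have tail: "(\<integral>\<^sup>+x. ennreal ((norm (f n x - g x))\<^sup>2) \<partial>lborel) \<le> ennreal (((1/2) ^ j)\<^sup>2)" if "n \<ge> M j" for n j
  proof -
    have "(\<integral>\<^sup>+x. ennreal ((norm (f n x - g x))\<^sup>2) \<partial>lborel)
       = (\<integral>\<^sup>+x. liminf (\<lambda>k. ennreal ((norm (f n x - f (r k) x))\<^sup>2)) \<partial>lborel)"
      using g
    proof (intro nn_integral_cong_AE, eventually_elim)
      case (elim x)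
      have "(\<lambda>k. ennreal ((norm (f n x - f (r k) x))\<^sup>2)) \<longlonglongrightarrow> ennreal ((norm (f n x - g x))\<^sup>2)"
        by (intro tendsto_ennrealI tendsto_power tendsto_norm tendsto_diff tendsto_const elim)
      from lim_imp_Liminf[OF _ this] show ?case by simp
    qed
    also have "\<dots> \<le> liminf (\<lambda>k. (\<integral>\<^sup>+x. ennreal ((norm (f n x - f (r k) x))\<^sup>2) \<partial>lborel))"
      by (rule nn_integral_liminf) auto
    also have "\<dots> \<le> limsup (\<lambda>k. (\<integral>\<^sup>+x. ennreal ((norm (f n x - f (r k) x))\<^sup>2) \<partial>lborel))"
      by (rule Liminf_le_Limsup) auto
    also have "\<dots> \<le> ennreal (((1/2) ^ j)\<^sup>2)"
    proof (rule Limsup_bounded, rule eventually_sequentiallyI[of j])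
      fix k assume "k \<ge> j"
      have "r j \<le> r k" using r(2) \<open>k \<ge> j\<close> by (rule lift_Suc_mono_le)
      then have "M j \<le> r k" using r(1)[of j] by linarith
      from M[OF that this] have "l2norm (\<lambda>x. f n x - f (r k) x) \<le> (1/2) ^ j" by simp
      then show "(\<integral>\<^sup>+x. ennreal ((norm (f n x - f (r k) x))\<^sup>2) \<partial>lborel) \<le> ennreal (((1/2) ^ j)\<^sup>2)"
        by (subst (asm) l2norm_le_iff_nn) (auto intro: L2_diff L2)
    qed
    finally show ?thesis .
  qed
  \<comment> \<open>The tail bound at a single index already puts the difference, and with it
    \<open>g\<close>, into \<open>L2\<close>.\<close>
  have "(\<lambda>x. f (M 0) x - g x) \<in> L2"
    unfolding L2_iff using tail[of 0 "M 0"] by (auto intro: le_less_trans)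
  from L2_diff[OF L2 this, of "M 0"] have gL2: "g \<in> L2" by simp
  have le: "l2norm (\<lambda>x. f n x - g x) \<le> (1/2) ^ j" if "n \<ge> M j" for n j
    using tail[OF that] by (subst l2norm_le_iff_nn) (auto intro: L2_diff L2 gL2)
  have "(\<lambda>n. l2norm (\<lambda>x. f n x - g x)) \<longlonglongrightarrow> 0"
  proof (rule LIMSEQ_I)
    fix e :: real assume "e > 0"
    then obtain j where "(1/2) ^ j < e" using real_arch_pow_inv[of e "1/2"] by auto
    then show "\<exists>no. \<forall>n\<ge>no. norm (l2norm (\<lambda>x. f n x - g x) - 0) < e"
      using le[of j] by (intro exI[of _ "M j"]) (fastforce intro: le_less_trans)
  qed
  with gL2 that show thesis by blast
qed

section \<open>Weak gradients\<close>

text \<open>Dynkin's pi-lambda argument: boxes are stable under intersection and generate the Borel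
  sets. Complements need the integral over the whole space, which is the limit of the integrals over
  an exhausting sequence of boxes.\<close>

lemma borel_measurable_box_induct:
  fixes F :: "real^'n \<Rightarrow> 'b::{banach, second_countable_topology}"
  assumes F: "integrable lborel F" and box: "\<And>a b. (LINT x:box a b|lborel. F x) = 0"
    and A: "A \<in> sets borel"
  shows "(LINT x:A|lborel. F x) = 0"
proof -
  let ?E = "range (\<lambda>(a, b). box a b) :: (real^'n) set set"
  have si: "set_integrable lborel A F" if "A \<in> sets borel" for A
    using integrable_mult_indicator[OF _ F, of A] that by (simp add: set_integrable_def)
  have all: "(LINT x|lborel. F x) = 0"
  proof -
    define S where "S n = box (- (real n *\<^sub>R One)) (real n *\<^sub>R One :: real^'n)" for n
    have "(\<lambda>n. LINT x|lborel. indicator (S n) x *\<^sub>R F x) \<longlonglongrightarrow> (LINT x|lborel. F x)"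
    proof (rule integral_dominated_convergence[where w="\<lambda>x. norm (F x)"])
      have "(\<lambda>n. indicat_real (S n) x *\<^sub>R F x) \<longlonglongrightarrow> F x" for x
      proof -
        have "x \<in> (\<Union>n. S n)" unfolding S_def UN_box_eq_UNIV by simp
        then obtain m where m: "x \<in> S m" by blast
        have "x \<in> S n" if "n \<ge> m" for n
          using m that by (fastforce simp: S_def mem_box inner_simps)
        then have "eventually (\<lambda>n. indicat_real (S n) x *\<^sub>R F x = F x) sequentially"
          by (auto simp: eventually_sequentially intro!: exI[of _ m])
        then show ?thesis by (rule tendsto_eventually)
      qed
      then show "AE x in lborel. (\<lambda>n. indicat_real (S n) x *\<^sub>R F x) \<longlonglongrightarrow> F x" by simp
      have [measurable]: "S n \<in> sets borel" for n by (simp add: S_def)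
      have [measurable]: "F \<in> borel_measurable borel" using F by auto
      show "(\<lambda>x. indicat_real (S n) x *\<^sub>R F x) \<in> borel_measurable lborel" for n by measurable
      show "AE x in lborel. norm (indicat_real (S n) x *\<^sub>R F x) \<le> norm (F x)" for n
        by (auto simp: indicator_def)
    qed (use F in auto)
    moreover have "(LINT x|lborel. indicator (S n) x *\<^sub>R F x) = 0" for n
      using box by (simp add: set_lebesgue_integral_def S_def)
    ultimately show ?thesis by (simp add: LIMSEQ_const_iff)
  qed
  have "Int_stable ?E" by (auto simp: Int_stable_def box_Int_box)
  moreover have "?E \<subseteq> Pow UNIV" by simp
  moreover have "A \<in> sigma_sets UNIV ?E" using A by (simp add: borel_eq_box)
  ultimately show ?thesis
  proof (induction rule: sigma_sets_induct_disjoint)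
    case (basic A)
    then show ?case using box by auto
  next
    case empty
    then show ?case by (simp add: set_lebesgue_integral_def)
  next
    case (compl A)
    then have A: "A \<in> sets borel" by (simp add: borel_eq_box)
    have "(LINT x|lborel. F x) = (LINT x:A|lborel. F x) + (LINT x:UNIV - A|lborel. F x)"
      using A set_integral_Un[of A "UNIV - A" lborel F] si by (simp add: set_lebesgue_integral_def)
    then show ?case using compl.IH all by simp
  next
    case (union A)
    have A: "range A \<subseteq> sets borel" using union.hyps(2) by (auto simp: borel_eq_box)
    then have "(LINT x:(\<Union>i. A i)|lborel. F x) = (\<Sum>i. (LINT x:A i|lborel. F x))"
      using union.hyps(1) by (intro lebesgue_integral_countable_add si) (auto simp: disjoint_family_on_def)
    then show ?case using union.IH by simp
  qed
qed

lemma test_function_L2: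
  fixes \<phi> :: "real^'n \<Rightarrow> real"
  assumes "test_function \<phi>" shows "\<phi> \<in> L2"
  using test_function_integrable_power[OF assms, of 2] test_function_measurable[OF assms]
  by (simp add: L2_def)

lemma box_indicator_L2: "(indicator (box a b) :: real^'n \<Rightarrow> real) \<in> L2"
proof -
  have "(norm (indicator (box a b) x :: real))\<^sup>2 = indicator (box a b) x" for x :: "real^'n"
    by (simp add: indicator_def)
  then show ?thesis
    using emeasure_lborel_box_finite[of a b] by (simp add: L2_def)
qed

lemma test_function_product_bump:
  "test_function (\<lambda>x::real^'n. \<Prod>i\<in>UNIV. bump (t * (x $ i - a $ i)) * bump (t * (b $ i - x $ i)))"
proof (rule test_functionI)
  have l: "bounded_linear (\<lambda>x::real^'n. s * x $ i)" for i s
    using bounded_linear_compose[OF bounded_linear_mult_right bounded_linear_vec_nth] .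
  have "C_k k (\<lambda>x::real^'n. t * x $ i + t * (- a $ i))" "C_k k (\<lambda>x::real^'n. (- t) * x $ i + t * b $ i)" for k i
    by (intro C_k_add C_k_const C_k_bounded_linear l)+
  then have "C_k k (\<lambda>x::real^'n. t * (x $ i - a $ i))" "C_k k (\<lambda>x::real^'n. t * (b $ i - x $ i))" for k i
    by (simp_all add: algebra_simps)
  then show "C_k k (\<lambda>x. \<Prod>i\<in>UNIV. bump (t * (x $ i - a $ i)) * bump (t * (b $ i - x $ i)))" for k
    by (intro C_k_prod C_k_mult[OF C_k_bump C_k_bump]) auto
  \<comment> \<open>For negative \<open>t\<close> both factors reverse and confine \<open>x\<close>
    to \<open>box b a\<close>; hence the union.\<close>
  have "x \<in> box a b \<union> box b a" if "(\<Prod>i\<in>UNIV. bump (t * (x $ i - a $ i)) * bump (t * (b $ i - x $ i))) \<noteq> 0" for x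
  proof -
    have *: "t * (x $ i - a $ i) > 0 \<and> t * (b $ i - x $ i) > 0" for i
      using that by (auto simp: bump_eq_0_iff not_le)
    show ?thesis
    proof (cases "t > 0")
      case True
      then show ?thesis using * by (auto simp: mem_box_cart zero_less_mult_iff)
    next
      case False
      then have "x \<in> box b a" using * by (simp add: mem_box_cart zero_less_mult_iff)
      then show ?thesis by simp
    qed
  qed
  then have sub: "{x. (\<Prod>i\<in>UNIV. bump (t * (x $ i - a $ i)) * bump (t * (b $ i - x $ i))) \<noteq> 0} \<subseteq> box a b \<union> box b a"
    by blast
  show "bounded {x. (\<Prod>i\<in>UNIV. bump (t * (x $ i - a $ i)) * bump (t * (b $ i - x $ i))) \<noteq> 0}"
    by (rule bounded_subset[OF _ sub]) (simp add: bounded_box)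
qed

lemma box_indicator_limit:
  fixes x :: "real^'n"
  shows "(\<lambda>n. \<Prod>i\<in>UNIV. bump (real n * (x $ i - a $ i)) * bump (real n * (b $ i - x $ i))) \<longlonglongrightarrow> indicator (box a b) x"
proof (cases "x \<in> box a b")
  case True
  then have "(\<lambda>n. \<Prod>i\<in>UNIV. bump (real n * (x $ i - a $ i)) * bump (real n * (b $ i - x $ i))) \<longlonglongrightarrow> (\<Prod>i\<in>(UNIV::'n set). 1 * 1)"
    by (intro tendsto_prod tendsto_mult bump_tendsto_1) (auto simp: mem_box_cart)
  then show ?thesis using True by simp
next
  case False
  then obtain i where i: "x $ i \<le> a $ i \<or> b $ i \<le> x $ i" by (auto simp: mem_box_cart not_less)
  have "(\<Prod>i\<in>UNIV. bump (real n * (x $ i - a $ i)) * bump (real n * (b $ i - x $ i))) = 0" for n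
    by (rule prod_zero) (use i in \<open>auto simp: bump_eq_0_iff mult_le_0_iff intro!: bexI[of _ i]\<close>)
  then have "(\<lambda>n. \<Prod>i\<in>UNIV. bump (real n * (x $ i - a $ i)) * bump (real n * (b $ i - x $ i))) = (\<lambda>n. 0)" by (rule ext)
  then show ?thesis using False by (simp only:) simp
qed

lemma prod_bump_le_indicator:
  fixes x :: "real^'n"
  assumes "t \<ge> 0"
  shows "\<bar>\<Prod>i\<in>UNIV. bump (t * (x $ i - a $ i)) * bump (t * (b $ i - x $ i))\<bar> \<le> indicator (box a b) x"
proof (cases "x \<in> box a b")
  case True
  have "(\<Prod>i\<in>(UNIV::'n set). bump (t * (x $ i - a $ i)) * bump (t * (b $ i - x $ i))) \<le> 1"
    by (intro prod_le_1) (auto simp: bump_nonneg bump_le_1 intro!: mult_le_one)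
  moreover have "0 \<le> (\<Prod>i\<in>(UNIV::'n set). bump (t * (x $ i - a $ i)) * bump (t * (b $ i - x $ i)))"
    by (intro prod_nonneg) (auto simp: bump_nonneg)
  ultimately show ?thesis using True by simp
next
  case False
  then obtain i where i: "x $ i \<le> a $ i \<or> b $ i \<le> x $ i" by (auto simp: mem_box_cart not_less)
  have "(\<Prod>i\<in>UNIV. bump (t * (x $ i - a $ i)) * bump (t * (b $ i - x $ i))) = 0"
    by (rule prod_zero) (use i assms in \<open>auto simp: bump_eq_0_iff mult_le_0_iff intro!: bexI[of _ i]\<close>)
  then show ?thesis using False by simp
qed

text \<open>Products of bumps approximate the indicator of a box from inside, so \<open>f\<close>
  integrates to zero over every box and then over every Borel set. As \<open>f\<close> may fail to
  be integrable on the whole space, this is applied to \<open>f\<close> cut off to large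
  boxes.\<close>

lemma test_function_fundamental_lemma:
  fixes f :: "real^'n \<Rightarrow> 'b::euclidean_space"
  assumes f: "f \<in> L2" and zero: "\<And>\<phi>. test_function \<phi> \<Longrightarrow> (LINT x|lborel. \<phi> x *\<^sub>R f x) = 0"
  shows "AE x in lborel. f x = 0"
proof -
  note [measurable] = L2_measurable[OF f]
  have box_int: "integrable lborel (\<lambda>x. indicat_real (box a b) x *\<^sub>R f x)" for a b
    by (rule L2_bilinear_integrable[OF box_indicator_L2 f]) auto
  have box: "(LINT x|lborel. indicat_real (box a b) x *\<^sub>R f x) = 0" for a b
  proof -
    define s where "s n x = (\<Prod>i\<in>UNIV. bump (real n * (x $ i - a $ i)) * bump (real n * (b $ i - x $ i)))" for n x
    have ts: "test_function (s n)" for n unfolding s_def by (rule test_function_product_bump)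
    note [measurable] = test_function_measurable[OF ts]
    have "(\<lambda>n. LINT x|lborel. s n x *\<^sub>R f x) \<longlonglongrightarrow> (LINT x|lborel. indicat_real (box a b) x *\<^sub>R f x)"
    proof (rule integral_dominated_convergence[where w="\<lambda>x. norm (indicat_real (box a b) x *\<^sub>R f x)"])
      show "AE x in lborel. (\<lambda>n. s n x *\<^sub>R f x) \<longlonglongrightarrow> indicat_real (box a b) x *\<^sub>R f x"
        unfolding s_def by (intro AE_I2 tendsto_scaleR tendsto_const box_indicator_limit)
      show "AE x in lborel. norm (s n x *\<^sub>R f x) \<le> norm (indicat_real (box a b) x *\<^sub>R f x)" for n
        using prod_bump_le_indicator[of "real n" _ a b] unfolding s_def by (auto intro!: mult_right_mono)
      show "integrable lborel (\<lambda>x. norm (indicat_real (box a b) x *\<^sub>R f x))"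
        using box_int by (rule integrable_norm)
    qed auto
    then show ?thesis by (simp add: zero[OF ts] LIMSEQ_const_iff)
  qed
  have "AE x in lborel. indicat_real (box (- (real n *\<^sub>R One)) (real n *\<^sub>R One)) x *\<^sub>R f x = 0" for n
  proof (rule sigma_finite_measure.density_unique_banach[OF sigma_finite_lborel])
    show "integrable lborel (\<lambda>x. indicat_real (box (- (real n *\<^sub>R One)) (real n *\<^sub>R One)) x *\<^sub>R f x)" by (rule box_int)
    show "integrable lborel (\<lambda>x::real^'n. 0::'b)" by simp
    fix A :: "(real^'n) set" assume "A \<in> sets lborel"
    have "(LINT x:A|lborel. indicat_real (box (- (real n *\<^sub>R One)) (real n *\<^sub>R One)) x *\<^sub>R f x) = 0"
    proof (rule borel_measurable_box_induct[OF box_int])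
      fix a b :: "real^'n"
      show "(LINT x:box a b|lborel. indicat_real (box (- (real n *\<^sub>R One)) (real n *\<^sub>R One)) x *\<^sub>R f x) = 0"
        unfolding set_lebesgue_integral_def scaleR_scaleR indicator_inter_arith[symmetric] box_Int_box by (rule box)
    qed (use \<open>A \<in> sets lborel\<close> in simp)
    then show "(LINT x:A|lborel. indicat_real (box (- (real n *\<^sub>R One)) (real n *\<^sub>R One)) x *\<^sub>R f x) = (LINT x:A|lborel. 0)"
      by simp
  qed
  then have "AE x in lborel. \<forall>n::nat. indicat_real (box (- (real n *\<^sub>R One)) (real n *\<^sub>R One)) x *\<^sub>R f x = 0"
    by (simp only: AE_all_countable) simp
  then show ?thesis
  proof eventually_elim
    case (elim x)
    have "x \<in> (\<Union>n::nat. box (- (real n *\<^sub>R One)) (real n *\<^sub>R One))" unfolding UN_box_eq_UNIV by simp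
    then show ?case using elim by (auto simp: indicator_def)
  qed
qed

lemma borel_measurable_vec_iff:
  fixes f :: "'a \<Rightarrow> 'b::euclidean_space^'n"
  shows "f \<in> borel_measurable M \<longleftrightarrow> (\<forall>i. (\<lambda>x. f x $ i) \<in> borel_measurable M)"
proof
  assume [measurable]: "f \<in> borel_measurable M"
  have [measurable]: "(\<lambda>v::'b^'n. v $ i) \<in> borel_measurable borel" for i
    by (intro borel_measurable_continuous_onI continuous_intros)
  show "\<forall>i. (\<lambda>x. f x $ i) \<in> borel_measurable M" by measurable
next
  assume m: "\<forall>i. (\<lambda>x. f x $ i) \<in> borel_measurable M"
  show "f \<in> borel_measurable M"
    unfolding borel_measurable_euclidean_space[of f]
    using m by (auto simp: Basis_vec_def inner_axis intro: borel_measurable_inner)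
qed

lemma norm_vec_square: "(norm (v :: 'b::real_normed_vector^'n))\<^sup>2 = (\<Sum>i\<in>UNIV. (norm (v $ i))\<^sup>2)"
  by (simp add: norm_vec_def L2_set_def sum_nonneg)

lemma L2_nth:
  fixes g :: "real^'m \<Rightarrow> 'b::euclidean_space^'n"
  assumes "g \<in> L2" shows "(\<lambda>x. g x $ i) \<in> L2"
proof (rule L2_dominated[OF _ assms, where C=1])
  show "(\<lambda>x. g x $ i) \<in> borel_measurable borel"
    using L2_measurable[OF assms] by (simp add: borel_measurable_vec_iff)
qed (simp add: Finite_Cartesian_Product.norm_nth_le)

lemma test_function_mult_integrable:
  fixes f :: "real^'n \<Rightarrow> 'b::euclidean_space"
  assumes "test_function \<phi>" "f \<in> L2" shows "integrable lborel (\<lambda>x. \<phi> x *\<^sub>R f x)"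
proof (rule L2_bilinear_integrable[OF test_function_L2[OF assms(1)] assms(2)])
  note [measurable] = test_function_measurable[OF assms(1)] L2_measurable[OF assms(2)]
  show "(\<lambda>x. \<phi> x *\<^sub>R f x) \<in> borel_measurable borel" by measurable
qed simp

lemma has_weak_gradient_unique:
  assumes g: "g \<in> L2" "has_weak_gradient u g" and h: "h \<in> L2" "has_weak_gradient u h"
  shows "AE x in lborel. g x = h x"
proof -
  have "AE x in lborel. g x $ i - h x $ i = 0" for i
  proof (rule test_function_fundamental_lemma)
    show "(\<lambda>x. g x $ i - h x $ i) \<in> L2" by (intro L2_diff L2_nth g h)
    fix \<phi> :: "real^'a \<Rightarrow> real" assume \<phi>: "test_function \<phi>"
    have "(LINT x|lborel. \<phi> x *\<^sub>R (g x $ i)) = (LINT x|lborel. \<phi> x *\<^sub>R (h x $ i))"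
    proof -
      have "- (LINT x|lborel. \<phi> x *\<^sub>R (g x $ i)) = - (LINT x|lborel. \<phi> x *\<^sub>R (h x $ i))"
        by (rule trans[OF g(2)[unfolded has_weak_gradient_def, rule_format, OF \<phi>, symmetric]
              h(2)[unfolded has_weak_gradient_def, rule_format, OF \<phi>]])
      then show ?thesis by (simp only: neg_equal_iff_equal)
    qed
    moreover have "(LINT x|lborel. \<phi> x *\<^sub>R (g x $ i - h x $ i))
        = (LINT x|lborel. \<phi> x *\<^sub>R (g x $ i)) - (LINT x|lborel. \<phi> x *\<^sub>R (h x $ i))"
      unfolding scaleR_diff_right
      by (intro Bochner_Integration.integral_diff test_function_mult_integrable \<phi> L2_nth g h)
    ultimately show "(LINT x|lborel. \<phi> x *\<^sub>R (g x $ i - h x $ i)) = 0" by simp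
  qed
  then have "AE x in lborel. \<forall>i. g x $ i - h x $ i = 0" by (simp add: AE_all_countable)
  then show ?thesis by eventually_elim (simp add: vec_eq_iff)
qed

text \<open>The chosen gradient may differ from a given one on a null set, so the comparison between
  the two is passed on as an equality of norms.\<close>

lemma weak_gradient:
  assumes "g \<in> L2" "has_weak_gradient u g"
  shows weak_gradient_L2: "weak_gradient u \<in> L2"
    and weak_gradient_has_weak_gradient: "has_weak_gradient u (weak_gradient u)"
    and weak_gradient_l2norm: "l2norm (weak_gradient u) = l2norm g"
proof -
  have "weak_gradient u \<in> L2 \<and> has_weak_gradient u (weak_gradient u)"
    unfolding weak_gradient_def by (rule someI[of _ g]) (use assms in simp)
  then show "weak_gradient u \<in> L2" "has_weak_gradient u (weak_gradient u)" by auto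
  then have "AE x in lborel. weak_gradient u x = g x" using assms by (intro has_weak_gradient_unique)
  then show "l2norm (weak_gradient u) = l2norm g"
    by (intro l2norm_cong_AE L2_measurable) (use assms \<open>weak_gradient u \<in> L2\<close> in auto)
qed

section \<open>Calculus of weak gradients\<close>

lemma H1_L2: "u \<in> H1 \<Longrightarrow> u \<in> L2" by (simp add: H1_def)

lemma H1_weak_gradient:
  assumes "u \<in> H1" shows "weak_gradient u \<in> L2" "has_weak_gradient u (weak_gradient u)"
  using assms weak_gradient_L2 weak_gradient_has_weak_gradient unfolding H1_def by blast+

lemma H1_I: "u \<in> L2 \<Longrightarrow> g \<in> L2 \<Longrightarrow> has_weak_gradient u g \<Longrightarrow> u \<in> H1"
  by (auto simp: H1_def)

lemma has_weak_gradient_add: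
  assumes "u \<in> L2" "g \<in> L2" "has_weak_gradient u g" "v \<in> L2" "h \<in> L2" "has_weak_gradient v h"
  shows "has_weak_gradient (\<lambda>x. u x + v x) (\<lambda>x. g x + h x)"
  unfolding has_weak_gradient_def
proof (intro allI impI)
  fix \<phi> :: "real^'a \<Rightarrow> real" and i assume \<phi>: "test_function \<phi>"
  note I = test_function_mult_integrable[OF test_function_derivative[OF \<phi>]]
    test_function_mult_integrable[OF \<phi> L2_nth]
  show "(LINT x|lborel. frechet_derivative \<phi> (at x) (axis i 1) *\<^sub>R (u x + v x)) =
       - (LINT x|lborel. \<phi> x *\<^sub>R (g x + h x) $ i)"
    using assms(3,6) \<phi> unfolding has_weak_gradient_def
    by (simp add: scaleR_add_right I assms)
qed

lemma has_weak_gradient_scaleR: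
  assumes "has_weak_gradient u g"
  shows "has_weak_gradient (\<lambda>x. c *\<^sub>R u x) (\<lambda>x. c *\<^sub>R g x)"
proof -
  have *: "a *\<^sub>R c *\<^sub>R z = c *\<^sub>R a *\<^sub>R (z::complex)" for a z by simp
  show ?thesis using assms unfolding has_weak_gradient_def
    by (simp del: scaleR_scaleR add: *)
qed

lemma has_weak_gradient_diff:
  assumes "u \<in> L2" "g \<in> L2" "has_weak_gradient u g" "v \<in> L2" "h \<in> L2" "has_weak_gradient v h"
  shows "has_weak_gradient (\<lambda>x. u x - v x) (\<lambda>x. g x - h x)"
  using has_weak_gradient_add[OF assms(1-3) L2_scaleR[OF assms(4), of "-1"] L2_scaleR[OF assms(5), of "-1"]
      has_weak_gradient_scaleR[OF assms(6), of "-1"]] by simp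

lemma frechet_derivative_translate:
  fixes \<phi> :: "real^'n \<Rightarrow> real"
  assumes "test_function \<phi>"
  shows "frechet_derivative (\<lambda>x. \<phi> (r *\<^sub>R x + a)) (at x) v = r * frechet_derivative \<phi> (at (r *\<^sub>R x + a)) v"
  using frechet_derivative_at[OF frechet_derivative_affine[OF test_function_differentiable[OF assms]]] by metis

lemma has_weak_gradient_translate:
  assumes "u \<in> L2" "g \<in> L2" "has_weak_gradient u g"
  shows "has_weak_gradient (\<lambda>x. u (x + a)) (\<lambda>x. g (x + a))"
  unfolding has_weak_gradient_def
proof (intro allI impI)
  fix \<phi> :: "real^'a \<Rightarrow> real" and i assume \<phi>: "test_function \<phi>"
  define \<psi> where "\<psi> x = \<phi> (1 *\<^sub>R x + (- a))" for x
  have \<psi>: "test_function \<psi>" unfolding \<psi>_def using \<phi> by (rule test_function_affine) simp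
  have d: "frechet_derivative \<psi> (at (x + a)) v = frechet_derivative \<phi> (at x) v" for x v
    using frechet_derivative_translate[OF \<phi>, of 1 "- a"] by (simp add: \<psi>_def[abs_def])
  note [measurable] = test_function_measurable[OF \<psi>] test_function_measurable[OF test_function_derivative[OF \<psi>]]
    L2_measurable[OF assms(1)] L2_measurable[OF L2_nth[OF assms(2), of i]]
  have m: "(\<lambda>x. \<psi> x *\<^sub>R (g x $ i)) \<in> borel_measurable borel" by measurable
  have "(LINT x|lborel. frechet_derivative \<phi> (at x) (axis i 1) *\<^sub>R u (x + a))
      = (LINT x|lborel. frechet_derivative \<psi> (at x) (axis i 1) *\<^sub>R u x)"
    using integral_translate[of "\<lambda>x. frechet_derivative \<psi> (at x) (axis i 1) *\<^sub>R u x" a] by (simp add: d)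
  also have "\<dots> = - (LINT x|lborel. \<psi> x *\<^sub>R (g x $ i))"
    using assms(3) \<psi> by (simp add: has_weak_gradient_def)
  also have "(LINT x|lborel. \<psi> x *\<^sub>R (g x $ i)) = (LINT x|lborel. \<phi> x *\<^sub>R (g (x + a) $ i))"
    unfolding integral_translate[OF m, of a, symmetric] by (simp add: \<psi>_def)
  finally show "(LINT x|lborel. frechet_derivative \<phi> (at x) (axis i 1) *\<^sub>R u (x + a))
      = - (LINT x|lborel. \<phi> x *\<^sub>R (g (x + a) $ i))" .
qed

text \<open>The product rule is transferred to the test function: \<open>\<xi>\<close> times a
  derivative of \<open>\<phi>\<close> is the derivative of the product of \<open>\<phi>\<close> and
  \<open>\<xi>\<close> minus \<open>\<phi>\<close> times the derivative of \<open>\<xi>\<close>, and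
  that product is again a test function.\<close>

lemma test_function_mult_gradient:
  fixes \<xi> :: "real^'n \<Rightarrow> real"
  assumes \<xi>: "test_function \<xi>" and u: "u \<in> L2" "g \<in> L2" "has_weak_gradient u g"
  shows "has_weak_gradient (\<lambda>x. \<xi> x *\<^sub>R u x)
    (\<lambda>x. \<xi> x *\<^sub>R g x + (\<chi> i. frechet_derivative \<xi> (at x) (axis i 1) *\<^sub>R u x))"
  unfolding has_weak_gradient_def
proof (intro allI impI)
  fix \<phi> :: "real^'n \<Rightarrow> real" and i assume \<phi>: "test_function \<phi>"
  let ?D = "\<lambda>(f :: real^'n \<Rightarrow> real) x. frechet_derivative f (at x) (axis i 1)"
  have p: "test_function (\<lambda>x. \<xi> x * \<phi> x)" "test_function (\<lambda>x. \<phi> x * \<xi> x)" "test_function (\<lambda>x. \<xi> x * ?D \<phi> x)" "test_function (\<lambda>x. \<phi> x * ?D \<xi> x)"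
    using \<phi> \<xi> by (auto intro!: test_function_mult test_function_C_k test_function_derivative)
  note d = test_function_differentiable[OF \<phi>] test_function_differentiable[OF \<xi>]
  have "(LINT x|lborel. ?D \<phi> x *\<^sub>R \<xi> x *\<^sub>R u x)
      = (LINT x|lborel. ?D (\<lambda>x. \<phi> x * \<xi> x) x *\<^sub>R u x - (\<phi> x * ?D \<xi> x) *\<^sub>R u x)"
    by (simp add: frechet_derivative_mult_eq d algebra_simps)
  also have "\<dots> = (LINT x|lborel. ?D (\<lambda>x. \<phi> x * \<xi> x) x *\<^sub>R u x) - (LINT x|lborel. (\<phi> x * ?D \<xi> x) *\<^sub>R u x)"
    by (intro Bochner_Integration.integral_diff test_function_mult_integrable test_function_derivative p u)
  also have "(LINT x|lborel. ?D (\<lambda>x. \<phi> x * \<xi> x) x *\<^sub>R u x) = - (LINT x|lborel. (\<phi> x * \<xi> x) *\<^sub>R (g x $ i))"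
    using u(3) p(2) by (simp add: has_weak_gradient_def)
  also have "- (LINT x|lborel. (\<phi> x * \<xi> x) *\<^sub>R (g x $ i)) - (LINT x|lborel. (\<phi> x * ?D \<xi> x) *\<^sub>R u x)
     = - (LINT x|lborel. (\<phi> x * \<xi> x) *\<^sub>R (g x $ i) + (\<phi> x * ?D \<xi> x) *\<^sub>R u x)"
    by (subst Bochner_Integration.integral_add) (intro test_function_mult_integrable p u L2_nth | simp)+
  finally show "(LINT x|lborel. ?D \<phi> x *\<^sub>R \<xi> x *\<^sub>R u x)
     = - (LINT x|lborel. \<phi> x *\<^sub>R (\<xi> x *\<^sub>R g x + (\<chi> i. frechet_derivative \<xi> (at x) (axis i 1) *\<^sub>R u x)) $ i)"
    by (simp add: scaleR_add_right)
qed

text \<open>Difference quotients have integral 0 by translation invariance. The Lipschitz bound on a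
  fixed ball dominates them, so the limit keeps this value.\<close>

lemma test_function_integral_derivative:
  fixes \<theta> :: "real^'n \<Rightarrow> real"
  assumes \<theta>: "test_function \<theta>"
  shows "(LINT x|lborel. frechet_derivative \<theta> (at x) v) = 0"
proof -
  note [measurable] = test_function_measurable[OF \<theta>] test_function_measurable[OF test_function_derivative[OF \<theta>]]
  obtain L where L: "0 < L" "\<And>x y. \<bar>\<theta> x - \<theta> y\<bar> \<le> L * norm (x - y)" using test_function_Lipschitz[OF \<theta>] by metis
  obtain B where B: "\<And>x. \<theta> x \<noteq> 0 \<Longrightarrow> norm x \<le> B"
    using test_function_bounded_support[OF \<theta>] by (auto simp: bounded_iff)
  \<comment> \<open>Increments \<open>1 / Suc n\<close> never exceed 1, so all quotients vanish
    outside the ball of radius \<open>B + norm v\<close>.\<close>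
  define q where "q n x = real (Suc n) * (\<theta> (x + (1 / real (Suc n)) *\<^sub>R v) - \<theta> x)" for n x
  have int: "integrable lborel \<theta>" using test_function_integrable_power[OF \<theta>, of 1] by simp
  have "(\<lambda>n. LINT x|lborel. q n x) \<longlonglongrightarrow> (LINT x|lborel. frechet_derivative \<theta> (at x) v)"
  proof (rule integral_dominated_convergence[where w="\<lambda>x. (L * norm v) * indicat_real (cball 0 (B + norm v)) x"])
    have "emeasure lborel (cball (0::real^'n) (B + norm v)) < \<infinity>"
      using emeasure_bounded_finite[of "cball (0::real^'n) (B + norm v)"] by simp
    then show "integrable lborel (\<lambda>x::real^'n. (L * norm v) * indicat_real (cball 0 (B + norm v)) x :: real)"
      by (intro integrable_mult_right integrable_real_indicator) simp_all
    show "AE x in lborel. (\<lambda>n. q n x) \<longlonglongrightarrow> frechet_derivative \<theta> (at x) v"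
    proof (rule AE_I2)
      fix x
      have d: "((\<lambda>t. x + t *\<^sub>R v) has_derivative (\<lambda>t. t *\<^sub>R v)) (at 0)"
        by (auto intro!: derivative_eq_intros)
      have "((\<lambda>t. \<theta> (x + t *\<^sub>R v)) has_derivative (\<lambda>t. frechet_derivative \<theta> (at x) (t *\<^sub>R v))) (at 0)"
        using has_derivative_compose[OF d, of \<theta> "frechet_derivative \<theta> (at x)"]
          frechet_derivative_worksI[OF test_function_differentiable[OF \<theta>], of x] by simp
      moreover have "frechet_derivative \<theta> (at x) (t *\<^sub>R v) = frechet_derivative \<theta> (at x) v * t" for t
        using linear_frechet_derivative[OF test_function_differentiable[OF \<theta>], of x] by (simp add: linear_cmul)
      ultimately have "((\<lambda>t. \<theta> (x + t *\<^sub>R v)) has_real_derivative frechet_derivative \<theta> (at x) v) (at 0)"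
        by (simp add: has_field_derivative_def)
      then have "(\<lambda>h. (\<theta> (x + h *\<^sub>R v) - \<theta> x) / h) \<midarrow>0\<rightarrow> frechet_derivative \<theta> (at x) v"
        by (simp add: DERIV_def)
      moreover have "filterlim (\<lambda>n. 1 / real (Suc n)) (at 0) sequentially"
        using LIMSEQ_Suc[OF lim_1_over_n] by (simp add: filterlim_at del: of_nat_Suc)
      ultimately have "(\<lambda>n. (\<theta> (x + (1 / real (Suc n)) *\<^sub>R v) - \<theta> x) / (1 / real (Suc n))) \<longlonglongrightarrow> frechet_derivative \<theta> (at x) v"
        by (rule filterlim_compose)
      then show "(\<lambda>n. q n x) \<longlonglongrightarrow> frechet_derivative \<theta> (at x) v"
        by (simp add: q_def mult.commute)
    qed
    fix n
    show "q n \<in> borel_measurable lborel" unfolding q_def[abs_def] by measurable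
    show "AE x in lborel. norm (q n x) \<le> L * norm v * indicat_real (cball 0 (B + norm v)) x"
    proof (rule AE_I2)
      fix x
      let ?y = "x + (1 / real (Suc n)) *\<^sub>R v"
      have le: "norm ((1 / real (Suc n)) *\<^sub>R v) \<le> norm v" by (simp add: field_simps)
      have "norm (q n x) \<le> real (Suc n) * (L * norm (?y - x))"
        unfolding q_def real_norm_def abs_mult using L(2)[of ?y x] by (intro mult_mono) auto
      also have "\<dots> = L * norm v" by simp
      finally have 1: "norm (q n x) \<le> L * norm v" .
      have "q n x = 0" if "x \<notin> cball 0 (B + norm v)"
      proof -
        have "norm x > B + norm v" using that by simp
        moreover have "norm x \<le> norm ?y + norm v"
          using norm_triangle_ineq4[of ?y "(1 / real (Suc n)) *\<^sub>R v"] le by simp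
        ultimately have "\<theta> ?y = 0" "\<theta> x = 0" using B[of ?y] B[of x] norm_ge_zero[of v] by fastforce+
        then show ?thesis by (simp add: q_def)
      qed
      then show "norm (q n x) \<le> L * norm v * indicat_real (cball 0 (B + norm v)) x"
        using 1 by (cases "x \<in> cball 0 (B + norm v)") auto
    qed
  qed auto
  moreover have "(LINT x|lborel. q n x) = 0" for n
    using integrable_translate[OF int] by (simp add: q_def int integral_translate del: of_nat_Suc)
  ultimately show ?thesis by (simp add: LIMSEQ_const_iff)
qed

text \<open>Integration by parts is the vanishing integral of the derivative of the product of
  \<open>\<phi>\<close> and \<open>\<psi>\<close>.\<close>

lemma test_function_has_weak_gradient:
  fixes \<psi> :: "real^'n \<Rightarrow> real"
  assumes \<psi>: "test_function \<psi>"
  shows "has_weak_gradient (\<lambda>x. complex_of_real (\<psi> x)) (\<lambda>x. \<chi> i. complex_of_real (frechet_derivative \<psi> (at x) (axis i 1)))"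
  unfolding has_weak_gradient_def
proof (intro allI impI)
  fix \<phi> :: "real^'n \<Rightarrow> real" and i assume \<phi>: "test_function \<phi>"
  let ?D = "\<lambda>(f :: real^'n \<Rightarrow> real) x. frechet_derivative f (at x) (axis i 1)"
  note d = test_function_differentiable[OF \<phi>] test_function_differentiable[OF \<psi>]
  have I: "integrable lborel (\<lambda>x. ?D \<phi> x * \<psi> x)" "integrable lborel (\<lambda>x. \<phi> x * ?D \<psi> x)"
    using test_function_mult_integrable[OF test_function_derivative[OF \<phi>] test_function_L2[OF \<psi>]]
      test_function_mult_integrable[OF \<phi> test_function_L2[OF test_function_derivative[OF \<psi>]]] by simp_all
  have "0 = (LINT x|lborel. ?D (\<lambda>x. \<phi> x * \<psi> x) x)"
    by (rule test_function_integral_derivative[symmetric], rule test_function_mult[OF test_function_C_k[OF \<phi>] \<psi>])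
  also have "\<dots> = (LINT x|lborel. ?D \<phi> x * \<psi> x) + (LINT x|lborel. \<phi> x * ?D \<psi> x)"
    by (simp add: frechet_derivative_mult_eq d I add.commute)
  finally have "(LINT x|lborel. ?D \<phi> x * \<psi> x) = - (LINT x|lborel. \<phi> x * ?D \<psi> x)" by simp
  then have "complex_of_real (LINT x|lborel. ?D \<phi> x * \<psi> x) = - complex_of_real (LINT x|lborel. \<phi> x * ?D \<psi> x)" by simp
  then show "(LINT x|lborel. ?D \<phi> x *\<^sub>R complex_of_real (\<psi> x)) =
       - (LINT x|lborel. \<phi> x *\<^sub>R (\<chi> i. complex_of_real (frechet_derivative \<psi> (at x) (axis i 1))) $ i)"
    by (simp add: scaleR_conv_of_real flip: of_real_mult integral_complex_of_real)
qed

section \<open>The translation estimate\<close>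

lemma L2_Cauchy_Schwarz_nn:
  assumes "f \<in> L2" "g \<in> L2"
  shows "(\<integral>\<^sup>+x. ennreal (norm (f x) * norm (g x)) \<partial>lborel) \<le> ennreal (l2norm f * l2norm g)"
  by (subst nn_integral_eq_integral[OF L2_integrable_mult[OF assms]]) (auto intro: ennreal_leI L2_Cauchy_Schwarz assms)

text \<open>For a gradient value \<open>z\<close> this is the derivative in direction
  \<open>h\<close>; the pairing is not conjugated because \<open>h\<close> is real.\<close>

definition dir_part :: "real^'n \<Rightarrow> complex^'n \<Rightarrow> complex" where
  "dir_part h z = (\<Sum>i\<in>UNIV. h $ i *\<^sub>R z $ i)"

lemma norm_dir_part_le: "norm (dir_part h z) \<le> norm h * norm z"
proof -
  have "norm (dir_part h z) \<le> (\<Sum>i\<in>UNIV. \<bar>h $ i\<bar> * \<bar>norm (z $ i)\<bar>)"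
    unfolding dir_part_def by (rule order_trans[OF norm_sum]) simp
  also have "\<dots> \<le> norm h * norm z"
    using L2_set_mult_ineq[of "\<lambda>i. h $ i" "\<lambda>i. norm (z $ i)" UNIV] by (simp add: norm_vec_def L2_set_def)
  finally show ?thesis .
qed

lemma dir_part_L2:
  assumes "g \<in> L2" shows "(\<lambda>x. dir_part h (g x)) \<in> L2"
proof (rule L2_dominated[OF _ assms])
  note [measurable] = L2_measurable[OF L2_nth[OF assms]]
  show "(\<lambda>x. dir_part h (g x)) \<in> borel_measurable borel" unfolding dir_part_def by measurable
qed (rule norm_dir_part_le)

lemma l2norm_dominated:
  assumes "f \<in> L2" "g \<in> L2" "\<And>x. norm (f x) \<le> C * norm (g x)" "C \<ge> 0"
  shows "l2norm f \<le> C * l2norm g"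
proof -
  have "(LINT x|lborel. (norm (f x))\<^sup>2) \<le> (LINT x|lborel. C\<^sup>2 * (norm (g x))\<^sup>2)"
    using power_mono[OF assms(3) norm_ge_zero, of _ 2]
    by (intro integral_mono integrable_mult_right L2_integrable assms) (simp add: power_mult_distrib)
  then have "(l2norm f)\<^sup>2 \<le> (C * l2norm g)\<^sup>2" by (simp add: l2norm_square power_mult_distrib)
  then show ?thesis by (rule power2_le_imp_le) (simp add: assms)
qed

lemma weak_gradient_direction:
  assumes \<phi>: "test_function \<phi>" and u: "u \<in> L2" "g \<in> L2" "has_weak_gradient u g"
  shows "(LINT x|lborel. frechet_derivative \<phi> (at x) h *\<^sub>R u x) = - (LINT x|lborel. \<phi> x *\<^sub>R dir_part h (g x))"
proof -
  have d: "frechet_derivative \<phi> (at x) h = (\<Sum>i\<in>UNIV. h $ i * frechet_derivative \<phi> (at x) (axis i 1))" for x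
  proof -
    have l: "linear (frechet_derivative \<phi> (at x))"
      by (rule linear_frechet_derivative[OF test_function_differentiable[OF \<phi>]])
    have "h = (\<Sum>i\<in>UNIV. h $ i *\<^sub>R axis i 1)"
      by (metis (no_types) basis_expansion scalar_mult_eq_scaleR)
    then have "frechet_derivative \<phi> (at x) h = frechet_derivative \<phi> (at x) (\<Sum>i\<in>UNIV. h $ i *\<^sub>R axis i 1)" by simp
    then show ?thesis using l by (simp add: linear_sum linear_cmul)
  qed
  note I = test_function_mult_integrable[OF test_function_derivative[OF \<phi>] u(1)]
    test_function_mult_integrable[OF \<phi> L2_nth[OF u(2)]]
  have "(LINT x|lborel. frechet_derivative \<phi> (at x) h *\<^sub>R u x)
      = (\<Sum>i\<in>UNIV. h $ i *\<^sub>R (LINT x|lborel. frechet_derivative \<phi> (at x) (axis i 1) *\<^sub>R u x))"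
    by (simp add: d scaleR_left.sum I flip: scaleR_scaleR)
  also have "\<dots> = (\<Sum>i\<in>UNIV. - (h $ i *\<^sub>R (LINT x|lborel. \<phi> x *\<^sub>R (g x $ i))))"
    using u(3) \<phi> by (simp add: has_weak_gradient_def)
  also have "\<dots> = - (LINT x|lborel. (\<Sum>i\<in>UNIV. h $ i *\<^sub>R \<phi> x *\<^sub>R (g x $ i)))"
    by (simp add: sum_negf I del: scaleR_scaleR)
  also have "(\<lambda>x. \<Sum>i\<in>UNIV. h $ i *\<^sub>R \<phi> x *\<^sub>R (g x $ i)) = (\<lambda>x. \<phi> x *\<^sub>R dir_part h (g x))"
    by (simp add: dir_part_def scaleR_sum_right mult.commute)
  finally show ?thesis .
qed

text \<open>A bound uniform in \<open>s\<close> suffices because the interval has length 1; this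
  supplies the integrability for Fubini in the translation identity.\<close>

lemma pair_integrable_unit_interval:
  fixes a :: "real^'n \<Rightarrow> real \<Rightarrow> 'b::{banach, second_countable_topology}"
  assumes [measurable]: "(\<lambda>(x, s). a x s) \<in> borel_measurable (borel \<Otimes>\<^sub>M borel)"
    and le: "\<And>s. (\<integral>\<^sup>+x. ennreal (norm (a x s)) \<partial>lborel) \<le> ennreal C"
  shows "integrable (lborel \<Otimes>\<^sub>M lborel) (\<lambda>(x, s). indicat_real {0..1} s *\<^sub>R a x s)"
proof (rule integrableI_bounded)
  show m: "(\<lambda>(x, s). indicat_real {0..1} s *\<^sub>R a x s) \<in> borel_measurable (lborel \<Otimes>\<^sub>M lborel)" by measurable
  have "(\<integral>\<^sup>+z. ennreal (norm (case z of (x, s) \<Rightarrow> indicat_real {0..1} s *\<^sub>R a x s)) \<partial>(lborel \<Otimes>\<^sub>M lborel))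
     = (\<integral>\<^sup>+s. \<integral>\<^sup>+x. ennreal (norm (indicat_real {0..1} s *\<^sub>R a x s)) \<partial>lborel \<partial>lborel)"
    by (subst lborel_pair.nn_integral_snd[symmetric, OF measurable_compose[OF measurable_compose[OF m borel_measurable_norm] measurable_ennreal]]) simp
  also have "\<dots> = (\<integral>\<^sup>+s. indicator {0..1} s * (\<integral>\<^sup>+x. ennreal (norm (a x s)) \<partial>lborel) \<partial>lborel)"
    by (intro nn_integral_cong) (auto simp: indicator_def)
  also have "\<dots> \<le> (\<integral>\<^sup>+s. indicator {0..1::real} s * ennreal C \<partial>lborel)"
    by (intro nn_integral_mono mult_left_mono le) auto
  also have "\<dots> < \<infinity>" by (simp add: nn_integral_multc ennreal_mult_less_top)
  finally show "(\<integral>\<^sup>+z. ennreal (norm (case z of (x, s) \<Rightarrow> indicat_real {0..1} s *\<^sub>R a x s)) \<partial>(lborel \<Otimes>\<^sub>M lborel)) < \<infinity>" .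
qed

lemma Fubini_unit_interval:
  fixes a :: "real^'n \<Rightarrow> real \<Rightarrow> 'b::{banach, second_countable_topology}"
  assumes "(\<lambda>(x, s). a x s) \<in> borel_measurable (borel \<Otimes>\<^sub>M borel)"
    and "\<And>s. (\<integral>\<^sup>+x. ennreal (norm (a x s)) \<partial>lborel) \<le> ennreal C"
  shows "(LINT x|lborel. LINT s|lborel. indicat_real {0..1} s *\<^sub>R a x s)
       = (LINT s|lborel. indicat_real {0..1} s *\<^sub>R (LINT x|lborel. a x s))"
proof -
  have "(LINT x|lborel. LINT s|lborel. indicat_real {0..1} s *\<^sub>R a x s)
      = (LINT s|lborel. LINT x|lborel. indicat_real {0..1} s *\<^sub>R a x s)"
    by (rule lborel_pair.Fubini_integral[symmetric]) (rule pair_integrable_unit_interval[OF assms])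
  then show ?thesis by simp
qed

lemma integral_test_function_segment:
  fixes \<phi> :: "real^'n \<Rightarrow> real"
  assumes \<phi>: "test_function \<phi>"
  shows "(LINT s|lborel. indicat_real {0..1} s *\<^sub>R frechet_derivative \<phi> (at (x - s *\<^sub>R h)) h) = \<phi> x - \<phi> (x - h)"
proof -
  have "(LINT s|lborel. indicat_real {0..1} s *\<^sub>R (frechet_derivative \<phi> (at (x - s *\<^sub>R h)) h)) =
     - \<phi> (x - 1 *\<^sub>R h) - (- \<phi> (x - 0 *\<^sub>R h))"
  proof (rule integral_FTC_atLeastAtMost[where F="\<lambda>s. - \<phi> (x - s *\<^sub>R h)"])
    fix s :: real
    have d: "((\<lambda>t. x - t *\<^sub>R h) has_derivative (\<lambda>t. - (t *\<^sub>R h))) (at s within {0..1})"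
      by (auto intro!: derivative_eq_intros)
    have "((\<lambda>t. \<phi> (x - t *\<^sub>R h)) has_derivative (\<lambda>t. frechet_derivative \<phi> (at (x - s *\<^sub>R h)) (- (t *\<^sub>R h)))) (at s within {0..1})"
      by (rule has_derivative_compose[OF d frechet_derivative_worksI[OF test_function_differentiable[OF \<phi>]]])
    from has_derivative_minus[OF this]
    show "((\<lambda>s. - \<phi> (x - s *\<^sub>R h)) has_vector_derivative frechet_derivative \<phi> (at (x - s *\<^sub>R h)) h) (at s within {0..1})"
      using linear_frechet_derivative[OF test_function_differentiable[OF \<phi>], of "x - s *\<^sub>R h"]
      by (simp add: has_vector_derivative_def linear_neg linear_cmul)
  next
    show "continuous_on {0..1} (\<lambda>s. frechet_derivative \<phi> (at (x - s *\<^sub>R h)) h)"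
      by (intro continuous_on_compose2[OF test_function_continuous[OF test_function_derivative[OF \<phi>]]] continuous_intros) auto
  qed simp
  then show ?thesis by simp
qed

text \<open>Jensen's inequality in \<open>s\<close> combined with translation invariance in
  \<open>x\<close>.\<close>

lemma segment_average_L2:
  fixes G :: "real^'n \<Rightarrow> 'b::euclidean_space" and h :: "real^'n"
  assumes G: "G \<in> L2"
  defines "F \<equiv> \<lambda>x. LINT s|lborel. indicat_real {0..1} s *\<^sub>R G (x + s *\<^sub>R h)"
  shows "F \<in> L2" "l2norm F \<le> l2norm G"
proof -
  note [measurable] = L2_measurable[OF G]
  have m [measurable]: "F \<in> borel_measurable borel"
    unfolding F_def by (intro lborel.borel_measurable_lebesgue_integral) measurable
  have pt: "ennreal ((norm (F x))\<^sup>2) \<le> (\<integral>\<^sup>+s. indicator {0..1} s * ennreal ((norm (G (x + s *\<^sub>R h)))\<^sup>2) \<partial>lborel)" for x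
  proof -
    have "ennreal (norm (F x)) \<le> (\<integral>\<^sup>+s. ennreal (norm (indicat_real {0..1} s *\<^sub>R G (x + s *\<^sub>R h))) \<partial>lborel)"
    proof (cases "integrable lborel (\<lambda>s. indicat_real {0..1} s *\<^sub>R G (x + s *\<^sub>R h))")
      case True
      then show ?thesis unfolding F_def by (rule integral_norm_bound_ennreal)
    next
      case False
      then show ?thesis by (simp add: F_def not_integrable_integral_eq)
    qed
    \<comment> \<open>The idempotent indicator is doubled so that the Cauchy-Schwarz inequality
      leaves the length 1 of the interval as one factor.\<close>
    also have "\<dots> = (\<integral>\<^sup>+s. indicator {0..1} s * (indicator {0..1} s * ennreal (norm (G (x + s *\<^sub>R h)))) \<partial>lborel)"
      by (intro nn_integral_cong) (auto simp: indicator_def)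
    finally have "(ennreal (norm (F x)))\<^sup>2 \<le> (\<integral>\<^sup>+s. indicator {0..1} s * (indicator {0..1} s * ennreal (norm (G (x + s *\<^sub>R h)))) \<partial>lborel)\<^sup>2"
      by (rule power_mono) simp
    also have "\<dots> \<le> (\<integral>\<^sup>+s. (indicator {0..1::real} s)\<^sup>2 \<partial>lborel) * (\<integral>\<^sup>+s. (indicator {0..1} s * ennreal (norm (G (x + s *\<^sub>R h))))\<^sup>2 \<partial>lborel)"
      by (rule Cauchy_Schwarz_nn_integral) measurable
    also have "(\<lambda>s::real. (indicator {0..1} s :: ennreal)\<^sup>2) = indicator {0..1}" by (auto simp: indicator_def)
    also have "(\<lambda>s. (indicator {0..1} s * ennreal (norm (G (x + s *\<^sub>R h))))\<^sup>2) = (\<lambda>s. indicator {0..1} s * ennreal ((norm (G (x + s *\<^sub>R h)))\<^sup>2))"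
      by (auto simp: indicator_def ennreal_power)
    finally show ?thesis by (simp add: ennreal_power)
  qed
  have "(\<integral>\<^sup>+x. ennreal ((norm (F x))\<^sup>2) \<partial>lborel)
    \<le> (\<integral>\<^sup>+x. \<integral>\<^sup>+s. indicator {0..1} s * ennreal ((norm (G (x + s *\<^sub>R h)))\<^sup>2) \<partial>lborel \<partial>lborel)"
    by (intro nn_integral_mono pt)
  also have "\<dots> = (\<integral>\<^sup>+s. \<integral>\<^sup>+x. indicator {0..1} s * ennreal ((norm (G (x + s *\<^sub>R h)))\<^sup>2) \<partial>lborel \<partial>lborel)"
    by (intro lborel_pair.Fubini') measurable
  also have "\<dots> = (\<integral>\<^sup>+s. indicator {0..1::real} s * ennreal ((l2norm G)\<^sup>2) \<partial>lborel)"
    by (intro nn_integral_cong)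
       (simp add: nn_integral_cmult nn_integral_translate[of "\<lambda>x. ennreal ((norm (G x))\<^sup>2)"] nn_integral_L2[OF G])
  also have "\<dots> = ennreal ((l2norm G)\<^sup>2)" by (simp add: nn_integral_multc)
  finally have le: "(\<integral>\<^sup>+x. ennreal ((norm (F x))\<^sup>2) \<partial>lborel) \<le> ennreal ((l2norm G)\<^sup>2)" .
  show "F \<in> L2" unfolding L2_iff using m le_less_trans[OF le] by simp
  then show "l2norm F \<le> l2norm G" using le by (subst l2norm_le_iff_nn) auto
qed

text \<open>The fundamental theorem of calculus along the segment from \<open>x\<close> to
  \<open>x + h\<close>, by duality: against a test function, the translations and the gradient are
  moved onto \<open>\<phi>\<close>, where the classical theorem applies, with Fubini exchanging the
  integrals in \<open>x\<close> and \<open>s\<close>.\<close>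

lemma weak_gradient_translate_eq:
  assumes u: "u \<in> L2" "g \<in> L2" "has_weak_gradient u g"
  shows "AE x in lborel. u (x + h) - u x = (LINT s|lborel. indicat_real {0..1} s *\<^sub>R dir_part h (g (x + s *\<^sub>R h)))"
proof -
  define G where "G x = dir_part h (g x)" for x
  define F where "F x = (LINT s|lborel. indicat_real {0..1} s *\<^sub>R G (x + s *\<^sub>R h))" for x
  have G: "G \<in> L2" unfolding G_def[abs_def] by (rule dir_part_L2[OF u(2)])
  have F: "F \<in> L2" unfolding F_def[abs_def] by (rule segment_average_L2[OF G])
  note [measurable] = L2_measurable[OF u(1)] L2_measurable[OF G]
  have "AE x in lborel. u (x + h) - u x - F x = 0"
  proof (rule test_function_fundamental_lemma)
    show "(\<lambda>x. u (x + h) - u x - F x) \<in> L2" by (intro L2_diff L2_translate u F)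
    fix \<phi> :: "real^'a \<Rightarrow> real" assume \<phi>: "test_function \<phi>"
    let ?D = "\<lambda>x. frechet_derivative \<phi> (at x) h"
    have aff: "test_function (\<lambda>x. \<psi> (x - b))" if "test_function \<psi>" for \<psi> :: "real^'a \<Rightarrow> real" and b
      using test_function_affine[OF that, of 1 "- b"] by simp
    note D = test_function_derivative[OF \<phi>, of h]
    note [measurable] = test_function_measurable[OF \<phi>] test_function_measurable[OF D]
    have tr: "l2norm (\<lambda>x. w (x - b)) = l2norm w" if "w \<in> L2" for w :: "real^'a \<Rightarrow> real" and b
      using l2norm_translate[OF that, of "- b"] by simp
    have "(LINT x|lborel. \<phi> x *\<^sub>R F x) = (LINT x|lborel. LINT s|lborel. indicat_real {0..1} s *\<^sub>R (\<phi> x *\<^sub>R G (x + s *\<^sub>R h)))"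
      unfolding F_def by (simp flip: integral_scaleR_right add: mult.commute)
    also have "\<dots> = (LINT s|lborel. indicat_real {0..1} s *\<^sub>R (LINT x|lborel. \<phi> x *\<^sub>R G (x + s *\<^sub>R h)))"
    proof (rule Fubini_unit_interval)
      fix s
      show "(\<integral>\<^sup>+x. ennreal (norm (\<phi> x *\<^sub>R G (x + s *\<^sub>R h))) \<partial>lborel) \<le> ennreal (l2norm \<phi> * l2norm G)"
        using L2_Cauchy_Schwarz_nn[OF test_function_L2[OF \<phi>] L2_translate[OF G, of "s *\<^sub>R h"]]
        by (simp add: l2norm_translate[OF G])
    qed measurable
    also have "(\<lambda>s. LINT x|lborel. \<phi> x *\<^sub>R G (x + s *\<^sub>R h)) = (\<lambda>s. - (LINT x|lborel. ?D (x - s *\<^sub>R h) *\<^sub>R u x))"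
    proof
      fix s
      have "(LINT x|lborel. \<phi> x *\<^sub>R G (x + s *\<^sub>R h)) = (LINT x|lborel. \<phi> (x - s *\<^sub>R h) *\<^sub>R G x)"
        using integral_translate[of "\<lambda>x. \<phi> (x - s *\<^sub>R h) *\<^sub>R G x" "s *\<^sub>R h"] by simp
      also have "\<dots> = - (LINT x|lborel. frechet_derivative (\<lambda>x. \<phi> (x - s *\<^sub>R h)) (at x) h *\<^sub>R u x)"
        unfolding G_def using weak_gradient_direction[OF aff[OF \<phi>] u] by simp
      also have "(\<lambda>x. frechet_derivative (\<lambda>x. \<phi> (x - s *\<^sub>R h)) (at x) h) = (\<lambda>x. ?D (x - s *\<^sub>R h))"
        using frechet_derivative_translate[OF \<phi>, of 1 "- (s *\<^sub>R h)" _ h] by simp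
      finally show "(LINT x|lborel. \<phi> x *\<^sub>R G (x + s *\<^sub>R h)) = - (LINT x|lborel. ?D (x - s *\<^sub>R h) *\<^sub>R u x)" .
    qed
    also have "(LINT s|lborel. indicat_real {0..1} s *\<^sub>R - (LINT x|lborel. ?D (x - s *\<^sub>R h) *\<^sub>R u x))
      = - (LINT s|lborel. indicat_real {0..1} s *\<^sub>R (LINT x|lborel. ?D (x - s *\<^sub>R h) *\<^sub>R u x))" by simp
    also have "(LINT s|lborel. indicat_real {0..1} s *\<^sub>R (LINT x|lborel. ?D (x - s *\<^sub>R h) *\<^sub>R u x))
      = (LINT x|lborel. LINT s|lborel. indicat_real {0..1} s *\<^sub>R (?D (x - s *\<^sub>R h) *\<^sub>R u x))"
    proof (rule Fubini_unit_interval[symmetric])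
      fix s
      show "(\<integral>\<^sup>+x. ennreal (norm (?D (x - s *\<^sub>R h) *\<^sub>R u x)) \<partial>lborel) \<le> ennreal (l2norm ?D * l2norm u)"
        using L2_Cauchy_Schwarz_nn[OF test_function_L2[OF aff[OF D]] u(1), of "s *\<^sub>R h"]
        by (simp add: tr[OF test_function_L2[OF D]])
    qed measurable
    also have "\<dots> = (LINT x|lborel. (LINT s|lborel. indicat_real {0..1} s *\<^sub>R ?D (x - s *\<^sub>R h)) *\<^sub>R u x)"
    proof (rule Bochner_Integration.integral_cong[OF refl])
      fix x
      have "integrable lborel (\<lambda>s. indicat_real {0..1} s *\<^sub>R ?D (x - s *\<^sub>R h))"
        unfolding set_integrable_def[symmetric]
        by (intro borel_integrable_atLeastAtMost' continuous_on_compose2[OF test_function_continuous[OF D]] continuous_intros) auto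
      from integral_scaleR_left[OF this]
      show "(LINT s|lborel. indicat_real {0..1} s *\<^sub>R (?D (x - s *\<^sub>R h) *\<^sub>R u x))
          = (LINT s|lborel. indicat_real {0..1} s *\<^sub>R ?D (x - s *\<^sub>R h)) *\<^sub>R u x"
        by simp
    qed
    also have "\<dots> = (LINT x|lborel. \<phi> x *\<^sub>R u x - \<phi> (x - h) *\<^sub>R u x)"
      by (simp only: integral_test_function_segment[OF \<phi>] scaleR_diff_left)
    also have "\<dots> = (LINT x|lborel. \<phi> x *\<^sub>R u x) - (LINT x|lborel. \<phi> (x - h) *\<^sub>R u x)"
      by (intro Bochner_Integration.integral_diff test_function_mult_integrable u aff \<phi>)
    also have "(LINT x|lborel. \<phi> (x - h) *\<^sub>R u x) = (LINT x|lborel. \<phi> x *\<^sub>R u (x + h))"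
      using integral_translate[of "\<lambda>x. \<phi> (x - h) *\<^sub>R u x" h] by simp
    finally have "(LINT x|lborel. \<phi> x *\<^sub>R F x) = (LINT x|lborel. \<phi> x *\<^sub>R u (x + h)) - (LINT x|lborel. \<phi> x *\<^sub>R u x)"
      by simp
    moreover have "(LINT x|lborel. \<phi> x *\<^sub>R (u (x + h) - u x - F x))
        = (LINT x|lborel. \<phi> x *\<^sub>R u (x + h)) - (LINT x|lborel. \<phi> x *\<^sub>R u x) - (LINT x|lborel. \<phi> x *\<^sub>R F x)"
      using test_function_mult_integrable[OF \<phi> L2_translate[OF u(1)]] test_function_mult_integrable[OF \<phi> u(1)]
        test_function_mult_integrable[OF \<phi> F] by (simp add: scaleR_diff_right)
    ultimately show "(LINT x|lborel. \<phi> x *\<^sub>R (u (x + h) - u x - F x)) = 0" by simp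
  qed
  then show ?thesis by eventually_elim (simp add: F_def G_def)
qed

lemma weak_gradient_translation_estimate:
  assumes u: "u \<in> L2" "g \<in> L2" "has_weak_gradient u g"
  shows "l2norm (\<lambda>x. u (x + h) - u x) \<le> norm h * l2norm g"
proof -
  define G where "G x = dir_part h (g x)" for x
  define F where "F x = (LINT s|lborel. indicat_real {0..1} s *\<^sub>R G (x + s *\<^sub>R h))" for x
  have G: "G \<in> L2" unfolding G_def[abs_def] by (rule dir_part_L2[OF u(2)])
  have F: "F \<in> L2" "l2norm F \<le> l2norm G" unfolding F_def[abs_def] by (rule segment_average_L2[OF G])+
  have "l2norm (\<lambda>x. u (x + h) - u x) = l2norm F"
    using weak_gradient_translate_eq[OF u, of h]
    by (intro l2norm_cong_AE L2_measurable L2_diff L2_translate u F) (simp add: F_def G_def)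
  also note F(2)
  also have "l2norm G \<le> norm h * l2norm g"
    by (rule l2norm_dominated[OF G u(2)]) (simp_all add: G_def norm_dir_part_le)
  finally show ?thesis .
qed

section \<open>A Hardy-type bound for Riesz potentials\<close>

lemma ball_borel_measurable [measurable]: "ball (a::'a::metric_space) r \<in> sets borel"
  by simp

lemma ennreal_le_suminf: "f k \<le> suminf (f :: nat \<Rightarrow> ennreal)"
  using sum_le_suminf[of f "{k}"] by simp

definition ball_mass :: "(real^'n \<Rightarrow> 'b::euclidean_space) \<Rightarrow> real^'n \<Rightarrow> real \<Rightarrow> real" where
  "ball_mass u a r = (LINT x|lborel. indicator (ball a r) x * (norm (u x))\<^sup>2)"

lemma ball_mass_integrable:
  assumes "u \<in> L2" shows "integrable lborel (\<lambda>x. indicator (ball a r) x * (norm (u x))\<^sup>2)"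
  using integrable_mult_indicator[OF _ L2_integrable[OF assms], of "ball a r"] by simp

lemma nn_ball_mass:
  assumes "u \<in> L2"
  shows "(\<integral>\<^sup>+x. indicator (ball a r) x * ennreal ((norm (u x))\<^sup>2) \<partial>lborel) = ennreal (ball_mass u a r)"
proof -
  have "(\<integral>\<^sup>+x. indicator (ball a r) x * ennreal ((norm (u x))\<^sup>2) \<partial>lborel)
      = (\<integral>\<^sup>+x. ennreal (indicator (ball a r) x * (norm (u x))\<^sup>2) \<partial>lborel)"
    by (intro nn_integral_cong) (auto simp: indicator_def)
  then show ?thesis
    unfolding ball_mass_def by (simp add: nn_integral_eq_integral ball_mass_integrable[OF assms])
qed

lemma ball_mass_nonneg: "0 \<le> ball_mass u a r"
  unfolding ball_mass_def by (intro integral_nonneg_AE AE_I2) simp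

lemma ball_mass_le: assumes "u \<in> L2" shows "ball_mass u a r \<le> (l2norm u)\<^sup>2"
  unfolding ball_mass_def l2norm_square
  by (intro integral_mono ball_mass_integrable L2_integrable assms) (auto simp: indicator_def)

lemma ball_mass_mono:
  assumes "u \<in> L2" "ball a r \<subseteq> ball b s" shows "ball_mass u a r \<le> ball_mass u b s"
  unfolding ball_mass_def using assms(2)
  by (intro integral_mono ball_mass_integrable assms(1)) (auto simp: indicator_def)

text \<open>Average \<open>\<bar>u x\<bar>\<^sup>2 \<le> 2 \<bar>u (x + h)\<bar>\<^sup>2 + 2 \<bar>u (x + h) - u x\<bar>\<^sup>2\<close> over the shifts \<open>\<bar>h\<bar> < \<Lambda> r\<close>.\<close>

lemma ball_mass_averaging:
  fixes u :: "real^'n \<Rightarrow> 'b::euclidean_space"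
  assumes u: "u \<in> L2" and K: "\<And>h. l2norm (\<lambda>x. u (x + h) - u x) \<le> K * norm h" "K \<ge> 0"
    and r: "r > 0" "\<Lambda> > 0"
  shows "ball_mass u a r \<le> 2 * \<Lambda> powr (- real CARD('n)) * ball_mass u a ((\<Lambda> + 1) * r) + 2 * K\<^sup>2 * (\<Lambda> * r)\<^sup>2"
proof -
  note [measurable] = L2_measurable[OF u]
  define vol where "vol s = unit_ball_vol (real CARD('n)) * s ^ CARD('n)" for s
  have vol: "emeasure lborel (ball c s :: (real^'n) set) = ennreal (vol s)" if "s \<ge> 0" for s and c :: "real^'n"
    using emeasure_ball[OF that, of c] by (simp add: vol_def)
  have vol_pos: "vol s > 0" if "s > 0" for s using that by (simp add: vol_def)
  let ?\<rho> = "\<lambda>x. ennreal ((norm (u x))\<^sup>2)"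
  let ?B = "ball (0::real^'n) (\<Lambda> * r)"
  let ?d = "\<lambda>h x. ennreal ((norm (u (x + h) - u x))\<^sup>2)"
  have pt: "ennreal ((norm (u x))\<^sup>2) \<le> 2 * ennreal ((norm (u (x + h)))\<^sup>2) + 2 * ennreal ((norm (u (x + h) - u x))\<^sup>2)" for x h
  proof -
    have "(norm (u x))\<^sup>2 \<le> 2 * (norm (u (x + h)))\<^sup>2 + 2 * (norm (u (x + h) - u x))\<^sup>2"
      using norm_add_square_le[of "u (x + h)" "- (u (x + h) - u x)"] by (simp add: norm_minus_commute)
    then have "ennreal ((norm (u x))\<^sup>2) \<le> ennreal (2 * (norm (u (x + h)))\<^sup>2 + 2 * (norm (u (x + h) - u x))\<^sup>2)"
      by (rule ennreal_leI)
    then show ?thesis by (simp add: ennreal_mult)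
  qed
  have "ennreal (vol (\<Lambda> * r)) * ennreal (ball_mass u a r)
      = (\<integral>\<^sup>+h. indicator ?B h * (\<integral>\<^sup>+x. indicator (ball a r) x * ?\<rho> x \<partial>lborel) \<partial>lborel)"
    using r by (simp add: nn_integral_multc vol nn_ball_mass[OF u])
  also have "\<dots> \<le> (\<integral>\<^sup>+h. indicator ?B h * (\<integral>\<^sup>+x. 2 * (indicator (ball a r) x * ?\<rho> (x + h)) + 2 * ?d h x \<partial>lborel) \<partial>lborel)"
  proof (intro nn_integral_mono mult_left_mono)
    fix h x
    show "indicator (ball a r) x * ?\<rho> x \<le> 2 * (indicator (ball a r) x * ?\<rho> (x + h)) + 2 * ?d h x"
      using pt[of x h] by (cases "x \<in> ball a r") auto
  qed simp
  also have "\<dots> = (\<integral>\<^sup>+h. 2 * (indicator ?B h * (\<integral>\<^sup>+x. indicator (ball a r) x * ?\<rho> (x + h) \<partial>lborel))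
        + 2 * (indicator ?B h * (\<integral>\<^sup>+x. ?d h x \<partial>lborel)) \<partial>lborel)"
    by (intro nn_integral_cong) (simp add: nn_integral_add nn_integral_cmult distrib_left mult_ac)
  also have "\<dots> = 2 * (\<integral>\<^sup>+h. indicator ?B h * (\<integral>\<^sup>+x. indicator (ball a r) x * ?\<rho> (x + h) \<partial>lborel) \<partial>lborel)
        + 2 * (\<integral>\<^sup>+h. indicator ?B h * (\<integral>\<^sup>+x. ?d h x \<partial>lborel) \<partial>lborel)"
    by (subst nn_integral_add) (simp_all add: nn_integral_cmult)
  \<comment> \<open>For fixed \<open>x\<close> in the small ball, all points \<open>x + h\<close>
    lie in the ball of radius \<open>(\<Lambda> + 1) * r\<close>; integrating over \<open>h\<close>
    first therefore costs that mass times the volume of the small ball.\<close>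
  also have "(\<integral>\<^sup>+h. indicator ?B h * (\<integral>\<^sup>+x. indicator (ball a r) x * ?\<rho> (x + h) \<partial>lborel) \<partial>lborel)
      \<le> ennreal (vol r) * ennreal (ball_mass u a ((\<Lambda> + 1) * r))"
  proof -
    have "(\<integral>\<^sup>+h. indicator ?B h * (\<integral>\<^sup>+x. indicator (ball a r) x * ?\<rho> (x + h) \<partial>lborel) \<partial>lborel)
       = (\<integral>\<^sup>+h. \<integral>\<^sup>+x. indicator ?B h * (indicator (ball a r) x * ?\<rho> (x + h)) \<partial>lborel \<partial>lborel)"
      by (simp add: nn_integral_cmult)
    also have "\<dots> = (\<integral>\<^sup>+x. \<integral>\<^sup>+h. indicator ?B h * (indicator (ball a r) x * ?\<rho> (x + h)) \<partial>lborel \<partial>lborel)"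
      by (intro lborel_pair.Fubini') measurable
    also have "\<dots> \<le> (\<integral>\<^sup>+x. indicator (ball a r) x * ennreal (ball_mass u a ((\<Lambda> + 1) * r)) \<partial>lborel)"
    proof (intro nn_integral_mono)
      fix x
      show "(\<integral>\<^sup>+h. indicator ?B h * (indicator (ball a r) x * ?\<rho> (x + h)) \<partial>lborel)
         \<le> indicator (ball a r) x * ennreal (ball_mass u a ((\<Lambda> + 1) * r))"
      proof (cases "x \<in> ball a r")
        case True
        have "(\<integral>\<^sup>+h. indicator ?B h * ?\<rho> (x + h) \<partial>lborel)
          \<le> (\<integral>\<^sup>+h. indicator (ball a ((\<Lambda> + 1) * r)) (h + x) * ?\<rho> (h + x) \<partial>lborel)"
        proof (intro nn_integral_mono)
          fix h
          have "h + x \<in> ball a ((\<Lambda> + 1) * r)" if "h \<in> ?B"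
            using that True norm_triangle_ineq4[of "a - x" h]
            by (simp add: dist_norm algebra_simps)
          then show "indicator ?B h * ?\<rho> (x + h) \<le> indicator (ball a ((\<Lambda> + 1) * r)) (h + x) * ?\<rho> (h + x)"
            by (cases "h \<in> ?B") (auto simp: add.commute)
        qed
        also have "\<dots> = (\<integral>\<^sup>+h. indicator (ball a ((\<Lambda> + 1) * r)) h * ?\<rho> h \<partial>lborel)"
          by (rule nn_integral_translate) measurable
        also have "\<dots> = ennreal (ball_mass u a ((\<Lambda> + 1) * r))" by (rule nn_ball_mass[OF u])
        finally show ?thesis using True by simp
      qed simp
    qed
    also have "\<dots> = ennreal (vol r) * ennreal (ball_mass u a ((\<Lambda> + 1) * r))"
      using r by (simp add: nn_integral_multc vol)
    finally show ?thesis .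
  qed
  also have "(\<integral>\<^sup>+h. indicator ?B h * (\<integral>\<^sup>+x. ?d h x \<partial>lborel) \<partial>lborel)
     \<le> (\<integral>\<^sup>+h. indicator ?B h * ennreal (K\<^sup>2 * (\<Lambda> * r)\<^sup>2) \<partial>lborel)"
  proof (intro nn_integral_mono)
    fix h :: "real^'n"
    show "indicator ?B h * (\<integral>\<^sup>+x. ?d h x \<partial>lborel) \<le> indicator ?B h * ennreal (K\<^sup>2 * (\<Lambda> * r)\<^sup>2)"
    proof (cases "h \<in> ?B")
      case True
      then have "K * norm h \<le> K * (\<Lambda> * r)" using K(2) by (intro mult_left_mono) auto
      with K(1)[of h] have "l2norm (\<lambda>x. u (x + h) - u x) \<le> K * (\<Lambda> * r)" by linarith
      then have "(\<integral>\<^sup>+x. ?d h x \<partial>lborel) \<le> ennreal ((K * (\<Lambda> * r))\<^sup>2)"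
        using K(2) r by (subst (asm) l2norm_le_iff_nn) (auto intro!: L2_diff L2_translate u)
      then show ?thesis using True by (simp add: power_mult_distrib)
    qed simp
  qed
  also have "\<dots> = ennreal (vol (\<Lambda> * r)) * ennreal (K\<^sup>2 * (\<Lambda> * r)\<^sup>2)"
    using r by (simp add: nn_integral_multc vol)
  finally have "ennreal (vol (\<Lambda> * r)) * ennreal (ball_mass u a r) \<le>
     2 * (ennreal (vol r) * ennreal (ball_mass u a ((\<Lambda> + 1) * r))) + 2 * (ennreal (vol (\<Lambda> * r)) * ennreal (K\<^sup>2 * (\<Lambda> * r)\<^sup>2))"
    by (simp add: add_mono mult_left_mono)
  also have "\<dots> = ennreal (2 * (vol r * ball_mass u a ((\<Lambda> + 1) * r)) + 2 * (vol (\<Lambda> * r) * (K\<^sup>2 * (\<Lambda> * r)\<^sup>2)))"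
    using vol_pos r by (simp add: ennreal_mult ennreal_plus ball_mass_nonneg less_imp_le)
  also have "ennreal (vol (\<Lambda> * r)) * ennreal (ball_mass u a r) = ennreal (vol (\<Lambda> * r) * ball_mass u a r)"
    using vol_pos r by (simp add: ennreal_mult ball_mass_nonneg less_imp_le)
  finally have "vol (\<Lambda> * r) * ball_mass u a r \<le> 2 * (vol r * ball_mass u a ((\<Lambda> + 1) * r)) + 2 * (vol (\<Lambda> * r) * (K\<^sup>2 * (\<Lambda> * r)\<^sup>2))"
    using vol_pos[of r] vol_pos[of "\<Lambda> * r"] r by (subst (asm) ennreal_le_iff) (auto intro!: add_nonneg_nonneg mult_nonneg_nonneg simp: ball_mass_nonneg less_imp_le)
  \<comment> \<open>The ratio of the two volumes is the gain of the averaging.\<close>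
  moreover have "vol r = vol (\<Lambda> * r) * \<Lambda> powr (- real CARD('n))"
    using r by (simp add: vol_def powr_minus powr_realpow power_mult_distrib)
  ultimately have "vol (\<Lambda> * r) * ball_mass u a r \<le> vol (\<Lambda> * r) *
     (2 * \<Lambda> powr (- real CARD('n)) * ball_mass u a ((\<Lambda> + 1) * r) + 2 * K\<^sup>2 * (\<Lambda> * r)\<^sup>2)"
    by (simp add: algebra_simps)
  then show ?thesis using vol_pos[of "\<Lambda> * r"] r by simp
qed

text \<open>A Campanato-type iteration of \<open>ball_mass_averaging\<close> over the radii
  \<open>q ^ k * l\<close>: each step multiplies the bound by \<open>q powr \<beta>\<close>, so a
  small ball carries mass of the order of its radius to the power \<beta>. That \<beta> lies below
  the dimension is used for the averaging gain, that it lies below 2 for the gradient term.\<close>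

lemma ball_mass_decay:
  fixes \<beta> :: real
  assumes "0 < \<beta>" "\<beta> < real CARD('n::finite)" "\<beta> < 2"
  obtains q C where "0 < q" "q < 1" "0 < C"
    "\<And>(u :: real^'n \<Rightarrow> 'b::euclidean_space) K a l k. u \<in> L2 \<Longrightarrow> K \<ge> 0 \<Longrightarrow> (\<And>h. l2norm (\<lambda>x. u (x + h) - u x) \<le> K * norm h) \<Longrightarrow>
      l > 0 \<Longrightarrow> ball_mass u a (q ^ k * l) \<le> ((l2norm u)\<^sup>2 + C * (K * l)\<^sup>2) * (q powr \<beta>) ^ k"
proof -
  define N where "N = real CARD('n)"
  define \<Lambda> where "\<Lambda> = 16 powr (1 / (N - \<beta>))"
  define q where "q = 1 / (\<Lambda> + 1)"
  \<comment> \<open>With this \<open>\<Lambda>\<close> one averaging step gains the factor \<open>q powr \<beta> / 2\<close>; as \<open>\<beta> < 2\<close>, the other half absorbs the gradient term.\<close>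
  have N: "\<beta> < N" using assms by (simp add: N_def)
  have \<Lambda>: "\<Lambda> \<ge> 1" unfolding \<Lambda>_def using N by (intro ge_one_powr_ge_zero) auto
  have q: "0 < q" "q < 1" using \<Lambda> by (auto simp: q_def)
  \<comment> \<open>The 16 in \<open>\<Lambda>\<close> is 4 times \<open>2 powr 2\<close>: the 4 is
    the gain that is wanted, and \<open>2 powr 2\<close> bounds the loss
    \<open>2 powr \<beta>\<close> from \<open>\<Lambda> + 1 \<le> 2 * \<Lambda>\<close>.\<close>
  have "4 * (\<Lambda> + 1) powr \<beta> \<le> \<Lambda> powr N"
  proof -
    have "(\<Lambda> + 1) powr \<beta> \<le> (2 * \<Lambda>) powr \<beta>" using \<Lambda> assms by (intro powr_mono2) auto
    also have "\<dots> = 2 powr \<beta> * \<Lambda> powr \<beta>" using \<Lambda> by (simp add: powr_mult)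
    also have "\<dots> \<le> 2 powr 2 * \<Lambda> powr \<beta>" using assms by (intro mult_right_mono powr_mono) auto
    finally have "4 * (\<Lambda> + 1) powr \<beta> \<le> 16 * \<Lambda> powr \<beta>" by simp
    also have "16 = \<Lambda> powr (N - \<beta>)" unfolding \<Lambda>_def using N by (simp add: powr_powr)
    also have "\<Lambda> powr (N - \<beta>) * \<Lambda> powr \<beta> = \<Lambda> powr N" by (simp flip: powr_add)
    finally show ?thesis .
  qed
  then have \<kappa>: "2 * \<Lambda> powr (- N) \<le> q powr \<beta> / 2"
    using \<Lambda> by (simp add: q_def powr_minus powr_divide divide_simps)
  \<comment> \<open>Chosen so that the gradient term
    \<open>2 * K\<^sup>2 * (\<Lambda> * l)\<^sup>2\<close> is at most half of the \<open>M\<close>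
    introduced below.\<close>
  define C where "C = 4 * \<Lambda>\<^sup>2"
  have main: "ball_mass u a (q ^ k * l) \<le> ((l2norm u)\<^sup>2 + C * (K * l)\<^sup>2) * (q powr \<beta>) ^ k"
    if u: "u \<in> L2" and K: "K \<ge> 0" "\<And>h. l2norm (\<lambda>x. u (x + h) - u x) \<le> K * norm h" and l: "l > 0"
    for u :: "real^'n \<Rightarrow> 'b" and K a l k
  proof (induction k)
    case 0
    have "0 \<le> C * (K * l)\<^sup>2" by (simp add: C_def)
    then show ?case using ball_mass_le[OF u, of a l] by simp
  next
    case (Suc k)
    define M where "M = (l2norm u)\<^sup>2 + C * (K * l)\<^sup>2"
    have "ball_mass u a (q ^ Suc k * l) \<le> 2 * \<Lambda> powr (- N) * ball_mass u a ((\<Lambda> + 1) * (q ^ Suc k * l)) + 2 * K\<^sup>2 * (\<Lambda> * (q ^ Suc k * l))\<^sup>2"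
      unfolding N_def using q l \<Lambda> by (intro ball_mass_averaging u K) auto
    also have "(\<Lambda> + 1) * (q ^ Suc k * l) = q ^ k * l" using \<Lambda> by (simp add: q_def)
    also have "2 * \<Lambda> powr (- N) * ball_mass u a (q ^ k * l) \<le> (q powr \<beta> / 2) * (M * (q powr \<beta>) ^ k)"
      using Suc.IH \<kappa> by (intro mult_mono) (auto simp: M_def ball_mass_nonneg)
    also have "2 * K\<^sup>2 * (\<Lambda> * (q ^ Suc k * l))\<^sup>2 \<le> M / 2 * (q powr \<beta>) ^ Suc k"
    proof -
      have "(q ^ Suc k)\<^sup>2 = (q powr 2) ^ Suc k" using q by (simp add: powr_numeral power_mult_distrib power_mult[symmetric] mult.commute power_even_eq)
      also have "\<dots> \<le> (q powr \<beta>) ^ Suc k" using q assms by (intro power_mono powr_mono') auto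
      finally have 1: "(q ^ Suc k)\<^sup>2 \<le> (q powr \<beta>) ^ Suc k" .
      have 2: "2 * K\<^sup>2 * (\<Lambda> * l)\<^sup>2 \<le> M / 2" unfolding M_def C_def by (simp add: power_mult_distrib)
      have "2 * K\<^sup>2 * (\<Lambda> * (q ^ Suc k * l))\<^sup>2 = (2 * K\<^sup>2 * (\<Lambda> * l)\<^sup>2) * (q ^ Suc k)\<^sup>2" by (simp add: power_mult_distrib)
      also have "\<dots> \<le> M / 2 * (q powr \<beta>) ^ Suc k" using 1 2 by (intro mult_mono) (auto simp: M_def C_def)
      finally show ?thesis .
    qed
    finally show ?case by (simp add: M_def mult_ac)
  qed
  have "0 < C" using \<Lambda> by (simp add: C_def)
  show thesis by (rule that[OF q \<open>0 < C\<close>]) (rule main)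
qed

text \<open>The kernel is summed over the shells between the radii \<open>q ^ Suc k * l\<close> and
  \<open>q ^ k * l\<close> around the pole: it grows by \<open>q powr (- \<gamma>)\<close> per shell
  while the mass bound decays by \<open>q powr \<beta>\<close>, and
  \<open>\<beta> > \<gamma>\<close> makes the series geometric. Keeping \<open>l\<close> free later
  allows the gradient term to be absorbed.\<close>

lemma Riesz_potential_bound:
  fixes \<gamma> :: real
  assumes "0 < \<gamma>" "\<gamma> < real CARD('n::finite)" "\<gamma> < 2"
  obtains C where "0 < C"
    "\<And>(u :: real^'n \<Rightarrow> 'b::euclidean_space) K a l. u \<in> L2 \<Longrightarrow> K \<ge> 0 \<Longrightarrow> (\<And>h. l2norm (\<lambda>x. u (x + h) - u x) \<le> K * norm h) \<Longrightarrow>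
      l > 0 \<Longrightarrow> (\<integral>\<^sup>+x. ennreal ((norm (u x))\<^sup>2 / norm (a - x) powr \<gamma>) \<partial>lborel)
        \<le> ennreal (C * l powr (- \<gamma>) * ((l2norm u)\<^sup>2 + (K * l)\<^sup>2))"
proof -
  obtain \<beta> where \<beta>: "\<gamma> < \<beta>" "\<beta> < real CARD('n)" "\<beta> < 2"
    using dense[of \<gamma> "min (real CARD('n)) 2"] assms by auto
  show thesis
  proof (rule ball_mass_decay[OF less_trans[OF assms(1) \<beta>(1)] \<beta>(2,3), where 'b='b])
  fix q C :: real
  assume q: "0 < q" "q < 1" and "0 < C" and decay:
    "\<And>(u :: real^'n \<Rightarrow> 'b) K a l k. u \<in> L2 \<Longrightarrow> K \<ge> 0 \<Longrightarrow> (\<And>h. l2norm (\<lambda>x. u (x + h) - u x) \<le> K * norm h) \<Longrightarrow>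
      l > 0 \<Longrightarrow> ball_mass u a (q ^ k * l) \<le> ((l2norm u)\<^sup>2 + C * (K * l)\<^sup>2) * (q powr \<beta>) ^ k"
  define s where "s = q powr (\<beta> - \<gamma>)"
  have s: "0 < s" "s < 1" using q \<beta> by (auto simp: s_def powr_def mult_pos_neg)
  define C1 where "C1 = q powr (- \<gamma>) / (1 - s)"
  have C1: "C1 > 0" using q s by (simp add: C1_def)
  define C' where "C' = (C1 + 1) * (C + 1)"
  have "(\<integral>\<^sup>+x. ennreal ((norm (u x))\<^sup>2 / norm (a - x) powr \<gamma>) \<partial>lborel)
        \<le> ennreal (C' * l powr (- \<gamma>) * ((l2norm u)\<^sup>2 + (K * l)\<^sup>2))"
    if u: "u \<in> L2" and K: "K \<ge> 0" "\<And>h. l2norm (\<lambda>x. u (x + h) - u x) \<le> K * norm h" and l: "l > 0"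
    for u :: "real^'n \<Rightarrow> 'b" and K a l
  proof -
    note [measurable] = L2_measurable[OF u]
    define M where "M = (l2norm u)\<^sup>2 + C * (K * l)\<^sup>2"
    have M: "M \<ge> 0" using \<open>0 < C\<close> by (simp add: M_def)
    define e where "e k = (q ^ Suc k * l) powr (- \<gamma>)" for k
    let ?\<rho> = "\<lambda>x. ennreal ((norm (u x))\<^sup>2)"
    have pt: "ennreal ((norm (u x))\<^sup>2 / norm (a - x) powr \<gamma>)
       \<le> ennreal (l powr (- \<gamma>)) * ?\<rho> x + (\<Sum>k. ennreal (e k) * (indicator (ball a (q ^ k * l)) x * ?\<rho> x))" for x
    proof (cases "norm (a - x) \<ge> l")
      case True
      then have "(norm (a - x)) powr (- \<gamma>) \<le> l powr (- \<gamma>)" using l assms by (intro powr_mono2') auto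
      then have "(norm (u x))\<^sup>2 / norm (a - x) powr \<gamma> \<le> l powr (- \<gamma>) * (norm (u x))\<^sup>2"
        by (simp add: powr_minus divide_inverse mult.commute mult_right_mono)
      then have "ennreal ((norm (u x))\<^sup>2 / norm (a - x) powr \<gamma>) \<le> ennreal (l powr (- \<gamma>)) * ?\<rho> x"
        by (simp add: ennreal_leI flip: ennreal_mult)
      then show ?thesis by (rule order_trans) simp
    next
      case False
      show ?thesis
      \<comment> \<open>At the pole the quotient has denominator 0 and hence value 0.\<close>
      proof (cases "x = a")
        case True
        then show ?thesis by simp
      next
        case neq: False
        then have pos: "norm (a - x) > 0" by simp
        obtain j where "q ^ j < norm (a - x) / l" using real_arch_pow_inv[of "norm (a - x) / l" q] pos l q by auto
        then have ex: "\<exists>j. q ^ j * l \<le> norm (a - x)" using l by (intro exI[of _ j]) (simp add: field_simps)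
        \<comment> \<open>The least \<open>j\<close> gives the shell; it is not 0 because
          \<open>norm (a - x) < l\<close>, so its predecessor \<open>k\<close> is the index of a
          ball containing \<open>x\<close>.\<close>
        define j where "j = (LEAST j. q ^ j * l \<le> norm (a - x))"
        have j: "q ^ j * l \<le> norm (a - x)" unfolding j_def using ex by (rule LeastI_ex)
        with False have "j \<noteq> 0" by (cases j) auto
        then obtain k where k: "j = Suc k" by (cases j) auto
        have kk: "norm (a - x) < q ^ k * l"
          using not_less_Least[of k "\<lambda>j. q ^ j * l \<le> norm (a - x)"] k unfolding j_def by auto
        have "(norm (a - x)) powr (- \<gamma>) \<le> e k" unfolding e_def using j k l q assms by (intro powr_mono2') auto
        then have "(norm (u x))\<^sup>2 / norm (a - x) powr \<gamma> \<le> e k * (norm (u x))\<^sup>2"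
          by (simp add: powr_minus divide_inverse mult.commute mult_right_mono)
        then have "ennreal ((norm (u x))\<^sup>2 / norm (a - x) powr \<gamma>) \<le> ennreal (e k) * ?\<rho> x"
          by (simp add: ennreal_leI e_def flip: ennreal_mult)
        also have "\<dots> = ennreal (e k) * (indicator (ball a (q ^ k * l)) x * ?\<rho> x)"
          using kk by (simp add: dist_norm)
        also have "\<dots> \<le> (\<Sum>k. ennreal (e k) * (indicator (ball a (q ^ k * l)) x * ?\<rho> x))"
          by (rule ennreal_le_suminf)
        finally show ?thesis by (simp add: add_increasing)
      qed
    qed
    have ek: "e k * (M * (q powr \<beta>) ^ k) = l powr (- \<gamma>) * M * q powr (- \<gamma>) * s ^ k" for k
    proof -
      have p: "(q ^ n) powr t = (q powr t) ^ n" for n t using q by (induction n) (simp_all add: powr_mult)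
      have "s = q powr \<beta> * q powr (- \<gamma>)" using q by (simp add: s_def flip: powr_add)
      then show ?thesis using q l by (simp add: e_def powr_mult p power_mult_distrib del: power_Suc) simp
    qed
    have "(\<integral>\<^sup>+x. ennreal ((norm (u x))\<^sup>2 / norm (a - x) powr \<gamma>) \<partial>lborel)
      \<le> (\<integral>\<^sup>+x. ennreal (l powr (- \<gamma>)) * ?\<rho> x + (\<Sum>k. ennreal (e k) * (indicator (ball a (q ^ k * l)) x * ?\<rho> x)) \<partial>lborel)"
      by (intro nn_integral_mono pt)
    also have "\<dots> = ennreal (l powr (- \<gamma>)) * ennreal ((l2norm u)\<^sup>2)
       + (\<Sum>k. ennreal (e k) * ennreal (ball_mass u a (q ^ k * l)))"
      by (simp add: nn_integral_add nn_integral_cmult nn_integral_suminf nn_integral_L2[OF u] nn_ball_mass[OF u])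
    also have "(\<Sum>k. ennreal (e k) * ennreal (ball_mass u a (q ^ k * l))) \<le> (\<Sum>k. ennreal (l powr (- \<gamma>) * M * q powr (- \<gamma>) * s ^ k))"
    proof (intro suminf_le)
      fix k
      have "e k * ball_mass u a (q ^ k * l) \<le> e k * (M * (q powr \<beta>) ^ k)"
        unfolding M_def by (intro mult_left_mono decay u K l) (simp add: e_def)
      then show "ennreal (e k) * ennreal (ball_mass u a (q ^ k * l)) \<le> ennreal (l powr (- \<gamma>) * M * q powr (- \<gamma>) * s ^ k)"
        unfolding ek by (simp add: ennreal_leI e_def ball_mass_nonneg flip: ennreal_mult)
    qed auto
    also have "\<dots> = ennreal (\<Sum>k. l powr (- \<gamma>) * M * q powr (- \<gamma>) * s ^ k)"
      using s M by (intro suminf_ennreal2 summable_mult summable_geometric) auto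
    also have "(\<Sum>k. l powr (- \<gamma>) * M * q powr (- \<gamma>) * s ^ k) = l powr (- \<gamma>) * M * C1"
      using s by (subst suminf_mult) (simp_all add: summable_geometric suminf_geometric C1_def)
    also have "ennreal (l powr (- \<gamma>)) * ennreal ((l2norm u)\<^sup>2) + ennreal (l powr (- \<gamma>) * M * C1)
       = ennreal (l powr (- \<gamma>) * ((l2norm u)\<^sup>2 + M * C1))"
      using M C1 by (simp add: distrib_left ennreal_mult ennreal_plus mult.assoc)
    also have "\<dots> \<le> ennreal (C' * l powr (- \<gamma>) * ((l2norm u)\<^sup>2 + (K * l)\<^sup>2))"
    proof (rule ennreal_leI)
      have "(l2norm u)\<^sup>2 + M * C1 \<le> C' * ((l2norm u)\<^sup>2 + (K * l)\<^sup>2)"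
        using \<open>0 < C\<close> C1 unfolding C'_def M_def
        by (simp add: algebra_simps add_increasing add_increasing2)
      then show "l powr (- \<gamma>) * ((l2norm u)\<^sup>2 + M * C1) \<le> C' * l powr (- \<gamma>) * ((l2norm u)\<^sup>2 + (K * l)\<^sup>2)"
        using mult_left_mono[of "(l2norm u)\<^sup>2 + M * C1" "C' * ((l2norm u)\<^sup>2 + (K * l)\<^sup>2)" "l powr (- \<gamma>)"] by (simp add: mult_ac)
    qed
    finally show ?thesis by simp
  qed
  moreover have "0 < C'" using C1 \<open>0 < C\<close> by (simp add: C'_def)
  ultimately show thesis using that by blast
  qed
qed

section \<open>The double integral energies\<close>

text \<open>The Bochner integrals in \<open>D_energy\<close> silently become 0 when they diverge;
  the extended version cannot hide divergence and admits Tonelli's theorem at once. Both agree under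
  a uniform potential bound, by \<open>D_energy_nn\<close>.\<close>

definition D_nn :: "real \<Rightarrow> (real^'n \<Rightarrow> complex) \<Rightarrow> ennreal" where
  "D_nn \<gamma> u = (\<integral>\<^sup>+x. \<integral>\<^sup>+y. ennreal ((norm (u x))\<^sup>2 * (norm (u y))\<^sup>2 / norm (x - y) powr \<gamma>) \<partial>lborel \<partial>lborel)"

text \<open>Bounds the Riesz potential of the density in the supremum norm. Uniformity in the pole
  \<open>a\<close> makes the double integral at most the mass times \<open>P\<close> and, in
  \<open>D_nn_diff_le\<close>, Lipschitz in the density.\<close>

definition riesz_bounded :: "real \<Rightarrow> (real^'n \<Rightarrow> complex) \<Rightarrow> real \<Rightarrow> bool" where
  "riesz_bounded \<gamma> u P \<longleftrightarrow> 0 \<le> P \<and>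
    (\<forall>a. (\<integral>\<^sup>+x. ennreal ((norm (u x))\<^sup>2 / norm (a - x) powr \<gamma>) \<partial>lborel) \<le> ennreal P)"

lemma D_nn_le:
  assumes u: "u \<in> L2" and P: "riesz_bounded \<gamma> u P"
  shows "D_nn \<gamma> u \<le> ennreal ((l2norm u)\<^sup>2 * P)"
proof -
  note [measurable] = L2_measurable[OF u]
  have "D_nn \<gamma> u = (\<integral>\<^sup>+x. ennreal ((norm (u x))\<^sup>2) * (\<integral>\<^sup>+y. ennreal ((norm (u y))\<^sup>2 / norm (x - y) powr \<gamma>) \<partial>lborel) \<partial>lborel)"
    unfolding D_nn_def by (simp add: nn_integral_cmult[symmetric] ennreal_mult[symmetric])
  also have "\<dots> \<le> (\<integral>\<^sup>+x. ennreal ((norm (u x))\<^sup>2) * ennreal P \<partial>lborel)"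
    using P unfolding riesz_bounded_def by (intro nn_integral_mono mult_left_mono) auto
  also have "\<dots> = ennreal ((l2norm u)\<^sup>2 * P)"
    using P by (simp add: nn_integral_multc nn_integral_L2[OF u] ennreal_mult riesz_bounded_def)
  finally show ?thesis .
qed

lemma D_energy_nn:
  assumes u: "u \<in> L2" and P: "riesz_bounded \<gamma> u P"
  shows "ennreal (D_energy \<gamma> u) = D_nn \<gamma> u" and "0 \<le> D_energy \<gamma> u"
    and "D_energy \<gamma> u \<le> (l2norm u)\<^sup>2 * P"
proof -
  note [measurable] = L2_measurable[OF u]
  have "(\<integral>\<^sup>+y. ennreal ((norm (u x))\<^sup>2 * (norm (u y))\<^sup>2 / norm (x - y) powr \<gamma>) \<partial>lborel)
      = ennreal ((norm (u x))\<^sup>2) * (\<integral>\<^sup>+y. ennreal ((norm (u y))\<^sup>2 / norm (x - y) powr \<gamma>) \<partial>lborel)" for x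
    by (simp add: nn_integral_cmult[symmetric] ennreal_mult[symmetric])
  also have "\<dots> x \<le> ennreal ((norm (u x))\<^sup>2) * ennreal P" for x
    using P unfolding riesz_bounded_def by (intro mult_left_mono) auto
  also have "\<dots> x < \<infinity>" for x by (simp add: ennreal_mult_less_top)
  finally have fin: "(\<integral>\<^sup>+y. ennreal ((norm (u x))\<^sup>2 * (norm (u y))\<^sup>2 / norm (x - y) powr \<gamma>) \<partial>lborel) < \<infinity>" for x .
  have inner: "ennreal (LINT y|lborel. (norm (u x))\<^sup>2 * (norm (u y))\<^sup>2 / norm (x - y) powr \<gamma>)
      = (\<integral>\<^sup>+y. ennreal ((norm (u x))\<^sup>2 * (norm (u y))\<^sup>2 / norm (x - y) powr \<gamma>) \<partial>lborel)" for x
    using fin[of x] by (subst integral_eq_nn_integral) auto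
  have [measurable]: "(\<lambda>x. LINT y|lborel. (norm (u x))\<^sup>2 * (norm (u y))\<^sup>2 / norm (x - y) powr \<gamma>) \<in> borel_measurable borel"
    by (intro lborel.borel_measurable_lebesgue_integral) measurable
  have le: "D_nn \<gamma> u \<le> ennreal ((l2norm u)\<^sup>2 * P)" by (rule D_nn_le[OF assms])
  then have finD: "D_nn \<gamma> u < \<infinity>" by (rule le_less_trans) simp
  have "D_energy \<gamma> u = enn2real (D_nn \<gamma> u)"
    unfolding D_energy_def D_nn_def inner[symmetric]
    by (subst integral_eq_nn_integral) (auto intro!: integral_nonneg_AE AE_I2)
  then show eq: "ennreal (D_energy \<gamma> u) = D_nn \<gamma> u" and "0 \<le> D_energy \<gamma> u" using finD by auto
  have "0 \<le> (l2norm u)\<^sup>2 * P" using P by (simp add: riesz_bounded_def)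
  then show "D_energy \<gamma> u \<le> (l2norm u)\<^sup>2 * P" using le unfolding eq[symmetric] by (simp add: ennreal_le_iff)
qed

text \<open>For the densities \<rho> and \<sigma> of \<open>u\<close> and \<open>v\<close>, the
  difference of the products is (\<rho> - \<sigma>)(x) \<rho>(y) + \<sigma>(x) (\<rho> -
  \<sigma>)(y). In each summand the untouched density is integrated against the kernel first, giving
  \<open>P\<close> or \<open>Q\<close>; the Cauchy-Schwarz inequality then bounds the integral of
  the absolute difference.\<close>

lemma D_nn_diff_le:
  assumes u: "u \<in> L2" "riesz_bounded \<gamma> u P" and v: "v \<in> L2" "riesz_bounded \<gamma> v Q"
  shows "D_nn \<gamma> u \<le> D_nn \<gamma> v + ennreal ((P + Q) * (l2norm (\<lambda>x. u x - v x) * (l2norm u + l2norm v)))"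
proof -
  note [measurable] = L2_measurable[OF u(1)] L2_measurable[OF v(1)]
  have PQ: "P \<ge> 0" "Q \<ge> 0" using u v by (auto simp: riesz_bounded_def)
  define d where "d x = \<bar>(norm (u x))\<^sup>2 - (norm (v x))\<^sup>2\<bar>" for x
  have [measurable]: "d \<in> borel_measurable borel" unfolding d_def[abs_def] by measurable
  let ?K = "\<lambda>x y. 1 / norm (x - y) powr \<gamma>"
  define \<rho> where "\<rho> x = (norm (u x))\<^sup>2" for x
  define \<sigma> where "\<sigma> x = (norm (v x))\<^sup>2" for x
  have [measurable]: "\<rho> \<in> borel_measurable borel" "\<sigma> \<in> borel_measurable borel"
    unfolding \<rho>_def[abs_def] \<sigma>_def[abs_def] by measurable
  have nn: "d x \<ge> 0" "\<rho> x \<ge> 0" "\<sigma> x \<ge> 0" for x by (auto simp: d_def \<rho>_def \<sigma>_def)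
  have Db: "(\<integral>\<^sup>+y. ennreal (\<rho> y * ?K x y) \<partial>lborel) \<le> ennreal P"
    "(\<integral>\<^sup>+y. ennreal (\<sigma> y * ?K x y) \<partial>lborel) \<le> ennreal Q" for x
    using u(2) v(2) by (auto simp: riesz_bounded_def \<rho>_def \<sigma>_def)
  have D: "D_nn \<gamma> u = (\<integral>\<^sup>+x. \<integral>\<^sup>+y. ennreal (\<rho> x * \<rho> y * ?K x y) \<partial>lborel \<partial>lborel)"
    "D_nn \<gamma> v = (\<integral>\<^sup>+x. \<integral>\<^sup>+y. ennreal (\<sigma> x * \<sigma> y * ?K x y) \<partial>lborel \<partial>lborel)"
    by (simp_all add: D_nn_def \<rho>_def \<sigma>_def)
  have "(\<integral>\<^sup>+x. \<integral>\<^sup>+y. ennreal (\<rho> x * \<rho> y * ?K x y) \<partial>lborel \<partial>lborel)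
     \<le> (\<integral>\<^sup>+x. \<integral>\<^sup>+y. (ennreal (\<sigma> x * \<sigma> y * ?K x y) + ennreal (d x * (\<rho> y * ?K x y))) + ennreal (d y * (\<sigma> x * ?K y x)) \<partial>lborel \<partial>lborel)"
  proof (intro nn_integral_mono)
    fix x y
    have "\<rho> x * \<rho> y \<le> \<sigma> x * \<sigma> y + d x * \<rho> y + d y * \<sigma> x"
    proof -
      have "(\<rho> x - \<sigma> x) * \<rho> y \<le> d x * \<rho> y" "(\<rho> y - \<sigma> y) * \<sigma> x \<le> d y * \<sigma> x"
        by (intro mult_right_mono nn; simp add: d_def \<rho>_def \<sigma>_def)+
      then show ?thesis by (simp add: algebra_simps)
    qed
    then have "\<rho> x * \<rho> y * ?K x y \<le> (\<sigma> x * \<sigma> y + d x * \<rho> y + d y * \<sigma> x) * ?K x y"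
      by (rule mult_right_mono) simp
    also have "\<dots> = \<sigma> x * \<sigma> y * ?K x y + d x * (\<rho> y * ?K x y) + d y * (\<sigma> x * ?K y x)"
      by (simp add: algebra_simps norm_minus_commute[of y x] add_divide_distrib)
    finally have "ennreal (\<rho> x * \<rho> y * ?K x y) \<le> ennreal (\<sigma> x * \<sigma> y * ?K x y + d x * (\<rho> y * ?K x y) + d y * (\<sigma> x * ?K y x))"
      by (rule ennreal_leI)
    then show "ennreal (\<rho> x * \<rho> y * ?K x y) \<le> ennreal (\<sigma> x * \<sigma> y * ?K x y) + ennreal (d x * (\<rho> y * ?K x y)) + ennreal (d y * (\<sigma> x * ?K y x))"
      by (simp add: nn)
  qed
  also have "\<dots> = (\<integral>\<^sup>+x. \<integral>\<^sup>+y. ennreal (\<sigma> x * \<sigma> y * ?K x y) \<partial>lborel \<partial>lborel)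
      + (\<integral>\<^sup>+x. \<integral>\<^sup>+y. ennreal (d x * (\<rho> y * ?K x y)) \<partial>lborel \<partial>lborel)
      + (\<integral>\<^sup>+x. \<integral>\<^sup>+y. ennreal (d y * (\<sigma> x * ?K y x)) \<partial>lborel \<partial>lborel)"
    by (simp add: nn_integral_add)
  also have "(\<integral>\<^sup>+x. \<integral>\<^sup>+y. ennreal (d x * (\<rho> y * ?K x y)) \<partial>lborel \<partial>lborel) \<le> (\<integral>\<^sup>+x. ennreal (d x) \<partial>lborel) * ennreal P"
  proof -
    have "(\<integral>\<^sup>+x. \<integral>\<^sup>+y. ennreal (d x * (\<rho> y * ?K x y)) \<partial>lborel \<partial>lborel)
      = (\<integral>\<^sup>+x. ennreal (d x) * (\<integral>\<^sup>+y. ennreal (\<rho> y * ?K x y) \<partial>lborel) \<partial>lborel)"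
      using nn by (simp add: nn_integral_cmult[symmetric] ennreal_mult[symmetric])
    also have "\<dots> \<le> (\<integral>\<^sup>+x. ennreal (d x) * ennreal P \<partial>lborel)"
      by (intro nn_integral_mono mult_left_mono Db) auto
    finally show ?thesis by (simp add: nn_integral_multc)
  qed
  also have "(\<integral>\<^sup>+x. \<integral>\<^sup>+y. ennreal (d y * (\<sigma> x * ?K y x)) \<partial>lborel \<partial>lborel) \<le> (\<integral>\<^sup>+x. ennreal (d x) \<partial>lborel) * ennreal Q"
  proof -
    have "(\<integral>\<^sup>+x. \<integral>\<^sup>+y. ennreal (d y * (\<sigma> x * ?K y x)) \<partial>lborel \<partial>lborel)
      = (\<integral>\<^sup>+y. \<integral>\<^sup>+x. ennreal (d y * (\<sigma> x * ?K y x)) \<partial>lborel \<partial>lborel)"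
      by (intro lborel_pair.Fubini') measurable
    also have "\<dots> = (\<integral>\<^sup>+y. ennreal (d y) * (\<integral>\<^sup>+x. ennreal (\<sigma> x * ?K y x) \<partial>lborel) \<partial>lborel)"
      using nn by (simp add: nn_integral_cmult[symmetric] ennreal_mult[symmetric])
    also have "\<dots> \<le> (\<integral>\<^sup>+y. ennreal (d y) * ennreal Q \<partial>lborel)"
      by (intro nn_integral_mono mult_left_mono Db) auto
    finally show ?thesis by (simp add: nn_integral_multc)
  qed
  also have "(\<integral>\<^sup>+x. \<integral>\<^sup>+y. ennreal (\<sigma> x * \<sigma> y * ?K x y) \<partial>lborel \<partial>lborel) + (\<integral>\<^sup>+x. ennreal (d x) \<partial>lborel) * ennreal P
      + (\<integral>\<^sup>+x. ennreal (d x) \<partial>lborel) * ennreal Q = D_nn \<gamma> v + ennreal (P + Q) * (\<integral>\<^sup>+x. ennreal (d x) \<partial>lborel)"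
    using PQ by (simp add: D distrib_right mult.commute add.assoc)
  also have "(\<integral>\<^sup>+x. ennreal (d x) \<partial>lborel) \<le> ennreal (l2norm (\<lambda>x. u x - v x) * (l2norm u + l2norm v))"
  proof -
    have uv: "(\<lambda>x. u x - v x) \<in> L2" by (rule L2_diff[OF u(1) v(1)])
    have "ennreal (d x) \<le> ennreal (norm (u x - v x) * norm (u x)) + ennreal (norm (u x - v x) * norm (v x))" for x
    proof -
      have "d x = \<bar>norm (u x) - norm (v x)\<bar> * (norm (u x) + norm (v x))"
        by (simp add: d_def power2_eq_square square_diff_square_factored abs_mult)
      also have "\<dots> \<le> norm (u x - v x) * (norm (u x) + norm (v x))"
        by (intro mult_right_mono norm_triangle_ineq3) auto
      finally have "ennreal (d x) \<le> ennreal (norm (u x - v x) * norm (u x) + norm (u x - v x) * norm (v x))"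
        by (intro ennreal_leI) (simp add: distrib_left)
      then show ?thesis by simp
    qed
    then have "(\<integral>\<^sup>+x. ennreal (d x) \<partial>lborel) \<le> (\<integral>\<^sup>+x. ennreal (norm (u x - v x) * norm (u x)) + ennreal (norm (u x - v x) * norm (v x)) \<partial>lborel)"
      by (rule nn_integral_mono)
    also have "\<dots> = (\<integral>\<^sup>+x. ennreal (norm (u x - v x) * norm (u x)) \<partial>lborel) + (\<integral>\<^sup>+x. ennreal (norm (u x - v x) * norm (v x)) \<partial>lborel)"
      by (rule nn_integral_add) measurable
    also have "\<dots> \<le> ennreal (l2norm (\<lambda>x. u x - v x) * l2norm u) + ennreal (l2norm (\<lambda>x. u x - v x) * l2norm v)"
      by (intro add_mono L2_Cauchy_Schwarz_nn uv u v)
    also have "\<dots> = ennreal (l2norm (\<lambda>x. u x - v x) * (l2norm u + l2norm v))"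
      by (simp add: distrib_left)
    finally show ?thesis .
  qed
  finally show ?thesis
    using PQ unfolding D by (simp add: ennreal_mult add_mono mult_left_mono)
qed

lemma D_energy_diff_le:
  assumes u: "u \<in> L2" "riesz_bounded \<gamma> u P" and v: "v \<in> L2" "riesz_bounded \<gamma> v Q"
  shows "\<bar>D_energy \<gamma> u - D_energy \<gamma> v\<bar> \<le> (P + Q) * (l2norm (\<lambda>x. u x - v x) * (l2norm u + l2norm v))"
proof -
  have PQ: "P \<ge> 0" "Q \<ge> 0" using u v by (auto simp: riesz_bounded_def)
  define R where "R = (P + Q) * (l2norm (\<lambda>x. u x - v x) * (l2norm u + l2norm v))"
  have R: "R \<ge> 0" using PQ by (simp add: R_def)
  note Du = D_energy_nn[OF u] and Dv = D_energy_nn[OF v]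
  have "ennreal (D_energy \<gamma> u) \<le> ennreal (D_energy \<gamma> v + R)"
    using D_nn_diff_le[OF u v] Du Dv R by (simp add: R_def)
  moreover have "ennreal (D_energy \<gamma> v) \<le> ennreal (D_energy \<gamma> u + R)"
    using D_nn_diff_le[OF v u] Du Dv R by (simp add: R_def l2norm_minus_commute[of v u] add.commute)
  ultimately have "D_energy \<gamma> u \<le> D_energy \<gamma> v + R" "D_energy \<gamma> v \<le> D_energy \<gamma> u + R"
    using Du(2) Dv(2) R by (simp_all add: ennreal_le_iff del: ennreal_plus)
  then show ?thesis unfolding R_def by linarith
qed

lemma D_energy_scaleR: "D_energy \<gamma> (\<lambda>x. t *\<^sub>R u x) = t ^ 4 * D_energy \<gamma> u"
proof -
  have *: "(norm (t *\<^sub>R u x))\<^sup>2 * (norm (t *\<^sub>R u y))\<^sup>2 / norm (x - y) powr \<gamma>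
     = t ^ 4 * ((norm (u x))\<^sup>2 * (norm (u y))\<^sup>2 / norm (x - y) powr \<gamma>)" for x y
    by (simp add: power_mult_distrib power2_eq_square power4_eq_xxxx)
  show ?thesis unfolding D_energy_def * by (simp only: integral_mult_right_zero)
qed

lemma D_energy_translate:
  assumes [measurable]: "u \<in> borel_measurable borel"
  shows "D_energy \<gamma> (\<lambda>x. u (x + a)) = D_energy \<gamma> u"
proof -
  have [measurable]: "(\<lambda>x. LINT y|lborel. (norm (u x))\<^sup>2 * (norm (u y))\<^sup>2 / norm (x - y) powr \<gamma>) \<in> borel_measurable borel"
    by (intro lborel.borel_measurable_lebesgue_integral) measurable
  have "(LINT y|lborel. (norm (u (x + a)))\<^sup>2 * (norm (u (y + a)))\<^sup>2 / norm (x - y) powr \<gamma>)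
     = (LINT y|lborel. (norm (u (x + a)))\<^sup>2 * (norm (u y))\<^sup>2 / norm (x + a - y) powr \<gamma>)" for x
    using integral_translate[of "\<lambda>y. (norm (u (x + a)))\<^sup>2 * (norm (u y))\<^sup>2 / norm (x + a - y) powr \<gamma>" a] by simp
  then show ?thesis
    unfolding D_energy_def
    using integral_translate[of "\<lambda>x. LINT y|lborel. (norm (u x))\<^sup>2 * (norm (u y))\<^sup>2 / norm (x - y) powr \<gamma>" a] by simp
qed

section \<open>Scaling, translation and sums in \<open>H1\<close>\<close>

lemma H1_translation_estimate:
  assumes "u \<in> H1" shows "l2norm (\<lambda>x. u (x + h) - u x) \<le> l2norm (weak_gradient u) * norm h"
  using weak_gradient_translation_estimate[OF H1_L2[OF assms] H1_weak_gradient[OF assms], of h] by (simp add: mult.commute)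

lemma weak_gradient_scaleR:
  assumes "u \<in> H1"
  shows "(\<lambda>x. t *\<^sub>R u x) \<in> H1" "l2norm (weak_gradient (\<lambda>x. t *\<^sub>R u x)) = \<bar>t\<bar> * l2norm (weak_gradient u)"
proof -
  note g = H1_weak_gradient[OF assms]
  have h: "(\<lambda>x. t *\<^sub>R weak_gradient u x) \<in> L2" "has_weak_gradient (\<lambda>x. t *\<^sub>R u x) (\<lambda>x. t *\<^sub>R weak_gradient u x)"
    by (intro L2_scaleR has_weak_gradient_scaleR g)+
  show "(\<lambda>x. t *\<^sub>R u x) \<in> H1" by (rule H1_I[OF L2_scaleR[OF H1_L2[OF assms]] h])
  show "l2norm (weak_gradient (\<lambda>x. t *\<^sub>R u x)) = \<bar>t\<bar> * l2norm (weak_gradient u)"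
    using weak_gradient_l2norm[OF h] by (simp add: l2norm_scaleR)
qed

lemma weak_gradient_translate:
  assumes "u \<in> H1"
  shows "(\<lambda>x. u (x + a)) \<in> H1" "l2norm (weak_gradient (\<lambda>x. u (x + a))) = l2norm (weak_gradient u)"
proof -
  note g = H1_weak_gradient[OF assms]
  have h: "(\<lambda>x. weak_gradient u (x + a)) \<in> L2" "has_weak_gradient (\<lambda>x. u (x + a)) (\<lambda>x. weak_gradient u (x + a))"
    by (intro L2_translate has_weak_gradient_translate g H1_L2 assms)+
  show "(\<lambda>x. u (x + a)) \<in> H1" by (rule H1_I[OF L2_translate[OF H1_L2[OF assms]] h])
  show "l2norm (weak_gradient (\<lambda>x. u (x + a))) = l2norm (weak_gradient u)"
    using weak_gradient_l2norm[OF h] by (simp add: l2norm_translate[OF g(1)])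
qed

lemma weak_gradient_add:
  assumes "u \<in> H1" "v \<in> H1"
  shows "(\<lambda>x. u x + v x) \<in> H1" "l2norm (weak_gradient (\<lambda>x. u x + v x)) = l2norm (\<lambda>x. weak_gradient u x + weak_gradient v x)"
proof -
  note g = H1_weak_gradient[OF assms(1)] H1_weak_gradient[OF assms(2)]
  have h: "(\<lambda>x. weak_gradient u x + weak_gradient v x) \<in> L2" "has_weak_gradient (\<lambda>x. u x + v x) (\<lambda>x. weak_gradient u x + weak_gradient v x)"
    by (intro L2_add has_weak_gradient_add g H1_L2 assms)+
  show "(\<lambda>x. u x + v x) \<in> H1" by (rule H1_I[OF L2_add[OF H1_L2[OF assms(1)] H1_L2[OF assms(2)]] h])
  show "l2norm (weak_gradient (\<lambda>x. u x + v x)) = l2norm (\<lambda>x. weak_gradient u x + weak_gradient v x)"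
    by (rule weak_gradient_l2norm[OF h])
qed

lemma mass_sphere_iff: "u \<in> mass_sphere c \<longleftrightarrow> u \<in> H1 \<and> (l2norm u)\<^sup>2 = c"
  by (simp add: mass_sphere_def l2norm_square)

lemma energy_altdef: "energy \<gamma>1 \<gamma>2 u = (l2norm (weak_gradient u))\<^sup>2 / 2 + D_energy \<gamma>2 u / 4 - D_energy \<gamma>1 u / 4"
  by (simp add: energy_def l2norm_square)

lemma H1_norm_altdef: "H1_norm u = sqrt ((l2norm (weak_gradient u))\<^sup>2 + (l2norm u)\<^sup>2)"
  by (simp add: H1_norm_def l2norm_square)

text \<open>Exponent 2 gives a nonzero mass, exponent 4 serves to normalise the cutoff.\<close>

lemma small_test_function:
  assumes "s > 0"
  obtains \<phi> :: "real^'n \<Rightarrow> real" where "test_function \<phi>" "\<And>x. \<phi> x \<noteq> 0 \<Longrightarrow> norm x < s"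
    "\<And>x. 0 \<le> \<phi> x" "\<And>k. k > 0 \<Longrightarrow> 0 < (LINT x|lborel. \<phi> x ^ k)"
proof -
  \<comment> \<open>Coordinates below this \<open>r\<close> in absolute value keep the 1-norm, hence
    the Euclidean norm, below \<open>s\<close>.\<close>
  define r where "r = s / real CARD('n)"
  define a :: "real^'n" where "a = (\<chi> i. - r)"
  define b :: "real^'n" where "b = (\<chi> i. r)"
  define \<phi> where "\<phi> x = (\<Prod>i\<in>UNIV. bump (1 * (x $ i - a $ i)) * bump (1 * (b $ i - x $ i)))" for x
  have r: "r > 0" using assms by (simp add: r_def)
  have \<phi>: "test_function \<phi>" unfolding \<phi>_def by (rule test_function_product_bump)
  have nz: "\<phi> x \<noteq> 0 \<longleftrightarrow> x \<in> box a b" for x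
    by (auto simp: \<phi>_def bump_eq_0_iff mem_box_cart not_le)
  have nn: "0 \<le> \<phi> x" for x unfolding \<phi>_def by (intro prod_nonneg) (auto simp: bump_nonneg)
  have "norm x < s" if "\<phi> x \<noteq> 0" for x
  proof -
    have *: "\<bar>x $ i\<bar> < r" for i using that by (simp add: nz mem_box_cart a_def b_def abs_less_iff minus_less_iff)
    have "norm x \<le> (\<Sum>i\<in>UNIV. \<bar>x $ i\<bar>)" by (rule norm_le_l1_cart)
    also have "\<dots> < (\<Sum>i\<in>(UNIV::'n set). r)" by (intro sum_strict_mono *) auto
    also have "\<dots> = s" by (simp add: r_def)
    finally show ?thesis .
  qed
  moreover have "0 < (LINT x|lborel. \<phi> x ^ k)" if "k > 0" for k
  proof (rule ccontr)
    have i: "integrable lborel (\<lambda>x. \<phi> x ^ k)" by (rule test_function_integrable_power[OF \<phi> that])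
    assume "\<not> 0 < (LINT x|lborel. \<phi> x ^ k)"
    moreover have "0 \<le> (LINT x|lborel. \<phi> x ^ k)" by (intro integral_nonneg_AE AE_I2) (simp add: nn)
    ultimately have "(LINT x|lborel. \<phi> x ^ k) = 0" by simp
    then have "AE x in lborel. \<phi> x ^ k = 0" using integral_nonneg_eq_0_iff_AE[OF i] nn by simp
    then have "AE x in lborel. x \<notin> box a b" by eventually_elim (use that in \<open>simp add: nz[symmetric]\<close>)
    then have "box a b \<in> null_sets lborel" by (subst AE_iff_null_sets) auto
    then have "negligible (box a b)" by (simp add: negligible_iff_null_sets null_sets_completionI)
    moreover have "box a b \<noteq> {}" using r by (simp add: box_ne_empty a_def b_def Basis_vec_def inner_axis)
    ultimately show False by (simp add: negligible_interval)
  qed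
  ultimately show thesis using that[of \<phi>] \<phi> nn by blast
qed

section \<open>Scaling and strict subadditivity\<close>

lemma test_function_H1:
  fixes \<phi> :: "real^'n \<Rightarrow> real"
  assumes \<phi>: "test_function \<phi>" shows "(\<lambda>x. complex_of_real (\<phi> x)) \<in> H1"
proof (rule H1_I[OF _ _ test_function_has_weak_gradient[OF \<phi>]])
  note [measurable] = test_function_measurable[OF \<phi>] test_function_measurable[OF test_function_derivative[OF \<phi>]]
  show "(\<lambda>x. complex_of_real (\<phi> x)) \<in> L2"
    by (rule L2_dominated[OF _ test_function_L2[OF \<phi>], where C=1]) auto
  have i: "integrable lborel (\<lambda>x. \<Sum>i\<in>UNIV. (norm (frechet_derivative \<phi> (at x) (axis i 1)))\<^sup>2)"
    by (intro Bochner_Integration.integrable_sum L2_integrable test_function_L2 test_function_derivative \<phi>)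
  show "(\<lambda>x. \<chi> i. complex_of_real (frechet_derivative \<phi> (at x) (axis i 1))) \<in> L2"
  proof (rule L2_bound[OF _ i])
    show "(\<lambda>x. \<chi> i. complex_of_real (frechet_derivative \<phi> (at x) (axis i 1))) \<in> borel_measurable borel"
      by (simp add: borel_measurable_vec_iff)
  qed (simp add: norm_vec_square)
qed

text \<open>Fixing the constant by choice makes the bound \<open>P\<close> a term that different
  lemmas can share; \<open>riesz_bounded_ex\<close> shows that the choice succeeds. It depends on
  the dimension and the exponent alone.\<close>

definition riesz_const :: "'n::finite itself \<Rightarrow> real \<Rightarrow> real" where
  "riesz_const _ \<gamma> = (SOME C. C > 0 \<and> (\<forall>u::real^'n \<Rightarrow> complex. \<forall>l>0. u \<in> H1 \<longrightarrow>
     riesz_bounded \<gamma> u (C * l powr (- \<gamma>) * ((l2norm u)\<^sup>2 + (l2norm (weak_gradient u) * l)\<^sup>2))))"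

locale riesz_pair =
  fixes \<gamma>1 \<gamma>2 :: real and TN :: "'n::finite itself"
  assumes \<gamma>2: "0 < \<gamma>2" and \<gamma>21: "\<gamma>2 < \<gamma>1" and \<gamma>1: "\<gamma>1 < real CARD('n)" "\<gamma>1 < 2"
begin

abbreviation E :: "(real^'n \<Rightarrow> complex) \<Rightarrow> real" where "E \<equiv> energy \<gamma>1 \<gamma>2"
abbreviation D1 :: "(real^'n \<Rightarrow> complex) \<Rightarrow> real" where "D1 \<equiv> D_energy \<gamma>1"
abbreviation D2 :: "(real^'n \<Rightarrow> complex) \<Rightarrow> real" where "D2 \<equiv> D_energy \<gamma>2"
abbreviation G :: "(real^'n \<Rightarrow> complex) \<Rightarrow> real" where "G u \<equiv> l2norm (weak_gradient u)"
abbreviation m :: "real \<Rightarrow> real" where "m \<equiv> min_energy TN \<gamma>1 \<gamma>2"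
abbreviation S :: "real \<Rightarrow> (real^'n \<Rightarrow> complex) set" where "S \<equiv> mass_sphere"

lemma riesz_bounded_ex:
  assumes "\<gamma> \<in> {\<gamma>1, \<gamma>2}"
  shows "\<exists>C>0. \<forall>u::real^'n \<Rightarrow> complex. \<forall>l>0. u \<in> H1 \<longrightarrow> riesz_bounded \<gamma> u (C * l powr (- \<gamma>) * ((l2norm u)\<^sup>2 + (G u * l)\<^sup>2))"
proof -
  have g: "0 < \<gamma>" "\<gamma> < real CARD('n)" "\<gamma> < 2" using assms \<gamma>1 \<gamma>2 \<gamma>21 by auto
  show ?thesis
  proof (rule Riesz_potential_bound[OF g, where 'b=complex])
    fix C :: real
    assume C: "0 < C" and
      *: "\<And>(u :: real^'n \<Rightarrow> complex) K a l. u \<in> L2 \<Longrightarrow> K \<ge> 0 \<Longrightarrow> (\<And>h. l2norm (\<lambda>x. u (x + h) - u x) \<le> K * norm h) \<Longrightarrow>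
      l > 0 \<Longrightarrow> (\<integral>\<^sup>+x. ennreal ((norm (u x))\<^sup>2 / norm (a - x) powr \<gamma>) \<partial>lborel)
        \<le> ennreal (C * l powr (- \<gamma>) * ((l2norm u)\<^sup>2 + (K * l)\<^sup>2))"
    show ?thesis
    proof (intro exI[of _ C] conjI C allI impI)
      fix u :: "real^'n \<Rightarrow> complex" and l :: real assume "l > 0" "u \<in> H1"
      then show "riesz_bounded \<gamma> u (C * l powr (- \<gamma>) * ((l2norm u)\<^sup>2 + (G u * l)\<^sup>2))"
        unfolding riesz_bounded_def using C
        by (auto intro!: * H1_L2 H1_translation_estimate)
    qed
  qed
qed

abbreviation CR :: "real \<Rightarrow> real" where "CR \<equiv> riesz_const TN"

lemma CR:
  assumes "\<gamma> \<in> {\<gamma>1, \<gamma>2}"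
  shows "0 < CR \<gamma>" "\<And>u l. l > 0 \<Longrightarrow> u \<in> H1 \<Longrightarrow> riesz_bounded \<gamma> u (CR \<gamma> * l powr (- \<gamma>) * ((l2norm u)\<^sup>2 + (G u * l)\<^sup>2))"
  using someI_ex[OF riesz_bounded_ex[OF assms, unfolded Bex_def]] unfolding riesz_const_def[symmetric, of _ TN] by auto

text \<open>The potential bound at scale \<open>l = 1\<close>, in terms of upper bounds for the mass
  and the gradient norm, so that one value serves a whole sequence.\<close>

abbreviation P :: "real \<Rightarrow> real \<Rightarrow> real \<Rightarrow> real" where
  "P \<gamma> c K \<equiv> CR \<gamma> * (c + K\<^sup>2)"

lemma P: assumes "\<gamma> \<in> {\<gamma>1, \<gamma>2}" "u \<in> H1" "(l2norm u)\<^sup>2 \<le> c" "G u \<le> K"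
  shows "riesz_bounded \<gamma> u (P \<gamma> c K)"
proof -
  have r: "riesz_bounded \<gamma> u (CR \<gamma> * ((l2norm u)\<^sup>2 + (G u)\<^sup>2))"
    using CR(2)[OF assms(1), of 1 u] assms(2) by simp
  have le: "CR \<gamma> * ((l2norm u)\<^sup>2 + (G u)\<^sup>2) \<le> P \<gamma> c K"
    using CR(1)[OF assms(1)] assms(3,4) by (intro mult_left_mono add_mono power_mono) auto
  show ?thesis using r le unfolding riesz_bounded_def by (meson ennreal_leI order_trans)
qed

lemma
  fixes u :: "real^'n \<Rightarrow> complex"
  shows D_nonneg: "\<gamma> \<in> {\<gamma>1, \<gamma>2} \<Longrightarrow> u \<in> H1 \<Longrightarrow> 0 \<le> D_energy \<gamma> u"
  and D_nn_eq: "\<gamma> \<in> {\<gamma>1, \<gamma>2} \<Longrightarrow> u \<in> H1 \<Longrightarrow> D_nn \<gamma> u = ennreal (D_energy \<gamma> u)"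
  using D_energy_nn[OF H1_L2 P[of \<gamma> u "(l2norm u)\<^sup>2" "G u"]] by auto

lemma D_zero:
  fixes u :: "real^'n \<Rightarrow> complex"
  shows "\<gamma> \<in> {\<gamma>1, \<gamma>2} \<Longrightarrow> u \<in> H1 \<Longrightarrow> l2norm u = 0 \<Longrightarrow> D_energy \<gamma> u = 0"
  using D_energy_nn(2,3)[OF H1_L2 P[of \<gamma> u "(l2norm u)\<^sup>2" "G u"]] by auto

lemma D1_le_gradient:
  assumes "c > 0"
  shows "\<exists>B. \<forall>u. u \<in> H1 \<longrightarrow> (l2norm u)\<^sup>2 = c \<longrightarrow> D1 u \<le> (G u)\<^sup>2 + B"
proof -
  define C where "C = CR \<gamma>1"
  have C: "C > 0" using CR(1)[of \<gamma>1] by (simp add: C_def)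
  \<comment> \<open>The scale solves \<open>c * C * l powr (2 - \<gamma>1) = 1\<close>, so the
    squared gradient enters with coefficient exactly 1; this uses
    \<open>\<gamma>1 < 2\<close>.\<close>
  define l where "l = (c * C) powr (- 1 / (2 - \<gamma>1))"
  have l: "l > 0" using C assms by (simp add: l_def)
  have "l powr (2 - \<gamma>1) = (c * C) powr (-1)" unfolding l_def powr_powr using \<gamma>1 by simp
  then have "c * (C * l powr (2 - \<gamma>1)) = 1" using C assms by (simp add: powr_neg_one)
  moreover have "l powr (2 - \<gamma>1) = l powr (- \<gamma>1) * l\<^sup>2"
    using l powr_add[of l "- \<gamma>1" 2] by simp
  ultimately have 1: "c * (C * l powr (- \<gamma>1) * l\<^sup>2) = 1" by simp
  have "D1 u \<le> (G u)\<^sup>2 + c * (C * l powr (- \<gamma>1) * c)" if u: "u \<in> H1" "(l2norm u)\<^sup>2 = c" for u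
  proof -
    have "D1 u \<le> (l2norm u)\<^sup>2 * (C * l powr (- \<gamma>1) * ((l2norm u)\<^sup>2 + (G u * l)\<^sup>2))"
      unfolding C_def by (rule D_energy_nn(3)[OF H1_L2[OF u(1)] CR(2)]) (use l u in auto)
    also have "\<dots> = c * (C * l powr (- \<gamma>1) * c) + (c * (C * l powr (- \<gamma>1) * l\<^sup>2)) * (G u)\<^sup>2"
      by (simp add: u power_mult_distrib algebra_simps)
    finally show ?thesis by (simp add: 1)
  qed
  then show ?thesis by blast
qed

text \<open>Four times the energy is \<open>2 * (G u)\<^sup>2 + D2 u - D1 u\<close>, and
  \<open>D1_le_gradient\<close> lets \<open>D1\<close> consume only one of the two squared
  gradients.\<close>

lemma energy_coercive:
  assumes "c > 0"
  obtains B where "\<And>u. u \<in> S c \<Longrightarrow> (G u)\<^sup>2 \<le> 4 * E u + B"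
proof -
  obtain B where B: "\<And>u. u \<in> H1 \<Longrightarrow> (l2norm u)\<^sup>2 = c \<Longrightarrow> D1 u \<le> (G u)\<^sup>2 + B"
    using D1_le_gradient[OF assms] by blast
  have "(G u)\<^sup>2 \<le> 4 * E u + B" if "u \<in> S c" for u
  proof -
    have "u \<in> H1" "(l2norm u)\<^sup>2 = c" using that by (auto simp: mass_sphere_iff)
    then show ?thesis using B[of u] D_nonneg[of \<gamma>2 u] by (simp add: energy_altdef)
  qed
  then show thesis by (rule that)
qed

lemma energy_bdd_below: assumes "c > 0" shows "bdd_below (E ` S c)"
proof -
  obtain B where B: "\<And>u. u \<in> S c \<Longrightarrow> (G u)\<^sup>2 \<le> 4 * E u + B" using energy_coercive[OF assms] by blast
  have "- (B / 4) \<le> E u" if "u \<in> S c" for u using B[OF that] zero_le_power2[of "G u"] by linarith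
  then show ?thesis by (rule bdd_belowI2)
qed

lemma min_energy_le: "c > 0 \<Longrightarrow> u \<in> S c \<Longrightarrow> m c \<le> E u"
  unfolding min_energy_def by (rule cINF_lower[OF energy_bdd_below])

lemma scaled_mass:
  assumes "u \<in> H1" "l2norm u \<noteq> 0" "c > 0"
  shows "(\<lambda>x. sqrt (c / (l2norm u)\<^sup>2) *\<^sub>R u x) \<in> S c"
    "E (\<lambda>x. sqrt (c / (l2norm u)\<^sup>2) *\<^sub>R u x)
      = (c / (l2norm u)\<^sup>2) * (G u)\<^sup>2 / 2 + (c / (l2norm u)\<^sup>2)\<^sup>2 * (D2 u - D1 u) / 4"
proof -
  define t where "t = sqrt (c / (l2norm u)\<^sup>2)"
  have t: "t\<^sup>2 = c / (l2norm u)\<^sup>2" using assms by (simp add: t_def)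
  have t4: "t ^ 4 = (c / (l2norm u)\<^sup>2)\<^sup>2" by (simp flip: t)
  have "(l2norm (\<lambda>x. t *\<^sub>R u x))\<^sup>2 = c" using assms by (simp add: l2norm_scaleR power_mult_distrib t)
  then show "(\<lambda>x. sqrt (c / (l2norm u)\<^sup>2) *\<^sub>R u x) \<in> S c"
    unfolding mass_sphere_iff t_def using weak_gradient_scaleR(1)[OF assms(1)] by simp
  show "E (\<lambda>x. sqrt (c / (l2norm u)\<^sup>2) *\<^sub>R u x)
      = (c / (l2norm u)\<^sup>2) * (G u)\<^sup>2 / 2 + (c / (l2norm u)\<^sup>2)\<^sup>2 * (D2 u - D1 u) / 4"
    unfolding t_def[symmetric]
    by (simp add: energy_altdef weak_gradient_scaleR(2)[OF assms(1)] D_energy_scaleR power_mult_distrib t t4 right_diff_distrib diff_divide_distrib)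
qed

text \<open>Rescaling \<open>u\<close> to mass \<open>c\<close> and dividing by the square of the scaling factor.\<close>

lemma scaling_inequality:
  assumes u: "u \<in> H1" and c: "c > 0"
  shows "D1 u / 4 \<le> ((l2norm u)\<^sup>2 / c) * (G u)\<^sup>2 / 2 + D2 u / 4 + ((l2norm u)\<^sup>2 / c)\<^sup>2 * (- m c)"
proof (cases "l2norm u = 0")
  case True
  then show ?thesis using D_zero[of \<gamma>1 u] D_zero[of \<gamma>2 u] u by simp
next
  case False
  define s where "s = c / (l2norm u)\<^sup>2"
  have s: "s > 0" using c False by (simp add: s_def)
  have "m c \<le> s * (G u)\<^sup>2 / 2 + s\<^sup>2 * (D2 u - D1 u) / 4"
    using min_energy_le[OF c scaled_mass(1)[OF u False c]] scaled_mass(2)[OF u False c] by (simp add: s_def)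
  then have "m c / s\<^sup>2 \<le> (s * (G u)\<^sup>2 / 2 + s\<^sup>2 * (D2 u - D1 u) / 4) / s\<^sup>2"
    by (rule divide_right_mono) simp
  also have "\<dots> = (1 / s) * (G u)\<^sup>2 / 2 + (D2 u - D1 u) / 4"
    using s by (simp add: field_simps power2_eq_square)
  finally have "D1 u / 4 \<le> (1 / s) * (G u)\<^sup>2 / 2 + D2 u / 4 + (1 / s)\<^sup>2 * (- m c)"
    by (simp add: field_simps power_divide)
  moreover have "1 / s = (l2norm u)\<^sup>2 / c" by (simp add: s_def)
  ultimately show ?thesis by simp
qed

text \<open>For mass at most \<open>c\<close> the coefficient of the gradient in
  \<open>scaling_inequality\<close> is at most that in the energy.\<close>

lemma energy_ge_square:
  assumes u: "u \<in> H1" "(l2norm u)\<^sup>2 \<le> c" and c: "c > 0"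
  shows "((l2norm u)\<^sup>2 / c)\<^sup>2 * m c \<le> E u"
proof -
  have "((l2norm u)\<^sup>2 / c) * (G u)\<^sup>2 \<le> 1 * (G u)\<^sup>2" using u c by (intro mult_right_mono) auto
  then show ?thesis using scaling_inequality[OF u(1) c] by (simp add: energy_altdef)
qed

lemma mass_sphere_nonempty: assumes "c > 0" shows "S c \<noteq> {}"
proof -
  obtain \<phi> :: "real^'n \<Rightarrow> real" where \<phi>: "test_function \<phi>" "\<And>k. k > 0 \<Longrightarrow> 0 < (LINT x|lborel. \<phi> x ^ k)"
    by (rule small_test_function[of 1]) auto
  let ?u = "\<lambda>x. complex_of_real (\<phi> x)"
  have "?u \<in> H1" by (rule test_function_H1[OF \<phi>(1)])
  moreover have "l2norm ?u \<noteq> 0" using \<phi>(2)[of 2] by (simp add: l2norm_def)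
  ultimately show ?thesis using scaled_mass(1)[OF _ _ assms] by blast
qed

lemma min_energy_ge_square:
  assumes "0 < c1" "c1 \<le> c" shows "(c1 / c)\<^sup>2 * m c \<le> m c1"
proof -
  have "(c1 / c)\<^sup>2 * m c \<le> E u" if "u \<in> S c1" for u
    using energy_ge_square[of u c] that assms by (simp add: mass_sphere_iff)
  then show ?thesis unfolding min_energy_def[of _ _ _ c1]
    by (intro cINF_greatest mass_sphere_nonempty assms) auto
qed

lemma strict_subadditivity:
  assumes "m c < 0" "c = c1 + c2" "0 < c1" "0 < c2"
  shows "m c < m c1 + m c2"
proof -
  have "c1\<^sup>2 + c2\<^sup>2 < c\<^sup>2" using assms by (simp add: power2_sum)
  then have "(c1 / c)\<^sup>2 + (c2 / c)\<^sup>2 < 1" using assms by (simp add: power_divide field_simps)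
  \<comment> \<open>Since \<open>m c\<close> is negative, a factor below 1 raises it.\<close>
  then have "m c < ((c1 / c)\<^sup>2 + (c2 / c)\<^sup>2) * m c" using assms(1) by (simp add: mult_less_cancel_right1)
  also have "\<dots> \<le> m c1 + m c2"
    using min_energy_ge_square[of c1 c] min_energy_ge_square[of c2 c] assms by (simp add: distrib_right)
  finally show ?thesis .
qed

text \<open>Between points of a support of diameter at most 1/2 the more singular kernel dominates
  the other by a factor \<kappa> > 1, so \<open>D1 u > D2 u\<close>. Raising the mass multiplies
  this difference quadratically and the gradient term only linearly.\<close>

lemma min_energy_negative: "\<exists>c0>0. \<forall>c>c0. m c < 0"
proof -
  obtain \<phi> :: "real^'n \<Rightarrow> real" where \<phi>: "test_function \<phi>" "\<And>x. \<phi> x \<noteq> 0 \<Longrightarrow> norm x < 1/4" "\<And>k. k > 0 \<Longrightarrow> 0 < (LINT x|lborel. \<phi> x ^ k)"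
    by (rule small_test_function[of "1/4"]) auto
  note [measurable] = test_function_measurable[OF \<phi>(1)]
  define u where "u x = complex_of_real (\<phi> x)" for x
  have [measurable]: "u \<in> borel_measurable borel" unfolding u_def[abs_def] by measurable
  have u: "u \<in> H1" unfolding u_def[abs_def] by (rule test_function_H1[OF \<phi>(1)])
  have nz: "l2norm u \<noteq> 0" using \<phi>(3)[of 2] by (simp add: l2norm_def u_def)
  define \<kappa> where "\<kappa> = 2 powr (\<gamma>1 - \<gamma>2)"
  have \<kappa>: "\<kappa> > 1" unfolding \<kappa>_def using \<gamma>21 by simp
  have small: "norm (x - y) < 1/2" if "\<phi> x \<noteq> 0" "\<phi> y \<noteq> 0" for x y
    using \<phi>(2)[OF that(1)] \<phi>(2)[OF that(2)] norm_triangle_ineq4[of x y] by linarith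
  have pw: "ennreal \<kappa> * ennreal ((norm (u x))\<^sup>2 * (norm (u y))\<^sup>2 / norm (x - y) powr \<gamma>2) \<le> ennreal ((norm (u x))\<^sup>2 * (norm (u y))\<^sup>2 / norm (x - y) powr \<gamma>1)" for x y
  proof (cases "\<phi> x = 0 \<or> \<phi> y = 0 \<or> x = y")
    case False
    define r where "r = norm (x - y)"
    have r: "0 < r" "r < 1/2" using small[of x y] False by (auto simp: r_def)
    have "(2 * r) powr (\<gamma>1 - \<gamma>2) \<le> 1" using r \<gamma>21 by (intro powr_le1) auto
    then have "\<kappa> * r powr (\<gamma>1 - \<gamma>2) \<le> 1" using r by (simp add: \<kappa>_def powr_mult)
    then have "\<kappa> / r powr \<gamma>2 \<le> 1 / r powr \<gamma>1" using r by (simp add: powr_diff field_simps)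
    then have "((norm (u x))\<^sup>2 * (norm (u y))\<^sup>2) * (\<kappa> / r powr \<gamma>2) \<le> ((norm (u x))\<^sup>2 * (norm (u y))\<^sup>2) * (1 / r powr \<gamma>1)"
      by (intro mult_left_mono) auto
    then show ?thesis using \<kappa> by (simp add: r_def ennreal_leI mult_ac flip: ennreal_mult)
  qed (auto simp: u_def)
  have D12: "\<kappa> * D2 u \<le> D1 u"
  proof -
    have "ennreal \<kappa> * D_nn \<gamma>2 u \<le> D_nn \<gamma>1 u"
      unfolding D_nn_def using pw by (auto simp: nn_integral_cmult[symmetric] intro!: nn_integral_mono)
    then show ?thesis using D_nn_eq[of \<gamma>1 u] D_nn_eq[of \<gamma>2 u] D_nonneg[of \<gamma>1 u] u \<kappa>
      by (simp add: ennreal_le_iff flip: ennreal_mult')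
  qed
  \<comment> \<open>Strictness needs \<open>D2 u > 0\<close>: on the support distances are below 1,
    so off the null diagonal the kernel is at least 1, and \<open>D2 u\<close> is at least the
    squared mass.\<close>
  have "D_nn \<gamma>2 u \<ge> (\<integral>\<^sup>+x. \<integral>\<^sup>+y. ennreal ((norm (u x))\<^sup>2) * ennreal ((norm (u y))\<^sup>2) \<partial>lborel \<partial>lborel)"
    unfolding D_nn_def
  proof (rule nn_integral_mono, rule nn_integral_mono_AE)
    fix x :: "real^'n"
    have "AE y in lborel. y \<noteq> x" by (rule AE_lborel_singleton)
    then show "AE y in lborel. ennreal ((norm (u x))\<^sup>2) * ennreal ((norm (u y))\<^sup>2) \<le> ennreal ((norm (u x))\<^sup>2 * (norm (u y))\<^sup>2 / norm (x - y) powr \<gamma>2)"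
    proof eventually_elim
      case (elim y)
      show ?case
      proof (cases "\<phi> x = 0 \<or> \<phi> y = 0")
        case False
        have "norm (x - y) powr \<gamma>2 \<le> 1" using small[of x y] False \<gamma>2 by (intro powr_le1) auto
        moreover have "norm (x - y) powr \<gamma>2 > 0" using elim by simp
        ultimately have "(norm (u x))\<^sup>2 * (norm (u y))\<^sup>2 \<le> (norm (u x))\<^sup>2 * (norm (u y))\<^sup>2 / norm (x - y) powr \<gamma>2"
          by (simp add: le_divide_eq mult_left_le)
        then show ?thesis by (simp add: ennreal_leI flip: ennreal_mult)
      qed (auto simp: u_def)
    qed
  qed
  moreover have "(\<integral>\<^sup>+x. \<integral>\<^sup>+y. ennreal ((norm (u x))\<^sup>2) * ennreal ((norm (u y))\<^sup>2) \<partial>lborel \<partial>lborel) = ennreal ((l2norm u)\<^sup>2 * (l2norm u)\<^sup>2)"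
    by (simp add: nn_integral_cmult nn_integral_multc nn_integral_L2[OF H1_L2[OF u]]) (simp flip: ennreal_mult)
  ultimately have "0 < D2 u"
    using D_nn_eq[of \<gamma>2 u] u nz by (cases "D2 u > 0") (simp_all add: ennreal_neg not_less)
  then have "D2 u < \<kappa> * D2 u" using \<kappa> by simp
  with D12 have lt: "D2 u < D1 u" by linarith
  define a where "a = (l2norm u)\<^sup>2"
  have a: "a > 0" using nz by (simp add: a_def)
  define W where "W = D1 u - D2 u"
  have W: "W > 0" using lt by (simp add: W_def)
  \<comment> \<open>The rescaled energy has the sign of
    \<open>2 * a * (G u)\<^sup>2 - c * W\<close>; the summand 1 makes the threshold positive at
    once.\<close>
  define c0 where "c0 = 2 * a * (G u)\<^sup>2 / W + 1"
  have "c0 > 0" using a W by (simp add: c0_def add_nonneg_pos)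
  moreover have "m c < 0" if "c > c0" for c
  proof -
    have c: "c > 0" using that \<open>c0 > 0\<close> by simp
    have "m c \<le> (c / a) * (G u)\<^sup>2 / 2 + (c / a)\<^sup>2 * (D2 u - D1 u) / 4"
      using min_energy_le[OF c scaled_mass(1)[OF u nz c]] scaled_mass(2)[OF u nz c] by (simp add: a_def)
    also have "\<dots> = (c / a) / (4 * a) * (2 * a * (G u)\<^sup>2 - c * W)"
      using a by (simp add: W_def field_simps power2_eq_square)
    also have "\<dots> < 0"
    proof (rule mult_pos_neg)
      have "2 * a * (G u)\<^sup>2 / W < c" using that by (simp add: c0_def)
      then show "2 * a * (G u)\<^sup>2 - c * W < 0" using W by (simp add: field_simps)
    qed (use a c in auto)
    finally show ?thesis .
  qed
  ultimately show ?thesis by blast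
qed

end

section \<open>Concentration of near-minimizers\<close>

definition gradsq :: "(real^'n \<Rightarrow> real) \<Rightarrow> real^'n \<Rightarrow> real" where
  "gradsq \<phi> x = (\<Sum>i\<in>UNIV. (frechet_derivative \<phi> (at x) (axis i 1))\<^sup>2)"

lemma gradsq_nonneg: "0 \<le> gradsq \<phi> x"
  by (simp add: gradsq_def sum_nonneg)

lemma gradsq_measurable: "test_function \<phi> \<Longrightarrow> gradsq \<phi> \<in> borel_measurable borel"
  unfolding gradsq_def[abs_def]
  by (intro borel_measurable_sum borel_measurable_power test_function_measurable test_function_derivative)

lemma gradsq_integrable: "test_function \<phi> \<Longrightarrow> integrable lborel (gradsq \<phi>)"
  unfolding gradsq_def[abs_def]
  by (intro Bochner_Integration.integrable_sum test_function_integrable_power test_function_derivative) auto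

text \<open>Young's inequality with a parameter: small \<eta> keeps the coefficient of the first
  summand close to 1, and the large factor falls on the second.\<close>

lemma power2_norm_add_le:
  fixes a b :: "'a::real_normed_vector"
  assumes "\<eta> > 0"
  shows "(norm (a + b))\<^sup>2 \<le> (1 + \<eta>) * (norm a)\<^sup>2 + (1 + 1 / \<eta>) * (norm b)\<^sup>2"
proof -
  have "(norm (a + b))\<^sup>2 \<le> (norm a + norm b)\<^sup>2" by (intro power_mono norm_triangle_ineq) auto
  also have "\<dots> \<le> (1 + \<eta>) * (norm a)\<^sup>2 + (1 + 1 / \<eta>) * (norm b)\<^sup>2"
  proof -
    have "0 \<le> (\<eta> * norm a - norm b)\<^sup>2 / \<eta>" using assms by simp
    also have "\<dots> = \<eta> * (norm a)\<^sup>2 + (1 / \<eta>) * (norm b)\<^sup>2 - 2 * norm a * norm b"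
      using assms by (simp add: power2_eq_square field_simps)
    finally show ?thesis by (simp add: power2_sum algebra_simps)
  qed
  finally show ?thesis .
qed

text \<open>The first integral carries the localised gradient, the second the error from
  differentiating the cutoff. They stay separate extended integrals because each is later multiplied
  by a mass and integrated over the centres of the cutoffs.\<close>

lemma test_function_mult_H1:
  fixes \<xi> :: "real^'n \<Rightarrow> real"
  assumes \<xi>: "test_function \<xi>" and u: "u \<in> H1" and \<eta>: "\<eta> > 0"
  shows "(\<lambda>x. \<xi> x *\<^sub>R u x) \<in> H1"
    and "ennreal ((l2norm (weak_gradient (\<lambda>x. \<xi> x *\<^sub>R u x)))\<^sup>2) \<le>
      ennreal (1 + \<eta>) * (\<integral>\<^sup>+x. ennreal ((\<xi> x)\<^sup>2) * ennreal ((norm (weak_gradient u x))\<^sup>2) \<partial>lborel)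
      + ennreal (1 + 1 / \<eta>) * (\<integral>\<^sup>+x. ennreal (gradsq \<xi> x) * ennreal ((norm (u x))\<^sup>2) \<partial>lborel)"
proof -
  note g = H1_weak_gradient[OF u] and uL = H1_L2[OF u]
  note [measurable] = L2_measurable[OF g(1)] L2_measurable[OF uL] test_function_measurable[OF \<xi>]
    test_function_measurable[OF test_function_derivative[OF \<xi>]] gradsq_measurable[OF \<xi>]
  define h where "h x = (\<chi> i. frechet_derivative \<xi> (at x) (axis i 1) *\<^sub>R u x)" for x
  have hm [measurable]: "h \<in> borel_measurable borel" unfolding h_def[abs_def] by (simp add: borel_measurable_vec_iff)
  have hn: "(norm (h x))\<^sup>2 = gradsq \<xi> x * (norm (u x))\<^sup>2" for x
    by (simp add: h_def norm_vec_square gradsq_def power_mult_distrib sum_distrib_right)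
  obtain B where B: "0 < B" "\<And>x. \<bar>\<xi> x\<bar> \<le> B" using test_function_bound[OF \<xi>] by metis
  obtain L where L: "0 < L" "\<And>x v. \<bar>frechet_derivative \<xi> (at x) v\<bar> \<le> L * norm v"
    using test_function_derivative_bound[OF \<xi>] by metis
  have v: "(\<lambda>x. \<xi> x *\<^sub>R u x) \<in> L2"
    by (rule L2_dominated[OF _ uL, where C=B]) (auto intro: mult_right_mono B)
  have g1: "(\<lambda>x. \<xi> x *\<^sub>R weak_gradient u x) \<in> L2"
    by (rule L2_dominated[OF _ g(1), where C=B]) (auto intro: mult_right_mono B)
  have h2: "h \<in> L2"
  proof (rule L2_bound[OF hm])
    show "integrable lborel (\<lambda>x. (real CARD('n) * L\<^sup>2) * (norm (u x))\<^sup>2)"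
      by (intro integrable_mult_right L2_integrable uL)
    have "gradsq \<xi> x \<le> (\<Sum>i\<in>(UNIV::'n set). L\<^sup>2)" for x
      unfolding gradsq_def using L(2)[of x "axis _ 1"] by (intro sum_mono) (auto simp: abs_le_square_iff[symmetric] L(1) less_imp_le)
    then show "(norm (h x))\<^sup>2 \<le> (real CARD('n) * L\<^sup>2) * (norm (u x))\<^sup>2" for x
      unfolding hn by (intro mult_right_mono) auto
  qed
  have w: "(\<lambda>x. \<xi> x *\<^sub>R weak_gradient u x + h x) \<in> L2" by (rule L2_add[OF g1 h2])
  have hw: "has_weak_gradient (\<lambda>x. \<xi> x *\<^sub>R u x) (\<lambda>x. \<xi> x *\<^sub>R weak_gradient u x + h x)"
    unfolding h_def by (rule test_function_mult_gradient[OF \<xi> uL g])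
  show "(\<lambda>x. \<xi> x *\<^sub>R u x) \<in> H1" by (rule H1_I[OF v w hw])
  have "ennreal ((l2norm (weak_gradient (\<lambda>x. \<xi> x *\<^sub>R u x)))\<^sup>2)
     = (\<integral>\<^sup>+x. ennreal ((norm (\<xi> x *\<^sub>R weak_gradient u x + h x))\<^sup>2) \<partial>lborel)"
    by (simp add: weak_gradient_l2norm[OF w hw] nn_integral_L2[OF w])
  also have "\<dots> \<le> (\<integral>\<^sup>+x. ennreal (1 + \<eta>) * (ennreal ((\<xi> x)\<^sup>2) * ennreal ((norm (weak_gradient u x))\<^sup>2))
      + ennreal (1 + 1 / \<eta>) * (ennreal (gradsq \<xi> x) * ennreal ((norm (u x))\<^sup>2)) \<partial>lborel)"
  proof (intro nn_integral_mono)
    fix x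
    have "(norm (\<xi> x *\<^sub>R weak_gradient u x + h x))\<^sup>2
       \<le> (1 + \<eta>) * ((\<xi> x)\<^sup>2 * (norm (weak_gradient u x))\<^sup>2) + (1 + 1 / \<eta>) * (gradsq \<xi> x * (norm (u x))\<^sup>2)"
      using power2_norm_add_le[OF \<eta>, of "\<xi> x *\<^sub>R weak_gradient u x" "h x"] by (simp add: hn power_mult_distrib)
    then have "ennreal ((norm (\<xi> x *\<^sub>R weak_gradient u x + h x))\<^sup>2)
       \<le> ennreal ((1 + \<eta>) * ((\<xi> x)\<^sup>2 * (norm (weak_gradient u x))\<^sup>2) + (1 + 1 / \<eta>) * (gradsq \<xi> x * (norm (u x))\<^sup>2))"
      by (rule ennreal_leI)
    also have "\<dots> = ennreal (1 + \<eta>) * (ennreal ((\<xi> x)\<^sup>2) * ennreal ((norm (weak_gradient u x))\<^sup>2))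
      + ennreal (1 + 1 / \<eta>) * (ennreal (gradsq \<xi> x) * ennreal ((norm (u x))\<^sup>2))"
      using \<eta> by (subst ennreal_plus) (auto simp: gradsq_nonneg ennreal_mult simp del: ennreal_plus)
    finally show "ennreal ((norm (\<xi> x *\<^sub>R weak_gradient u x + h x))\<^sup>2)
       \<le> ennreal (1 + \<eta>) * (ennreal ((\<xi> x)\<^sup>2) * ennreal ((norm (weak_gradient u x))\<^sup>2))
      + ennreal (1 + 1 / \<eta>) * (ennreal (gradsq \<xi> x) * ennreal ((norm (u x))\<^sup>2))" .
  qed
  also have "\<dots> = ennreal (1 + \<eta>) * (\<integral>\<^sup>+x. ennreal ((\<xi> x)\<^sup>2) * ennreal ((norm (weak_gradient u x))\<^sup>2) \<partial>lborel)
      + ennreal (1 + 1 / \<eta>) * (\<integral>\<^sup>+x. ennreal (gradsq \<xi> x) * ennreal ((norm (u x))\<^sup>2) \<partial>lborel)"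
    by (subst nn_integral_add) (simp_all add: nn_integral_cmult)
  finally show "ennreal ((l2norm (weak_gradient (\<lambda>x. \<xi> x *\<^sub>R u x)))\<^sup>2) \<le> \<dots>" .
qed

section \<open>Cutoffs and their averaged kernel\<close>

lemma
  fixes H :: "real^'n \<Rightarrow> real^'n \<Rightarrow> ennreal" and p q :: "real^'n \<Rightarrow> real^'n \<Rightarrow> ennreal"
  assumes [measurable]: "(\<lambda>(x, y). H x y) \<in> borel_measurable (borel \<Otimes>\<^sub>M borel)"
    "(\<lambda>(w, x). p w x) \<in> borel_measurable (borel \<Otimes>\<^sub>M borel)" "(\<lambda>(w, x). q w x) \<in> borel_measurable (borel \<Otimes>\<^sub>M borel)"
  shows nn_integral_triple_swap: "(\<integral>\<^sup>+w. \<integral>\<^sup>+x. \<integral>\<^sup>+y. H x y * (p w x * q w y) \<partial>lborel \<partial>lborel \<partial>lborel)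
       = (\<integral>\<^sup>+x. \<integral>\<^sup>+y. H x y * (\<integral>\<^sup>+w. p w x * q w y \<partial>lborel) \<partial>lborel \<partial>lborel)"
    and nn_integral_double_measurable: "(\<lambda>w. \<integral>\<^sup>+x. \<integral>\<^sup>+y. H x y * (p w x * q w y) \<partial>lborel \<partial>lborel) \<in> borel_measurable borel"
proof -
  have "(\<integral>\<^sup>+w. \<integral>\<^sup>+x. \<integral>\<^sup>+y. H x y * (p w x * q w y) \<partial>lborel \<partial>lborel \<partial>lborel)
     = (\<integral>\<^sup>+x. \<integral>\<^sup>+w. \<integral>\<^sup>+y. H x y * (p w x * q w y) \<partial>lborel \<partial>lborel \<partial>lborel)"
    by (intro lborel_pair.Fubini') measurable
  also have "\<dots> = (\<integral>\<^sup>+x. \<integral>\<^sup>+y. \<integral>\<^sup>+w. H x y * (p w x * q w y) \<partial>lborel \<partial>lborel \<partial>lborel)"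
    by (intro nn_integral_cong lborel_pair.Fubini') measurable
  finally show "(\<integral>\<^sup>+w. \<integral>\<^sup>+x. \<integral>\<^sup>+y. H x y * (p w x * q w y) \<partial>lborel \<partial>lborel \<partial>lborel)
       = (\<integral>\<^sup>+x. \<integral>\<^sup>+y. H x y * (\<integral>\<^sup>+w. p w x * q w y \<partial>lborel) \<partial>lborel \<partial>lborel)"
    by (simp add: nn_integral_cmult)
  show "(\<lambda>w. \<integral>\<^sup>+x. \<integral>\<^sup>+y. H x y * (p w x * q w y) \<partial>lborel \<partial>lborel) \<in> borel_measurable borel"
    by measurable
qed

text \<open>The centre is \<open>R *\<^sub>R w\<close>: measuring it in units of \<open>R\<close>
  frees integrals over \<open>w\<close> of a Jacobian, so the fourth power integrates to the same
  value for every \<open>R\<close> and \<open>x\<close>.\<close>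

definition cutoff :: "(real^'n \<Rightarrow> real) \<Rightarrow> real \<Rightarrow> real^'n \<Rightarrow> real^'n \<Rightarrow> real" where
  "cutoff \<phi> R w x = \<phi> ((1 / R) *\<^sub>R x - w)"

definition cutoff_kernel :: "(real^'n \<Rightarrow> real) \<Rightarrow> real \<Rightarrow> real^'n \<Rightarrow> real^'n \<Rightarrow> ennreal" where
  "cutoff_kernel \<phi> R x y = (\<integral>\<^sup>+w. ennreal ((cutoff \<phi> R w x)\<^sup>2) * ennreal ((cutoff \<phi> R w y)\<^sup>2) \<partial>lborel)"

lemma cutoff_test_function: "test_function \<phi> \<Longrightarrow> R > 0 \<Longrightarrow> test_function (cutoff \<phi> R w)"
  using test_function_affine[of \<phi> "1 / R" "- w"] by (simp add: cutoff_def[abs_def])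

lemma cutoff_gradsq:
  assumes "test_function \<phi>" "R > 0"
  shows "gradsq (cutoff \<phi> R w) x = gradsq \<phi> ((1 / R) *\<^sub>R x - w) / R\<^sup>2"
  using frechet_derivative_translate[OF assms(1), of "1 / R" "- w" x]
  by (simp add: cutoff_def[abs_def] gradsq_def power_divide sum_divide_distrib)

lemma cutoff_measurable [measurable (raw)]:
  assumes "test_function \<phi>" and [measurable]: "f \<in> borel_measurable M" "h \<in> borel_measurable M"
  shows "(\<lambda>z. cutoff \<phi> R (f z) (h z)) \<in> borel_measurable M"
proof -
  note [measurable] = test_function_measurable[OF assms(1)]
  show ?thesis unfolding cutoff_def by measurable
qed

lemma nn_integral_cutoff:
  fixes x :: "real^'n"
  assumes [measurable]: "F \<in> borel_measurable borel"
  shows "(\<integral>\<^sup>+w. F ((1 / R) *\<^sub>R x - w) \<partial>lborel) = (\<integral>\<^sup>+w. F w \<partial>lborel)"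
  by (rule nn_integral_reflect) measurable

text \<open>Let a and b be the squared cutoffs at \<open>x\<close> and \<open>y\<close>. Both a^2
  and b^2 integrate to 1 over \<open>w\<close>, so 2ab = a^2 + b^2 - (a - b)^2 bounds the kernel by
  1 and identifies its defect from 1 with half the integral of (a - b)^2, which is quadratic in the
  distance by a Lipschitz bound.\<close>

lemma cutoff_kernel_bounds:
  fixes \<phi> :: "real^'n \<Rightarrow> real"
  assumes \<phi>: "test_function \<phi>" "\<And>x. \<phi> x \<noteq> 0 \<Longrightarrow> norm x < 1/2" "(LINT x|lborel. \<phi> x ^ 4) = 1"
  obtains C where "0 < C" "\<And>R x y. R > 0 \<Longrightarrow> cutoff_kernel \<phi> R x y \<le> 1"
    "\<And>R x y. R > 0 \<Longrightarrow> R \<le> norm (x - y) \<Longrightarrow> cutoff_kernel \<phi> R x y = 0"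
    "\<And>R x y. R > 0 \<Longrightarrow> 1 \<le> cutoff_kernel \<phi> R x y + ennreal (C * (norm (x - y) / R)\<^sup>2)"
    "\<And>R x y. R > 0 \<Longrightarrow> (\<integral>\<^sup>+w. ennreal ((cutoff \<phi> R w x)\<^sup>2) * ennreal (gradsq (cutoff \<phi> R w) y) \<partial>lborel) \<le> ennreal (C / R\<^sup>2)"
proof -
  note [measurable] = test_function_measurable[OF \<phi>(1)] gradsq_measurable[OF \<phi>(1)]
  obtain B where B: "0 < B" "\<And>x. \<bar>\<phi> x\<bar> \<le> B" using test_function_bound[OF \<phi>(1)] by metis
  \<comment> \<open>The kernel contains squares of cutoffs, so the Lipschitz constant is taken for
    the square of \<open>\<phi>\<close>.\<close>
  have "test_function (\<lambda>x. \<phi> x * \<phi> x)" by (intro test_function_mult test_function_C_k \<phi>)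
  then obtain L where L: "0 < L" "\<And>x y. \<bar>\<phi> x * \<phi> x - \<phi> y * \<phi> y\<bar> \<le> L * norm (x - y)"
    by (rule test_function_Lipschitz) auto
  define V where "V = measure lborel (ball (0::real^'n) 1)"
  have V: "emeasure lborel (ball (0::real^'n) 1) = ennreal V"
    unfolding V_def using emeasure_bounded_finite[of "ball (0::real^'n) 1"] by (intro emeasure_eq_ennreal_measure) auto
  define I where "I = (LINT x|lborel. gradsq \<phi> x)"
  have I: "(\<integral>\<^sup>+x. ennreal (gradsq \<phi> x) \<partial>lborel) = ennreal I" "I \<ge> 0"
    unfolding I_def by (auto intro!: nn_integral_eq_integral gradsq_integrable \<phi> gradsq_nonneg integral_nonneg_AE AE_I2)
  \<comment> \<open>\<open>L\<^sup>2 * V\<close> serves the defect of the kernel,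
    \<open>B\<^sup>2 * I\<close> the gradient bound, and 1 gives positivity.\<close>
  define C where "C = L\<^sup>2 * V + B\<^sup>2 * I + 1"
  have V0: "V \<ge> 0" by (simp add: V_def)
  have C: "L\<^sup>2 * V \<le> C" "B\<^sup>2 * I \<le> C" "C > 0" using I V0 by (auto simp: C_def add_nonneg_pos)
  have f4: "(\<integral>\<^sup>+w. ennreal (cutoff \<phi> R w x ^ 4) \<partial>lborel) = 1" for R and x :: "real^'n"
  proof -
    have "(\<integral>\<^sup>+w. ennreal (cutoff \<phi> R w x ^ 4) \<partial>lborel) = (\<integral>\<^sup>+w. ennreal (\<phi> w ^ 4) \<partial>lborel)"
      unfolding cutoff_def by (rule nn_integral_cutoff) measurable
    also have "\<dots> = 1" using test_function_integrable_power[OF \<phi>(1), of 4] \<phi>(3) by (simp add: nn_integral_eq_integral)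
    finally show ?thesis .
  qed
  note [measurable (raw)] = cutoff_measurable[OF \<phi>(1)]
  show thesis
  proof (rule that[OF C(3)])
    fix R :: real and x y :: "real^'n" assume R: "R > 0"
    let ?a = "\<lambda>w. (cutoff \<phi> R w x)\<^sup>2" and ?b = "\<lambda>w. (cutoff \<phi> R w y)\<^sup>2"
    have k2: "2 * cutoff_kernel \<phi> R x y = (\<integral>\<^sup>+w. ennreal (2 * (?a w * ?b w)) \<partial>lborel)"
      unfolding cutoff_kernel_def by (simp add: ennreal_mult nn_integral_cmult)
    have two: "(\<integral>\<^sup>+w. ennreal ((?a w)\<^sup>2 + (?b w)\<^sup>2) \<partial>lborel) = 2"
      using f4[of R x] f4[of R y] by (simp add: nn_integral_add flip: power_mult)
    have "2 * cutoff_kernel \<phi> R x y \<le> (\<integral>\<^sup>+w. ennreal ((?a w)\<^sup>2 + (?b w)\<^sup>2) \<partial>lborel)"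
    proof (unfold k2, intro nn_integral_mono ennreal_leI)
      show "2 * (?a w * ?b w) \<le> (?a w)\<^sup>2 + (?b w)\<^sup>2" for w
        using sum_squares_bound[of "?a w" "?b w"] by (simp only: mult.assoc)
    qed
    then have "2 * cutoff_kernel \<phi> R x y \<le> 2 * 1" unfolding two by simp
    then show "cutoff_kernel \<phi> R x y \<le> 1" by (subst (asm) ennreal_mult_le_mult_iff) auto
    show "cutoff_kernel \<phi> R x y = 0" if "R \<le> norm (x - y)"
    proof -
      \<comment> \<open>A support radius of 1/2 in units of \<open>R\<close> prevents two points at
        distance at least \<open>R\<close> from being seen by the same cutoff.\<close>
      have "cutoff \<phi> R w x = 0 \<or> cutoff \<phi> R w y = 0" for w
      proof (rule ccontr)
        assume "\<not> ?thesis"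
        then have "norm ((1 / R) *\<^sub>R x - w) < 1/2" "norm ((1 / R) *\<^sub>R y - w) < 1/2"
          using \<phi>(2) by (auto simp: cutoff_def)
        then have "norm (((1 / R) *\<^sub>R x - w) - ((1 / R) *\<^sub>R y - w)) < 1"
          using norm_triangle_ineq4[of "(1 / R) *\<^sub>R x - w" "(1 / R) *\<^sub>R y - w"] by linarith
        then have "norm ((1 / R) *\<^sub>R (x - y)) < 1" by (simp add: scaleR_diff_right)
        then show False using that R by simp
      qed
      then have "ennreal (?a w) * ennreal (?b w) = 0" for w by (metis ennreal_0 mult_zero_left mult_zero_right zero_power2)
      then show ?thesis unfolding cutoff_kernel_def by (simp only:) simp
    qed
    show "1 \<le> cutoff_kernel \<phi> R x y + ennreal (C * (norm (x - y) / R)\<^sup>2)"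
    proof -
      let ?z = "norm (x - y) / R"
      \<comment> \<open>The indicators localise the Lipschitz error to centres near one of the two
        points, a set of volume at most \<open>2 * V\<close>.\<close>
      let ?i = "\<lambda>x w. indicator (ball 0 1) ((1 / R) *\<^sub>R x - w) :: real"
      have pt: "(?a w)\<^sup>2 + (?b w)\<^sup>2 \<le> 2 * (?a w * ?b w) + (L * ?z)\<^sup>2 * (?i x w + ?i y w)" for w
      proof -
        have "(?a w - ?b w)\<^sup>2 \<le> (L * ?z)\<^sup>2 * (?i x w + ?i y w)"
        proof (cases "cutoff \<phi> R w x = 0 \<and> cutoff \<phi> R w y = 0")
          case False
          then have "norm ((1 / R) *\<^sub>R x - w) < 1 \<or> norm ((1 / R) *\<^sub>R y - w) < 1"
            using \<phi>(2) by (fastforce simp: cutoff_def)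
          then have "?i x w + ?i y w \<ge> 1" by (auto simp: indicator_def)
          moreover have "(?a w - ?b w)\<^sup>2 \<le> (L * ?z)\<^sup>2"
          proof (rule abs_le_square_iff[THEN iffD1])
            have "((1 / R) *\<^sub>R x - w) - ((1 / R) *\<^sub>R y - w) = (1 / R) *\<^sub>R (x - y)" by (simp add: scaleR_diff_right)
            then have "norm (((1 / R) *\<^sub>R x - w) - ((1 / R) *\<^sub>R y - w)) = ?z" using R by simp
            then show "\<bar>?a w - ?b w\<bar> \<le> \<bar>L * ?z\<bar>"
              using L(2)[of "(1 / R) *\<^sub>R x - w" "(1 / R) *\<^sub>R y - w"] L(1) R by (simp add: cutoff_def power2_eq_square)
          qed
          ultimately show ?thesis using mult_left_mono[of 1 "?i x w + ?i y w" "(L * ?z)\<^sup>2"] by simp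
        qed simp
        then show ?thesis by (simp add: power2_diff mult.assoc)
      qed
      have iV: "(\<integral>\<^sup>+w. ennreal (?i x w) \<partial>lborel) = ennreal V" for x :: "real^'n"
        using nn_integral_cutoff[of "\<lambda>w. ennreal (indicator (ball 0 1) w)" R x] by (simp add: V ennreal_indicator)
      have "2 \<le> (\<integral>\<^sup>+w. ennreal (2 * (?a w * ?b w) + (L * ?z)\<^sup>2 * (?i x w + ?i y w)) \<partial>lborel)"
        unfolding two[symmetric] by (intro nn_integral_mono ennreal_leI pt)
      also have "\<dots> = (\<integral>\<^sup>+w. ennreal (2 * (?a w * ?b w)) + ennreal ((L * ?z)\<^sup>2) * (ennreal (?i x w) + ennreal (?i y w)) \<partial>lborel)"
        by (intro nn_integral_cong) (simp add: ennreal_mult)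
      also have "\<dots> = 2 * cutoff_kernel \<phi> R x y + ennreal ((L * ?z)\<^sup>2) * (ennreal V + ennreal V)"
        unfolding k2 by (subst nn_integral_add) (simp_all add: nn_integral_cmult nn_integral_add iV)
      also have "ennreal V + ennreal V = ennreal (2 * V)"
        unfolding mult_2 using V0 by (intro ennreal_plus[symmetric])
      also have "ennreal ((L * ?z)\<^sup>2) * ennreal (2 * V) = ennreal ((L * ?z)\<^sup>2 * (2 * V))"
        using V0 by (intro ennreal_mult[symmetric]) auto
      also have "(L * ?z)\<^sup>2 * (2 * V) = 2 * (L\<^sup>2 * V * ?z\<^sup>2)" by (simp add: power_mult_distrib power_divide)
      also have "ennreal (2 * (L\<^sup>2 * V * ?z\<^sup>2)) = 2 * ennreal (L\<^sup>2 * V * ?z\<^sup>2)"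
        using V0 by (subst ennreal_mult) simp_all
      also have "2 * cutoff_kernel \<phi> R x y + 2 * ennreal (L\<^sup>2 * V * ?z\<^sup>2) \<le> 2 * (cutoff_kernel \<phi> R x y + ennreal (C * ?z\<^sup>2))"
        unfolding distrib_left using C by (intro add_left_mono mult_left_mono ennreal_leI mult_right_mono) auto
      finally have "2 * 1 \<le> 2 * (cutoff_kernel \<phi> R x y + ennreal (C * ?z\<^sup>2))" by simp
      then show ?thesis by (subst (asm) ennreal_mult_le_mult_iff) auto
    qed
    show "(\<integral>\<^sup>+w. ennreal ((cutoff \<phi> R w x)\<^sup>2) * ennreal (gradsq (cutoff \<phi> R w) y) \<partial>lborel) \<le> ennreal (C / R\<^sup>2)"
    proof -
      have "(\<integral>\<^sup>+w. ennreal ((cutoff \<phi> R w x)\<^sup>2) * ennreal (gradsq (cutoff \<phi> R w) y) \<partial>lborel)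
        \<le> (\<integral>\<^sup>+w. ennreal (B\<^sup>2 / R\<^sup>2) * ennreal (gradsq \<phi> ((1 / R) *\<^sub>R y - w)) \<partial>lborel)"
      proof (intro nn_integral_mono)
        fix w
        have "(cutoff \<phi> R w x)\<^sup>2 \<le> B\<^sup>2" using B unfolding cutoff_def by (simp add: abs_le_square_iff[symmetric])
        then have "(cutoff \<phi> R w x)\<^sup>2 * gradsq (cutoff \<phi> R w) y \<le> B\<^sup>2 / R\<^sup>2 * gradsq \<phi> ((1 / R) *\<^sub>R y - w)"
          by (simp add: cutoff_gradsq[OF \<phi>(1) R] divide_right_mono mult_right_mono gradsq_nonneg)
        then show "ennreal ((cutoff \<phi> R w x)\<^sup>2) * ennreal (gradsq (cutoff \<phi> R w) y) \<le> ennreal (B\<^sup>2 / R\<^sup>2) * ennreal (gradsq \<phi> ((1 / R) *\<^sub>R y - w))"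
          by (simp add: gradsq_nonneg ennreal_leI flip: ennreal_mult)
      qed
      also have "\<dots> = ennreal (B\<^sup>2 / R\<^sup>2) * ennreal I"
        using nn_integral_cutoff[of "\<lambda>w. ennreal (gradsq \<phi> w)" R y] I by (simp add: nn_integral_cmult)
      also have "\<dots> \<le> ennreal (C / R\<^sup>2)"
        using C I by (simp add: ennreal_leI divide_right_mono flip: ennreal_mult)
      finally show ?thesis .
    qed
  qed
qed

text \<open>Up to distance \<open>R\<close> the defect of \<open>k\<close> costs a multiple of
  \<open>r powr (2 - \<gamma>) / R\<^sup>2\<close>, at most \<open>R powr (- \<gamma>)\<close>
  because \<open>\<gamma> < 2\<close>; beyond \<open>R\<close> the kernel itself is that small. At
  \<open>r = 0\<close> the quotient is 0.\<close>

lemma kernel_error_bound: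
  assumes \<gamma>: "0 < \<gamma>" "\<gamma> < 2" and R: "R > 0" and C: "C > 0" and r: "r \<ge> 0"
    and k: "1 \<le> k + ennreal (C * (r / R)\<^sup>2)"
  shows "ennreal (1 / r powr \<gamma>) \<le> ennreal (1 / r powr \<gamma>) * k + ennreal ((C + 1) * R powr (- \<gamma>))"
proof (cases "r \<le> R \<and> r > 0")
  case True
  have "(1 / r powr \<gamma>) * (C * (r / R)\<^sup>2) = C * (r powr (2 - \<gamma>) / R\<^sup>2)"
    using True by (simp add: powr_diff power_divide)
  also have "\<dots> \<le> C * (R powr (2 - \<gamma>) / R\<^sup>2)"
    using True \<gamma> C by (intro mult_left_mono divide_right_mono powr_mono2) auto
  also have "\<dots> = C * R powr (- \<gamma>)" using R by (simp add: powr_diff powr_minus field_simps)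
  also have "\<dots> \<le> (C + 1) * R powr (- \<gamma>)" by (intro mult_right_mono) auto
  finally have le: "(1 / r powr \<gamma>) * (C * (r / R)\<^sup>2) \<le> (C + 1) * R powr (- \<gamma>)" .
  have "ennreal (1 / r powr \<gamma>) * 1 \<le> ennreal (1 / r powr \<gamma>) * (k + ennreal (C * (r / R)\<^sup>2))"
    by (intro mult_left_mono k) auto
  also have "\<dots> = ennreal (1 / r powr \<gamma>) * k + ennreal ((1 / r powr \<gamma>) * (C * (r / R)\<^sup>2))"
    using C unfolding distrib_left by (subst ennreal_mult[of "1 / r powr \<gamma>" "C * (r / R)\<^sup>2"]) auto
  also have "\<dots> \<le> ennreal (1 / r powr \<gamma>) * k + ennreal ((C + 1) * R powr (- \<gamma>))"
    by (intro add_left_mono ennreal_leI le)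
  finally show ?thesis by simp
next
  case False
  have "1 / r powr \<gamma> \<le> (C + 1) * R powr (- \<gamma>)"
  proof (cases "r = 0")
    case True
    then show ?thesis using C by simp
  next
    case nz: False
    then have "r powr (- \<gamma>) \<le> R powr (- \<gamma>)" using False R r \<gamma> by (intro powr_mono2') auto
    also have "\<dots> \<le> (C + 1) * R powr (- \<gamma>)" using C by (simp add: mult_le_cancel_right1)
    finally show ?thesis by (simp add: powr_minus divide_inverse)
  qed
  then have "ennreal (1 / r powr \<gamma>) \<le> ennreal ((C + 1) * R powr (- \<gamma>))" by (rule ennreal_leI)
  also have "\<dots> \<le> ennreal (1 / r powr \<gamma>) * k + ennreal ((C + 1) * R powr (- \<gamma>))" by simp
  finally show ?thesis .
qed

text \<open>Brings \<open>scaling_inequality\<close> into the form of constants times products,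
  since products of two single integrals are what becomes a double integral.\<close>

lemma quarter_le_imp_le:
  fixes a c d1 d2 g n :: real
  assumes "d1 / 4 \<le> (a / c) * g / 2 + d2 / 4 + (a / c)\<^sup>2 * n"
  shows "d1 \<le> (2 / c) * (a * g) + d2 + (4 * n / c\<^sup>2) * (a * a)"
proof -
  have "4 * ((a / c) * g / 2) = (2 / c) * (a * g)" "4 * ((a / c)\<^sup>2 * n) = (4 * n / c\<^sup>2) * (a * a)"
    by (simp_all add: power_divide power2_eq_square)
  then show ?thesis using assms by linarith
qed

context riesz_pair
begin

text \<open>The main part of the localised gradient cancels against the gradient in
  \<open>E u\<close>, leaving a multiple of \<eta>. With \<eta> small and then \<open>R\<close>
  large, all terms but the last are negligible, so an energy near \<open>m c\<close> leaves no room
  for a bound \<open>M\<close> well below \<open>c\<close>.\<close>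

lemma cutoff_energy_inequality:
  assumes c: "c > 0" and m: "m c < 0"
  obtains C where "C > 0"
    "\<And>u R \<eta> M. u \<in> S c \<Longrightarrow> R > 0 \<Longrightarrow> \<eta> > 0 \<Longrightarrow> M \<ge> 0 \<Longrightarrow> (\<And>x. ball_mass u x R \<le> M) \<Longrightarrow>
      - 4 * E u \<le> C * R powr (- \<gamma>1) * c\<^sup>2 + 2 * \<eta> * (G u)\<^sup>2 + 2 * (1 + 1 / \<eta>) * (c * (C / R\<^sup>2)) + 4 * (- m c) * M / c"
proof -
  have m4: "0 \<le> 4 * (- m c) / c\<^sup>2" using m by (intro divide_nonneg_nonneg) auto
  obtain \<phi>0 :: "real^'n \<Rightarrow> real" where \<phi>0: "test_function \<phi>0" "\<And>x. \<phi>0 x \<noteq> 0 \<Longrightarrow> norm x < 1/2" "\<And>k. k > 0 \<Longrightarrow> 0 < (LINT x|lborel. \<phi>0 x ^ k)"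
    by (rule small_test_function[of "1/2"]) auto
  define j where "j = (LINT x|lborel. \<phi>0 x ^ 4)"
  have j: "j > 0" unfolding j_def by (rule \<phi>0) simp
  define \<phi> where "\<phi> x = (1 / root 4 j) * \<phi>0 x" for x
  have \<phi>: "test_function \<phi>" unfolding \<phi>_def by (intro test_function_mult C_k_const \<phi>0)
  have "(LINT x|lborel. \<phi> x ^ 4) = (LINT x|lborel. (1 / j) * \<phi>0 x ^ 4)"
    unfolding \<phi>_def power_mult_distrib power_divide using j by simp
  also have "\<dots> = (1 / j) * j" unfolding j_def by (rule integral_mult_right_zero)
  finally have \<phi>4: "(LINT x|lborel. \<phi> x ^ 4) = 1" using j by simp
  have \<phi>s: "norm x < 1/2" if "\<phi> x \<noteq> 0" for x using that \<phi>0(2) by (auto simp: \<phi>_def)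
  show thesis
  proof (rule cutoff_kernel_bounds[OF \<phi> \<phi>s \<phi>4])
    fix C :: real
    assume C: "0 < C" and k1: "\<And>R x y. R > 0 \<Longrightarrow> cutoff_kernel \<phi> R x y \<le> 1"
      and k2: "\<And>R x y. R > 0 \<Longrightarrow> R \<le> norm (x - y) \<Longrightarrow> cutoff_kernel \<phi> R x y = 0"
      and k3: "\<And>R x y. R > 0 \<Longrightarrow> 1 \<le> cutoff_kernel \<phi> R x y + ennreal (C * (norm (x - y) / R)\<^sup>2)"
      and k4: "\<And>R x y. R > 0 \<Longrightarrow> (\<integral>\<^sup>+w. ennreal ((cutoff \<phi> R w x)\<^sup>2) * ennreal (gradsq (cutoff \<phi> R w) y) \<partial>lborel) \<le> ennreal (C / R\<^sup>2)"
    \<comment> \<open>The constant is raised to \<open>C + 1\<close> because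
      \<open>kernel_error_bound\<close> returns
      \<open>(C + 1) * R powr (- \<gamma>)\<close>.\<close>
    have main: "- 4 * E u \<le> (C + 1) * R powr (- \<gamma>1) * c\<^sup>2 + 2 * \<eta> * (G u)\<^sup>2 + 2 * (1 + 1 / \<eta>) * (c * ((C + 1) / R\<^sup>2)) + 4 * (- m c) * M / c"
      if uS: "u \<in> S c" and R: "R > 0" and \<eta>: "\<eta> > 0" and M: "M \<ge> 0" "\<And>x. ball_mass u x R \<le> M" for u R \<eta> M
    proof -
      have u: "u \<in> H1" and uc: "(l2norm u)\<^sup>2 = c" using uS by (auto simp: mass_sphere_iff)
      note uL = H1_L2[OF u] and g = H1_weak_gradient[OF u]
      note [measurable] = L2_measurable[OF uL] L2_measurable[OF g(1)] gradsq_measurable[OF \<phi>]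
      note [measurable (raw)] = cutoff_measurable[OF \<phi>]
      define \<rho> where "\<rho> x = ennreal ((norm (u x))\<^sup>2)" for x
      define gg where "gg x = ennreal ((norm (weak_gradient u x))\<^sup>2)" for x
      define p where "p w x = ennreal ((cutoff \<phi> R w x)\<^sup>2)" for w x
      define q where "q w x = ennreal (gradsq (cutoff \<phi> R w) x)" for w x
      have [measurable]: "\<rho> \<in> borel_measurable borel" "gg \<in> borel_measurable borel"
        unfolding \<rho>_def[abs_def] gg_def[abs_def] by measurable
      have [measurable]: "(\<lambda>(w, x). p w x) \<in> borel_measurable (borel \<Otimes>\<^sub>M borel)" unfolding p_def by measurable
      have [measurable]: "(\<lambda>(w, x). q w x) \<in> borel_measurable (borel \<Otimes>\<^sub>M borel)"
        unfolding q_def cutoff_gradsq[OF \<phi> R] by measurable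
      have [measurable]: "p w \<in> borel_measurable borel" "q w \<in> borel_measurable borel" for w
        unfolding p_def[abs_def] q_def[abs_def] cutoff_gradsq[OF \<phi> R] by measurable
      have \<rho>I: "(\<integral>\<^sup>+x. \<rho> x \<partial>lborel) = ennreal c" unfolding \<rho>_def by (simp add: nn_integral_L2[OF uL] uc)
      have ggI: "(\<integral>\<^sup>+x. gg x \<partial>lborel) = ennreal ((G u)\<^sup>2)" unfolding gg_def by (simp add: nn_integral_L2[OF g(1)])
      define k where "k = cutoff_kernel \<phi> R"
      have k: "k x y = (\<integral>\<^sup>+w. p w x * p w y \<partial>lborel)" for x y by (simp add: k_def cutoff_kernel_def p_def)
      have [measurable]: "(\<lambda>(x, y). k x y) \<in> borel_measurable (borel \<Otimes>\<^sub>M borel)" unfolding k by measurable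
      have prod: "(\<integral>\<^sup>+x. f x \<partial>lborel) * (\<integral>\<^sup>+y. h y \<partial>lborel) = (\<integral>\<^sup>+x. \<integral>\<^sup>+y. f x * h y \<partial>lborel \<partial>lborel)"
        if [measurable]: "f \<in> borel_measurable borel" "h \<in> borel_measurable borel" for f h :: "real^'n \<Rightarrow> ennreal"
        by (simp add: nn_integral_cmult nn_integral_multc)
      define Kr where "Kr \<gamma> x y = ennreal (1 / norm (x - y) powr \<gamma>)" for \<gamma> and x y :: "real^'n"
      have [measurable]: "(\<lambda>(x, y). Kr \<gamma> x y) \<in> borel_measurable (borel \<Otimes>\<^sub>M borel)" for \<gamma> unfolding Kr_def by measurable
      \<comment> \<open>For each centre \<open>w\<close> these belong to the localised function:
        mass times gradient, mass times cutoff error, squared mass, and the two double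
        integrals.\<close>
      define Ig where "Ig w = (\<integral>\<^sup>+x. \<integral>\<^sup>+y. (\<rho> x * gg y) * (p w x * p w y) \<partial>lborel \<partial>lborel)" for w
      define Ir where "Ir w = (\<integral>\<^sup>+x. \<integral>\<^sup>+y. (\<rho> x * \<rho> y) * (p w x * q w y) \<partial>lborel \<partial>lborel)" for w
      define It where "It w = (\<integral>\<^sup>+x. \<integral>\<^sup>+y. (\<rho> x * \<rho> y) * (p w x * p w y) \<partial>lborel \<partial>lborel)" for w
      define ID where "ID \<gamma> w = (\<integral>\<^sup>+x. \<integral>\<^sup>+y. (\<rho> x * \<rho> y * Kr \<gamma> x y) * (p w x * p w y) \<partial>lborel \<partial>lborel)" for \<gamma> w
      have [measurable]: "Ig \<in> borel_measurable borel" "Ir \<in> borel_measurable borel" "It \<in> borel_measurable borel"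
        "ID \<gamma> \<in> borel_measurable borel" for \<gamma>
        unfolding Ig_def[abs_def] Ir_def[abs_def] It_def[abs_def] ID_def[abs_def]
        by (intro nn_integral_double_measurable; measurable)+
      have Ig: "(\<integral>\<^sup>+w. Ig w \<partial>lborel) = (\<integral>\<^sup>+x. \<integral>\<^sup>+y. (\<rho> x * gg y) * k x y \<partial>lborel \<partial>lborel)"
        unfolding Ig_def k by (intro nn_integral_triple_swap; measurable)
      have It: "(\<integral>\<^sup>+w. It w \<partial>lborel) = (\<integral>\<^sup>+x. \<integral>\<^sup>+y. (\<rho> x * \<rho> y) * k x y \<partial>lborel \<partial>lborel)"
        unfolding It_def k by (intro nn_integral_triple_swap; measurable)
      have ID: "(\<integral>\<^sup>+w. ID \<gamma> w \<partial>lborel) = (\<integral>\<^sup>+x. \<integral>\<^sup>+y. (\<rho> x * \<rho> y * Kr \<gamma> x y) * k x y \<partial>lborel \<partial>lborel)" for \<gamma>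
        unfolding ID_def k by (intro nn_integral_triple_swap; measurable)
      have Ir: "(\<integral>\<^sup>+w. Ir w \<partial>lborel) = (\<integral>\<^sup>+x. \<integral>\<^sup>+y. (\<rho> x * \<rho> y) * (\<integral>\<^sup>+w. p w x * q w y \<partial>lborel) \<partial>lborel \<partial>lborel)"
        unfolding Ir_def by (intro nn_integral_triple_swap; measurable)
      have Dk: "D_nn \<gamma> u = (\<integral>\<^sup>+x. \<integral>\<^sup>+y. \<rho> x * \<rho> y * Kr \<gamma> x y \<partial>lborel \<partial>lborel)" for \<gamma>
        unfolding D_nn_def \<rho>_def Kr_def by (simp flip: ennreal_mult)
      \<comment> \<open>\<open>scaling_inequality\<close> for the localised function, moved to the
        extended reals, where the integration over \<open>w\<close> can be exchanged freely.\<close>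
      have per_w: "ID \<gamma>1 w \<le> ennreal (2 / c) * (ennreal (1 + \<eta>) * Ig w + ennreal (1 + 1 / \<eta>) * Ir w) + ID \<gamma>2 w + ennreal (4 * (- m c) / c\<^sup>2) * It w" for w
      proof -
        let ?v = "\<lambda>x. cutoff \<phi> R w x *\<^sub>R u x"
        have tf: "test_function (cutoff \<phi> R w)" by (rule cutoff_test_function[OF \<phi> R])
        note vH = test_function_mult_H1(1)[OF tf u \<eta>] and vG = test_function_mult_H1(2)[OF tf u \<eta>]
        have va: "ennreal ((l2norm ?v)\<^sup>2) = (\<integral>\<^sup>+x. \<rho> x * p w x \<partial>lborel)"
          unfolding nn_integral_L2[OF H1_L2[OF vH], symmetric] \<rho>_def p_def
          by (intro nn_integral_cong) (simp add: power_mult_distrib mult.commute flip: ennreal_mult)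
        have vD: "D_nn \<gamma> ?v = ID \<gamma> w" for \<gamma>
          unfolding D_nn_def ID_def \<rho>_def Kr_def p_def
          by (intro nn_integral_cong) (simp add: power_mult_distrib mult_ac flip: ennreal_mult)
        have "D1 ?v \<le> (2 / c) * ((l2norm ?v)\<^sup>2 * (G ?v)\<^sup>2) + D2 ?v + (4 * (- m c) / c\<^sup>2) * ((l2norm ?v)\<^sup>2 * (l2norm ?v)\<^sup>2)"
          by (rule quarter_le_imp_le[OF scaling_inequality[OF vH c]])
        then have "ennreal (D1 ?v) \<le> ennreal ((2 / c) * ((l2norm ?v)\<^sup>2 * (G ?v)\<^sup>2) + D2 ?v + (4 * (- m c) / c\<^sup>2) * ((l2norm ?v)\<^sup>2 * (l2norm ?v)\<^sup>2))"
          by (rule ennreal_leI)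
        also have "\<dots> = ennreal (2 / c) * (ennreal ((l2norm ?v)\<^sup>2) * ennreal ((G ?v)\<^sup>2)) + ennreal (D2 ?v)
            + ennreal (4 * (- m c) / c\<^sup>2) * (ennreal ((l2norm ?v)\<^sup>2) * ennreal ((l2norm ?v)\<^sup>2))"
        proof -
          have nn: "0 \<le> 2 / c" "0 \<le> 4 * (- m c) / c\<^sup>2" "0 \<le> D2 ?v" using c m4 D_nonneg[OF _ vH] by auto
          have t1: "ennreal ((2 / c) * ((l2norm ?v)\<^sup>2 * (G ?v)\<^sup>2)) = ennreal (2 / c) * (ennreal ((l2norm ?v)\<^sup>2) * ennreal ((G ?v)\<^sup>2))"
            using nn by (simp only: ennreal_mult zero_le_power2 mult_nonneg_nonneg)
          have t2: "ennreal ((4 * (- m c) / c\<^sup>2) * ((l2norm ?v)\<^sup>2 * (l2norm ?v)\<^sup>2)) = ennreal (4 * (- m c) / c\<^sup>2) * (ennreal ((l2norm ?v)\<^sup>2) * ennreal ((l2norm ?v)\<^sup>2))"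
            using nn by (simp only: ennreal_mult zero_le_power2 mult_nonneg_nonneg)
          show ?thesis unfolding t1[symmetric] t2[symmetric]
            using nn by (simp only: ennreal_plus add_nonneg_nonneg mult_nonneg_nonneg zero_le_power2)
        qed
        also have "\<dots> \<le> ennreal (2 / c) * (ennreal ((l2norm ?v)\<^sup>2) * (ennreal (1 + \<eta>) * (\<integral>\<^sup>+x. p w x * gg x \<partial>lborel) + ennreal (1 + 1 / \<eta>) * (\<integral>\<^sup>+x. q w x * \<rho> x \<partial>lborel))) + ennreal (D2 ?v)
            + ennreal (4 * (- m c) / c\<^sup>2) * (ennreal ((l2norm ?v)\<^sup>2) * ennreal ((l2norm ?v)\<^sup>2))"
          using vG unfolding p_def[symmetric] q_def[symmetric] gg_def[symmetric] \<rho>_def[symmetric]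
          by (intro add_mono mult_left_mono order_refl) auto
        also have "ennreal ((l2norm ?v)\<^sup>2) * ennreal ((l2norm ?v)\<^sup>2) = It w"
          unfolding va It_def by (subst prod) (simp_all add: mult_ac)
        also have "ennreal ((l2norm ?v)\<^sup>2) * (ennreal (1 + \<eta>) * (\<integral>\<^sup>+x. p w x * gg x \<partial>lborel) + ennreal (1 + 1 / \<eta>) * (\<integral>\<^sup>+x. q w x * \<rho> x \<partial>lborel))
           = ennreal (1 + \<eta>) * ((\<integral>\<^sup>+x. \<rho> x * p w x \<partial>lborel) * (\<integral>\<^sup>+x. p w x * gg x \<partial>lborel))
           + ennreal (1 + 1 / \<eta>) * ((\<integral>\<^sup>+x. \<rho> x * p w x \<partial>lborel) * (\<integral>\<^sup>+x. q w x * \<rho> x \<partial>lborel))"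
          unfolding va by (simp only: distrib_left mult_ac)
        also have "(\<integral>\<^sup>+x. \<rho> x * p w x \<partial>lborel) * (\<integral>\<^sup>+x. p w x * gg x \<partial>lborel) = Ig w"
          unfolding Ig_def by (subst prod) (simp_all add: mult_ac)
        also have "(\<integral>\<^sup>+x. \<rho> x * p w x \<partial>lborel) * (\<integral>\<^sup>+x. q w x * \<rho> x \<partial>lborel) = Ir w"
          unfolding Ir_def by (subst prod) (simp_all add: mult_ac)
        finally show ?thesis using D_nn_eq[OF _ vH] vD by simp
      qed
      have "(\<integral>\<^sup>+w. ID \<gamma>1 w \<partial>lborel) \<le> (\<integral>\<^sup>+w. ennreal (2 / c) * (ennreal (1 + \<eta>) * Ig w + ennreal (1 + 1 / \<eta>) * Ir w) + ID \<gamma>2 w + ennreal (4 * (- m c) / c\<^sup>2) * It w \<partial>lborel)"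
        by (intro nn_integral_mono per_w)
      also have "\<dots> = ennreal (2 / c) * (ennreal (1 + \<eta>) * (\<integral>\<^sup>+w. Ig w \<partial>lborel) + ennreal (1 + 1 / \<eta>) * (\<integral>\<^sup>+w. Ir w \<partial>lborel)) + (\<integral>\<^sup>+w. ID \<gamma>2 w \<partial>lborel) + ennreal (4 * (- m c) / c\<^sup>2) * (\<integral>\<^sup>+w. It w \<partial>lborel)"
        by (simp add: nn_integral_add nn_integral_cmult)
      \<comment> \<open>On the right-hand side replacing \<open>k\<close> by 1 only enlarges the
        estimate.\<close>
      also have "(\<integral>\<^sup>+w. Ig w \<partial>lborel) \<le> ennreal (c * (G u)\<^sup>2)"
      proof -
        have "(\<integral>\<^sup>+w. Ig w \<partial>lborel) \<le> (\<integral>\<^sup>+x. \<integral>\<^sup>+y. (\<rho> x * gg y) * 1 \<partial>lborel \<partial>lborel)"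
          unfolding Ig k_def by (intro nn_integral_mono mult_left_mono k1 R) auto
        also have "\<dots> = ennreal (c * (G u)\<^sup>2)" using c by (simp add: prod[symmetric] \<rho>I ggI ennreal_mult)
        finally show ?thesis .
      qed
      also have "(\<integral>\<^sup>+w. Ir w \<partial>lborel) \<le> ennreal (c * c * (C / R\<^sup>2))"
      proof -
        have "(\<integral>\<^sup>+w. Ir w \<partial>lborel) \<le> (\<integral>\<^sup>+x. \<integral>\<^sup>+y. (\<rho> x * \<rho> y) * ennreal (C / R\<^sup>2) \<partial>lborel \<partial>lborel)"
          unfolding Ir p_def q_def by (intro nn_integral_mono mult_left_mono k4 R) auto
        also have "\<dots> = (\<integral>\<^sup>+x. \<integral>\<^sup>+y. \<rho> x * \<rho> y \<partial>lborel \<partial>lborel) * ennreal (C / R\<^sup>2)" by (simp add: nn_integral_multc)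
        also have "\<dots> = ennreal (c * c * (C / R\<^sup>2))"
        proof -
          have "0 \<le> c" "0 \<le> C / R\<^sup>2" "0 \<le> c * c" using c C by auto
          then show ?thesis by (simp only: prod[symmetric] \<rho>I ennreal_mult[symmetric] \<open>\<rho> \<in> borel_measurable borel\<close>)
        qed
        finally show ?thesis .
      qed
      also have "(\<integral>\<^sup>+w. ID \<gamma>2 w \<partial>lborel) \<le> ennreal (D2 u)"
      proof -
        have "(\<integral>\<^sup>+w. ID \<gamma>2 w \<partial>lborel) \<le> (\<integral>\<^sup>+x. \<integral>\<^sup>+y. (\<rho> x * \<rho> y * Kr \<gamma>2 x y) * 1 \<partial>lborel \<partial>lborel)"
          unfolding ID k_def by (intro nn_integral_mono mult_left_mono k1 R) auto
        also have "\<dots> = ennreal (D2 u)" using D_nn_eq[of \<gamma>2 u] u by (simp add: Dk)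
        finally show ?thesis .
      qed
      \<comment> \<open>Here the vanishing of \<open>k\<close> beyond distance \<open>R\<close>
        matters: the inner integral is at most the mass of one ball.\<close>
      also have "(\<integral>\<^sup>+w. It w \<partial>lborel) \<le> ennreal (c * M)"
      proof -
        have "(\<integral>\<^sup>+w. It w \<partial>lborel) = (\<integral>\<^sup>+x. \<rho> x * (\<integral>\<^sup>+y. \<rho> y * k x y \<partial>lborel) \<partial>lborel)"
          unfolding It by (simp add: mult.assoc nn_integral_cmult)
        also have "\<dots> \<le> (\<integral>\<^sup>+x. \<rho> x * ennreal M \<partial>lborel)"
        proof (intro nn_integral_mono mult_left_mono)
          fix x
          have "(\<integral>\<^sup>+y. \<rho> y * k x y \<partial>lborel) \<le> (\<integral>\<^sup>+y. indicator (ball x R) y * \<rho> y \<partial>lborel)"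
          proof (intro nn_integral_mono)
            fix y
            show "\<rho> y * k x y \<le> indicator (ball x R) y * \<rho> y"
            proof (cases "y \<in> ball x R")
              case True
              then show ?thesis using mult_left_mono[OF k1[OF R, of x y], of "\<rho> y"] by (simp add: k_def)
            next
              case False
              then show ?thesis using k2[OF R, of x y] by (simp add: k_def dist_norm)
            qed
          qed
          also have "\<dots> = ennreal (ball_mass u x R)" unfolding \<rho>_def by (rule nn_ball_mass[OF uL])
          also have "\<dots> \<le> ennreal M" by (intro ennreal_leI M)
          finally show "(\<integral>\<^sup>+y. \<rho> y * k x y \<partial>lborel) \<le> ennreal M" .
        qed simp
        also have "\<dots> = ennreal (c * M)" using c M by (simp add: nn_integral_multc \<rho>I ennreal_mult)
        finally show ?thesis .
      qed
      finally have I1: "(\<integral>\<^sup>+w. ID \<gamma>1 w \<partial>lborel) \<le> ennreal (2 / c) * (ennreal (1 + \<eta>) * ennreal (c * (G u)\<^sup>2) + ennreal (1 + 1 / \<eta>) * ennreal (c * c * (C / R\<^sup>2)))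
          + ennreal (D2 u) + ennreal (4 * (- m c) / c\<^sup>2) * ennreal (c * M)"
        by (simp add: add_mono mult_left_mono)
      have nn: "0 \<le> 2 / c" "0 \<le> 1 + \<eta>" "0 \<le> c * (G u)\<^sup>2" "0 \<le> 1 + 1 / \<eta>" "0 \<le> c * c * (C / R\<^sup>2)" "0 \<le> D2 u" "0 \<le> 4 * (- m c) / c\<^sup>2" "0 \<le> c * M" "0 \<le> c"
          using c m4 \<eta> C M D_nonneg[of \<gamma>2 u] u by (auto intro!: divide_nonneg_nonneg mult_nonneg_nonneg)
      have e: "0 \<le> (C + 1) * R powr (- \<gamma>1)" using C by simp
      \<comment> \<open>The averaged \<open>D1\<close> falls short of the full one by an error of
        order \<open>R powr (- \<gamma>1)\<close> times the squared mass.\<close>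
      have "ennreal (D1 u) = (\<integral>\<^sup>+x. \<integral>\<^sup>+y. \<rho> x * \<rho> y * Kr \<gamma>1 x y \<partial>lborel \<partial>lborel)"
        using D_nn_eq[of \<gamma>1 u] u by (simp add: Dk)
      also have "\<dots> \<le> (\<integral>\<^sup>+x. \<integral>\<^sup>+y. (\<rho> x * \<rho> y * Kr \<gamma>1 x y) * k x y + \<rho> x * \<rho> y * ennreal ((C + 1) * R powr (- \<gamma>1)) \<partial>lborel \<partial>lborel)"
      proof (intro nn_integral_mono)
        fix x y
        have "Kr \<gamma>1 x y \<le> Kr \<gamma>1 x y * k x y + ennreal ((C + 1) * R powr (- \<gamma>1))"
          unfolding Kr_def k_def using \<gamma>1 \<gamma>2 \<gamma>21 k3[OF R, of x y] by (intro kernel_error_bound R C) auto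
        then have "(\<rho> x * \<rho> y) * Kr \<gamma>1 x y \<le> (\<rho> x * \<rho> y) * (Kr \<gamma>1 x y * k x y + ennreal ((C + 1) * R powr (- \<gamma>1)))"
          by (rule mult_left_mono) simp
        then show "\<rho> x * \<rho> y * Kr \<gamma>1 x y \<le> (\<rho> x * \<rho> y * Kr \<gamma>1 x y) * k x y + \<rho> x * \<rho> y * ennreal ((C + 1) * R powr (- \<gamma>1))"
          by (simp only: distrib_left mult.assoc)
      qed
      also have "\<dots> = (\<integral>\<^sup>+w. ID \<gamma>1 w \<partial>lborel) + (\<integral>\<^sup>+x. \<integral>\<^sup>+y. \<rho> x * \<rho> y \<partial>lborel \<partial>lborel) * ennreal ((C + 1) * R powr (- \<gamma>1))"
        unfolding ID by (simp add: nn_integral_add nn_integral_multc)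
      also have "(\<integral>\<^sup>+x. \<integral>\<^sup>+y. \<rho> x * \<rho> y \<partial>lborel \<partial>lborel) = ennreal c * ennreal c" by (simp add: prod[symmetric] \<rho>I)
      also have "(\<integral>\<^sup>+w. ID \<gamma>1 w \<partial>lborel) + ennreal c * ennreal c * ennreal ((C + 1) * R powr (- \<gamma>1))
         \<le> (ennreal (2 / c) * (ennreal (1 + \<eta>) * ennreal (c * (G u)\<^sup>2) + ennreal (1 + 1 / \<eta>) * ennreal (c * c * (C / R\<^sup>2)))
          + ennreal (D2 u) + ennreal (4 * (- m c) / c\<^sup>2) * ennreal (c * M)) + ennreal c * ennreal c * ennreal ((C + 1) * R powr (- \<gamma>1))"
        by (intro add_right_mono I1)
      also have "\<dots> = ennreal ((2 / c) * ((1 + \<eta>) * (c * (G u)\<^sup>2) + (1 + 1 / \<eta>) * (c * c * (C / R\<^sup>2)))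
          + D2 u + (4 * (- m c) / c\<^sup>2) * (c * M) + c * c * ((C + 1) * R powr (- \<gamma>1)))"
        using e nn by (simp only: ennreal_plus[symmetric] ennreal_mult[symmetric] mult_nonneg_nonneg add_nonneg_nonneg)
      finally have "D1 u \<le> (2 / c) * ((1 + \<eta>) * (c * (G u)\<^sup>2) + (1 + 1 / \<eta>) * (c * c * (C / R\<^sup>2)))
          + D2 u + (4 * (- m c) / c\<^sup>2) * (c * M) + c * c * ((C + 1) * R powr (- \<gamma>1))"
        by (rule ennreal_le_iff[THEN iffD1, rotated]) (intro add_nonneg_nonneg mult_nonneg_nonneg[OF nn(1)]
          mult_nonneg_nonneg[OF nn(2)] mult_nonneg_nonneg[OF nn(4)] mult_nonneg_nonneg[OF nn(7)] nn mult_nonneg_nonneg[OF _ e] mult_nonneg_nonneg[OF nn(9,9)])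
      also have "\<dots> = 2 * (1 + \<eta>) * (G u)\<^sup>2 + 2 * (1 + 1 / \<eta>) * (c * (C / R\<^sup>2)) + D2 u + 4 * (- m c) * M / c + (C + 1) * R powr (- \<gamma>1) * c\<^sup>2"
      proof -
        have a: "2 / c * (s * (c * g) + t * (c * c * k)) = 2 * s * g + 2 * t * (c * k)" for s t g k :: real
          using c by (simp add: distrib_left)
        have b: "(4 * (- m c) / c\<^sup>2) * (c * M) = 4 * (- m c) * M / c" using c by (simp add: power2_eq_square)
        have d: "c * c * ((C + 1) * R powr (- \<gamma>1)) = (C + 1) * R powr (- \<gamma>1) * c\<^sup>2" by (simp only: power2_eq_square mult_ac)
        show ?thesis unfolding a b d by (rule refl)
      qed
      also have "2 * (1 + 1 / \<eta>) * (c * (C / R\<^sup>2)) \<le> 2 * (1 + 1 / \<eta>) * (c * ((C + 1) / R\<^sup>2))"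
        using \<eta> c by (intro mult_left_mono divide_right_mono) auto
      finally show ?thesis by (simp add: energy_altdef algebra_simps)
    qed
    show thesis by (rule that[of "C + 1"]) (use C main in auto)
  qed
qed

end

section \<open>Compactness in \<open>L\<^sup>2\<close>\<close>

lemma ball_mass_translate:
  fixes u :: "real^'n \<Rightarrow> 'b::euclidean_space"
  assumes "u \<in> L2" shows "ball_mass (\<lambda>x. u (x + y)) a r = ball_mass u (a + y) r"
proof -
  note [measurable] = L2_measurable[OF assms]
  have "indicator (ball a r) x = (indicator (ball (a + y) r) (x + y) :: real)" for x
    by (simp add: indicator_def dist_norm)
  then show ?thesis unfolding ball_mass_def
    using integral_translate[of "\<lambda>x. indicator (ball (a + y) r) x * (norm (u x))\<^sup>2" y] by simp
qed

lemma ball_mass_disjoint: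
  assumes "u \<in> L2" "ball a r \<inter> ball b s = {}" shows "ball_mass u a r + ball_mass u b s \<le> (l2norm u)\<^sup>2"
proof -
  have "ball_mass u a r + ball_mass u b s = (LINT x|lborel. indicator (ball a r) x * (norm (u x))\<^sup>2 + indicator (ball b s) x * (norm (u x))\<^sup>2)"
    unfolding ball_mass_def by (simp add: ball_mass_integrable[OF assms(1)])
  also have "\<dots> \<le> (l2norm u)\<^sup>2" unfolding l2norm_square
  proof (intro integral_mono Bochner_Integration.integrable_add ball_mass_integrable assms(1) L2_integrable)
    fix x show "indicator (ball a r) x * (norm (u x))\<^sup>2 + indicator (ball b s) x * (norm (u x))\<^sup>2 \<le> (norm (u x))\<^sup>2"
      using assms(2) by (cases "x \<in> ball a r"; cases "x \<in> ball b s") auto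
  qed
  finally show ?thesis .
qed

lemma l2norm_triangle_diff:
  assumes "f \<in> L2" "g \<in> L2" shows "l2norm (\<lambda>x. f x - g x) \<le> l2norm f + l2norm g"
  using l2norm_triangle[OF assms(1) L2_scaleR[OF assms(2), of "-1"]] l2norm_scaleR[of "-1" g] by simp

text \<open>Not divided by the volume of the ball, which accounts for the powers of \<open>V\<close>
  in \<open>local_Poincare\<close>.\<close>

definition avg :: "(real^'n \<Rightarrow> 'b::euclidean_space) \<Rightarrow> real \<Rightarrow> real^'n \<Rightarrow> 'b" where
  "avg u s x = (LINT z|lborel. indicat_real (ball x s) z *\<^sub>R u z)"

definition ball_vol :: "'n::finite itself \<Rightarrow> real \<Rightarrow> real" where
  "ball_vol _ s = unit_ball_vol (real CARD('n)) * s ^ CARD('n)"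

lemma emeasure_ball_vol: "s \<ge> 0 \<Longrightarrow> emeasure lborel (ball (a :: real^'n) s) = ennreal (ball_vol TYPE('n) s)"
  using emeasure_ball[of s a] by (simp add: ball_vol_def)

lemma ball_vol_pos: "s > 0 \<Longrightarrow> ball_vol TN s > 0"
  by (simp add: ball_vol_def)

lemma ball_indicator_L2:
  fixes a :: "real^'n"
  assumes "s > 0"
  shows "(indicat_real (ball a s)) \<in> L2" "l2norm (indicat_real (ball a s)) = sqrt (ball_vol TYPE('n) s)"
proof -
  have e: "(norm (indicat_real (ball a s) x))\<^sup>2 = indicat_real (ball a s) x" for x
    by (simp add: indicator_def)
  have "integrable lborel (\<lambda>x. (norm (indicat_real (ball a s) x))\<^sup>2)"
    unfolding e using emeasure_ball_vol[of s a] assms by simp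
  then show "(indicat_real (ball a s)) \<in> L2" by (simp add: L2_def)
  show "l2norm (indicat_real (ball a s)) = sqrt (ball_vol TYPE('n) s)"
    unfolding l2norm_def e using emeasure_ball_vol[of s a] ball_vol_pos[OF assms, of "TYPE('n)"] assms by (simp add: measure_def less_imp_le)
qed

lemma ball_integrable:
  fixes u :: "real^'n \<Rightarrow> 'b::euclidean_space"
  assumes "u \<in> L2" "s > 0" shows "integrable lborel (\<lambda>z. indicat_real (ball x s) z *\<^sub>R u z)"
proof (rule L2_bilinear_integrable[OF ball_indicator_L2(1)[OF assms(2), of x] assms(1)])
  show "(\<lambda>z. indicat_real (ball x s) z *\<^sub>R u z) \<in> borel_measurable borel"
    using L2_measurable[OF assms(1)] by measurable
qed simp

lemma avg_le:
  fixes u :: "real^'n \<Rightarrow> 'b::euclidean_space"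
  assumes "u \<in> L2" "s > 0" shows "norm (avg u s x) \<le> sqrt (ball_vol TYPE('n) s) * l2norm u"
proof -
  have "norm (avg u s x) \<le> l2norm (indicat_real (ball x s)) * l2norm u"
    unfolding avg_def
  proof (rule L2_bilinear_le[OF ball_indicator_L2(1)[OF assms(2), of x] assms(1)])
    show "(\<lambda>z. indicat_real (ball x s) z *\<^sub>R u z) \<in> borel_measurable borel"
      using L2_measurable[OF assms(1)] by measurable
  qed simp
  then show ?thesis by (simp add: ball_indicator_L2(2)[OF assms(2)])
qed

lemma avg_translate:
  fixes u :: "real^'n \<Rightarrow> 'b::euclidean_space"
  assumes "u \<in> L2" shows "avg (\<lambda>x. u (x + y)) s x = avg u s (x + y)"
proof -
  note [measurable] = L2_measurable[OF assms]
  have "indicat_real (ball x s) z = indicat_real (ball (x + y) s) (z + y)" for z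
    by (simp add: indicator_def dist_norm)
  then show ?thesis unfolding avg_def
    using integral_translate[of "\<lambda>z. indicat_real (ball (x + y) s) z *\<^sub>R u z" y] by simp
qed

lemma avg_diff:
  fixes u v :: "real^'n \<Rightarrow> 'b::euclidean_space"
  assumes "u \<in> L2" "v \<in> L2" "s > 0" shows "avg (\<lambda>x. u x - v x) s x = avg u s x - avg v s x"
  unfolding avg_def by (simp add: scaleR_diff_right ball_integrable assms)

text \<open>Averages at two points are averages of two translates around one point, so
  \<open>L2\<close> control of translations gives equicontinuity with one constant for a whole
  sequence.\<close>

lemma avg_Lipschitz:
  fixes u :: "real^'n \<Rightarrow> 'b::euclidean_space"
  assumes u: "u \<in> L2" and K: "\<And>h. l2norm (\<lambda>x. u (x + h) - u x) \<le> K * norm h" and s: "s > 0"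
  shows "norm (avg u s x - avg u s y) \<le> sqrt (ball_vol TYPE('n) s) * (K * norm (x - y))"
proof -
  have "avg u s x - avg u s y = avg (\<lambda>z. u (z + (x - y)) - u z) s y"
    using avg_translate[OF u, of "x - y" s y] by (simp add: avg_diff L2_translate u s)
  also have "norm \<dots> \<le> sqrt (ball_vol TYPE('n) s) * l2norm (\<lambda>z. u (z + (x - y)) - u z)"
    by (intro avg_le L2_diff L2_translate u s)
  also have "\<dots> \<le> sqrt (ball_vol TYPE('n) s) * (K * norm (x - y))"
    using ball_vol_pos[OF s, of "TYPE('n)"] by (intro mult_left_mono K) simp
  finally show ?thesis .
qed

lemma avg_measurable:
  fixes u :: "real^'n \<Rightarrow> 'b::euclidean_space"
  assumes "u \<in> L2" shows "avg u s \<in> borel_measurable borel"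
proof -
  note [measurable] = L2_measurable[OF assms]
  have "avg u s x = (LINT z|lborel. indicat_real (ball 0 s) z *\<^sub>R u (z + x))" for x
    using avg_translate[OF assms, of x s 0] by (simp add: avg_def)
  then have "avg u s = (\<lambda>x. LINT z|lborel. indicat_real (ball 0 s) z *\<^sub>R u (z + x))" by (rule ext)
  also have "\<dots> \<in> borel_measurable borel" by (intro lborel.borel_measurable_lebesgue_integral) measurable
  finally show ?thesis .
qed

lemma avg_square_integrable:
  fixes u :: "real^'n \<Rightarrow> 'b::euclidean_space"
  assumes "u \<in> L2" "s > 0" "R > 0" shows "integrable lborel (\<lambda>x. indicat_real (ball 0 R) x * (norm (avg u s x))\<^sup>2)"
proof -
  note [measurable] = avg_measurable[OF assms(1)]
  have "integrable lborel (\<lambda>x::real^'n. indicat_real (ball 0 R) x * (sqrt (ball_vol TYPE('n) s) * l2norm u)\<^sup>2)"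
    using emeasure_ball_vol[of R "0::real^'n"] assms(3) by (intro integrable_mult_left) simp
  then show ?thesis
    by (rule Bochner_Integration.integrable_bound)
       (use avg_le[OF assms(1,2)] in \<open>auto simp: abs_mult intro!: mult_left_mono power_mono\<close>)
qed

text \<open>The difference between \<open>avg u s x\<close> and \<open>V *\<^sub>R u x\<close> is
  the integral of \<open>u (x + h) - u x\<close> over \<open>norm h < s\<close>; the Cauchy-Schwarz
  inequality contributes a factor \<open>V\<close>, and Fubini reduces the rest to the translation
  estimate. For small \<open>s\<close>, smallness on a ball thus follows from smallness of the
  averages.\<close>

lemma local_Poincare:
  fixes u :: "real^'n \<Rightarrow> 'b::euclidean_space"
  assumes u: "u \<in> L2" and K: "\<And>h. l2norm (\<lambda>x. u (x + h) - u x) \<le> K * norm h" "K \<ge> 0" and s: "s > 0" and R: "R > 0"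
  defines "V \<equiv> ball_vol TYPE('n) s"
  shows "ball_mass u 0 R \<le> 2 / V\<^sup>2 * (LINT x|lborel. indicat_real (ball 0 R) x * (norm (avg u s x))\<^sup>2) + 2 * (K * s)\<^sup>2"
proof -
  note [measurable] = L2_measurable[OF u] avg_measurable[OF u]
  have V: "V > 0" unfolding V_def by (rule ball_vol_pos[OF s])
  let ?B = "ball (0::real^'n) s"
  let ?d = "\<lambda>h x. ennreal ((norm (u (x + h) - u x))\<^sup>2)"
  have vB: "emeasure lborel ?B = ennreal V" unfolding V_def using emeasure_ball_vol[of s 0] s by simp
  have pt: "ennreal (V\<^sup>2) * ennreal ((norm (u x))\<^sup>2) \<le> 2 * ennreal ((norm (avg u s x))\<^sup>2) + 2 * (ennreal V * (\<integral>\<^sup>+h. indicator ?B h * ?d h x \<partial>lborel))" for x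
  proof -
    have i1: "integrable lborel (\<lambda>h. indicat_real ?B h *\<^sub>R u (h + x))" by (rule ball_integrable[OF L2_translate[OF u] s])
    have i2: "integrable lborel (\<lambda>h. indicat_real ?B h *\<^sub>R u x)" using vB by (intro integrable_scaleR_left) simp
    have m: "measure lborel ?B = V" using vB V by (simp add: measure_def less_imp_le)
    have "avg u s x - V *\<^sub>R u x = (LINT h|lborel. indicat_real ?B h *\<^sub>R u (h + x)) - (LINT h|lborel. indicat_real ?B h *\<^sub>R u x)"
      using avg_translate[OF u, of x s 0] vB by (simp add: avg_def m)
    also have "\<dots> = (LINT h|lborel. indicat_real ?B h *\<^sub>R u (h + x) - indicat_real ?B h *\<^sub>R u x)"
      by (rule Bochner_Integration.integral_diff[OF i1 i2, symmetric])
    finally have eq: "avg u s x - V *\<^sub>R u x = (LINT h|lborel. indicat_real ?B h *\<^sub>R (u (x + h) - u x))"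
      by (simp add: scaleR_diff_right add.commute)
    have i3: "integrable lborel (\<lambda>h. indicat_real ?B h *\<^sub>R (u (x + h) - u x))"
      using Bochner_Integration.integrable_diff[OF i1 i2] by (simp add: scaleR_diff_right add.commute)
    have "ennreal (norm (avg u s x - V *\<^sub>R u x)) \<le> (\<integral>\<^sup>+h. ennreal (norm (indicat_real ?B h *\<^sub>R (u (x + h) - u x))) \<partial>lborel)"
      unfolding eq by (rule integral_norm_bound_ennreal[OF i3])
    also have "\<dots> = (\<integral>\<^sup>+h. indicator ?B h * (indicator ?B h * ennreal (norm (u (x + h) - u x))) \<partial>lborel)"
      by (intro nn_integral_cong) (auto simp: indicator_def)
    finally have "(ennreal (norm (avg u s x - V *\<^sub>R u x)))\<^sup>2 \<le> (\<integral>\<^sup>+h. indicator ?B h * (indicator ?B h * ennreal (norm (u (x + h) - u x))) \<partial>lborel)\<^sup>2"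
      by (rule power_mono) simp
    also have "\<dots> \<le> (\<integral>\<^sup>+h. (indicator ?B h)\<^sup>2 \<partial>lborel) * (\<integral>\<^sup>+h. (indicator ?B h * ennreal (norm (u (x + h) - u x)))\<^sup>2 \<partial>lborel)"
      by (rule Cauchy_Schwarz_nn_integral) measurable
    also have "(\<lambda>h. (indicator ?B h :: ennreal)\<^sup>2) = indicator ?B" by (auto simp: indicator_def)
    also have "(\<lambda>h. (indicator ?B h * ennreal (norm (u (x + h) - u x)))\<^sup>2) = (\<lambda>h. indicator ?B h * ?d h x)"
      by (auto simp: indicator_def ennreal_power)
    finally have le: "ennreal ((norm (avg u s x - V *\<^sub>R u x))\<^sup>2) \<le> ennreal V * (\<integral>\<^sup>+h. indicator ?B h * ?d h x \<partial>lborel)"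
      by (simp add: ennreal_power vB)
    have "V\<^sup>2 * (norm (u x))\<^sup>2 \<le> 2 * (norm (avg u s x))\<^sup>2 + 2 * (norm (avg u s x - V *\<^sub>R u x))\<^sup>2"
      using norm_add_square_le[of "avg u s x" "- (avg u s x - V *\<^sub>R u x)"] by (simp add: power_mult_distrib norm_minus_commute)
    then have "ennreal (V\<^sup>2 * (norm (u x))\<^sup>2) \<le> ennreal (2 * (norm (avg u s x))\<^sup>2 + 2 * (norm (avg u s x - V *\<^sub>R u x))\<^sup>2)"
      by (rule ennreal_leI)
    also have "\<dots> = 2 * ennreal ((norm (avg u s x))\<^sup>2) + 2 * ennreal ((norm (avg u s x - V *\<^sub>R u x))\<^sup>2)"
      by (simp add: ennreal_mult)
    also have "\<dots> \<le> 2 * ennreal ((norm (avg u s x))\<^sup>2) + 2 * (ennreal V * (\<integral>\<^sup>+h. indicator ?B h * ?d h x \<partial>lborel))"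
      by (intro add_left_mono mult_left_mono le) simp
    finally show ?thesis by (simp add: ennreal_mult)
  qed
  define A where "A = (LINT x|lborel. indicat_real (ball 0 R) x * (norm (avg u s x))\<^sup>2)"
  have A0: "A \<ge> 0" unfolding A_def by (intro integral_nonneg_AE AE_I2) simp
  have A: "(\<integral>\<^sup>+x. indicator (ball 0 R) x * ennreal ((norm (avg u s x))\<^sup>2) \<partial>lborel) = ennreal A"
  proof -
    have "(\<integral>\<^sup>+x. indicator (ball 0 R) x * ennreal ((norm (avg u s x))\<^sup>2) \<partial>lborel)
      = (\<integral>\<^sup>+x. ennreal (indicat_real (ball 0 R) x * (norm (avg u s x))\<^sup>2) \<partial>lborel)"
      by (intro nn_integral_cong) (auto simp: indicator_def)
    then show ?thesis unfolding A_def by (simp add: nn_integral_eq_integral avg_square_integrable[OF u s R])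
  qed
  have "ennreal (V\<^sup>2) * ennreal (ball_mass u 0 R) = (\<integral>\<^sup>+x. indicator (ball 0 R) x * (ennreal (V\<^sup>2) * ennreal ((norm (u x))\<^sup>2)) \<partial>lborel)"
    unfolding nn_ball_mass[OF u, symmetric] by (simp add: nn_integral_cmult[symmetric] mult_ac)
  also have "\<dots> \<le> (\<integral>\<^sup>+x. 2 * (indicator (ball 0 R) x * ennreal ((norm (avg u s x))\<^sup>2)) + 2 * (ennreal V * (\<integral>\<^sup>+h. indicator ?B h * ?d h x \<partial>lborel)) \<partial>lborel)"
  proof (intro nn_integral_mono)
    fix x
    show "indicator (ball 0 R) x * (ennreal (V\<^sup>2) * ennreal ((norm (u x))\<^sup>2))
       \<le> 2 * (indicator (ball 0 R) x * ennreal ((norm (avg u s x))\<^sup>2)) + 2 * (ennreal V * (\<integral>\<^sup>+h. indicator ?B h * ?d h x \<partial>lborel))"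
      using pt[of x] by (cases "x \<in> ball 0 R") auto
  qed
  also have "\<dots> = 2 * ennreal A + 2 * (ennreal V * (\<integral>\<^sup>+x. \<integral>\<^sup>+h. indicator ?B h * ?d h x \<partial>lborel \<partial>lborel))"
    by (simp add: nn_integral_add nn_integral_cmult A)
  also have "(\<integral>\<^sup>+x. \<integral>\<^sup>+h. indicator ?B h * ?d h x \<partial>lborel \<partial>lborel) = (\<integral>\<^sup>+h. \<integral>\<^sup>+x. indicator ?B h * ?d h x \<partial>lborel \<partial>lborel)"
    by (intro lborel_pair.Fubini') measurable
  also have "\<dots> \<le> (\<integral>\<^sup>+h. indicator ?B h * ennreal ((K * s)\<^sup>2) \<partial>lborel)"
  proof (intro nn_integral_mono)
    fix h :: "real^'n"
    show "(\<integral>\<^sup>+x. indicator ?B h * ?d h x \<partial>lborel) \<le> indicator ?B h * ennreal ((K * s)\<^sup>2)"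
    proof (cases "h \<in> ?B")
      case True
      then have "K * norm h \<le> K * s" using K(2) by (intro mult_left_mono) auto
      with K(1)[of h] have "l2norm (\<lambda>x. u (x + h) - u x) \<le> K * s" by linarith
      then have "(\<integral>\<^sup>+x. ?d h x \<partial>lborel) \<le> ennreal ((K * s)\<^sup>2)"
        using K(2) s by (subst (asm) l2norm_le_iff_nn) (auto intro!: L2_diff L2_translate u)
      then show ?thesis using True by simp
    qed simp
  qed
  also have "\<dots> = ennreal V * ennreal ((K * s)\<^sup>2)" by (simp add: nn_integral_multc vB)
  finally have "ennreal (V\<^sup>2) * ennreal (ball_mass u 0 R) \<le> 2 * ennreal A + 2 * (ennreal V * (ennreal V * ennreal ((K * s)\<^sup>2)))"
    by (simp add: mult_left_mono)
  also have "\<dots> = ennreal (2 * A + 2 * (V * (V * (K * s)\<^sup>2)))"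
    using V A0 by (simp add: ennreal_mult ennreal_plus less_imp_le)
  also have "ennreal (V\<^sup>2) * ennreal (ball_mass u 0 R) = ennreal (V\<^sup>2 * ball_mass u 0 R)"
    by (simp add: ennreal_mult ball_mass_nonneg)
  finally have "V\<^sup>2 * ball_mass u 0 R \<le> 2 * A + 2 * (V * (V * (K * s)\<^sup>2))"
    using V A0 by (subst (asm) ennreal_le_iff) (auto intro!: add_nonneg_nonneg mult_nonneg_nonneg)
  also have "\<dots> = V\<^sup>2 * (2 / V\<^sup>2 * A + 2 * (K * s)\<^sup>2)" using V by (simp add: power2_eq_square field_simps)
  finally show ?thesis unfolding A_def using V by simp
qed

lemma diagonal_convergent_subsequence:
  fixes a :: "nat \<Rightarrow> nat \<Rightarrow> 'b::euclidean_space"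
  assumes "\<And>j n. norm (a j n) \<le> B j"
  shows "\<exists>r. strict_mono r \<and> (\<forall>j. convergent (\<lambda>n. a j (r n)))"
proof -
  interpret subseqs "\<lambda>j s. convergent (\<lambda>n. a j (s n))"
  proof
    fix j and s :: "nat \<Rightarrow> nat"
    have "seq_compact (cball (0::'b) (B j))" by (intro compact_imp_seq_compact compact_cball)
    moreover have "\<forall>n. a j (s n) \<in> cball 0 (B j)" using assms by simp
    ultimately obtain l r where "strict_mono r" "((\<lambda>n. a j (s n)) \<circ> r) \<longlonglongrightarrow> l" by (rule seq_compactE)
    then show "\<exists>r'. strict_mono r' \<and> convergent (\<lambda>n. a j ((s \<circ> r') n))"
      by (auto simp: convergent_def o_def)
  qed
  \<comment> \<open>The diagonal is controlled at stage \<open>j\<close> only from index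
    \<open>Suc j\<close> on; the initial segment is discarded afterwards.\<close>
  have "convergent (\<lambda>n. a j ((diagseq \<circ> (+) (Suc j)) n))" for j
  proof (rule diagseq_holds)
    fix r s :: "nat \<Rightarrow> nat" and n assume "strict_mono r" "convergent (\<lambda>i. a n (s i))"
    then show "convergent (\<lambda>i. a n ((s \<circ> r) i))"
      using convergent_subseq_convergent[of "\<lambda>i. a n (s i)" r] by (simp add: o_def)
  qed
  then have "convergent (\<lambda>n. a j (diagseq (n + Suc j)))" for j by (simp only: o_def add.commute[of _ "Suc j"])
  then have "convergent (\<lambda>n. a j (diagseq n))" for j
    using convergent_ignore_initial_segment[of "\<lambda>n. a j (diagseq n)" "Suc j"] by simp
  then show ?thesis using subseq_diagseq by blast
qed

text \<open>Kolmogorov-Riesz compactness. Averages over balls with countably many centres and radii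
  converge along a diagonal subsequence; equicontinuity extends this to all centres, and dominated
  convergence makes it \<open>L2\<close> convergence on balls. Then \<open>local_Poincare\<close>
  controls the functions inside a large ball and tightness outside.\<close>

lemma L2_precompact:
  fixes v :: "nat \<Rightarrow> real^'n \<Rightarrow> 'b::euclidean_space"
  assumes v: "\<And>n. v n \<in> L2" and A: "\<And>n. l2norm (v n) \<le> A"
    and K: "\<And>n h. l2norm (\<lambda>x. v n (x + h) - v n x) \<le> K * norm h" "K \<ge> 0"
    and tight: "\<And>\<delta>. \<delta> > 0 \<Longrightarrow> \<exists>R>0. \<forall>\<^sub>F n in sequentially. (l2norm (v n))\<^sup>2 - ball_mass (v n) 0 R \<le> \<delta>"
  obtains r :: "nat \<Rightarrow> nat" where "strict_mono r" "\<And>e. e > 0 \<Longrightarrow> \<exists>M. \<forall>m\<ge>M. \<forall>n\<ge>M. l2norm (\<lambda>x. v (r m) x - v (r n) x) < e"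
proof -
  let ?vol = "ball_vol TYPE('n)"
  obtain D :: "(real^'n) set" where D: "countable D" "\<And>X. open X \<Longrightarrow> X \<noteq> {} \<Longrightarrow> \<exists>d\<in>D. d \<in> X"
    using countable_dense_setE by blast
  then have "D \<noteq> {}" by force
  define d where "d = from_nat_into D"
  have d: "range d = D" unfolding d_def using range_from_nat_into[OF \<open>D \<noteq> {}\<close> D(1)] .
  define \<sigma> where "\<sigma> k = 1 / real (Suc k)" for k
  have \<sigma>: "\<sigma> k > 0" for k by (simp add: \<sigma>_def)
  \<comment> \<open>\<open>prod_decode\<close> enumerates the pairs of a centre index and a radius
    index.\<close>
  define a where "a j n = avg (v n) (\<sigma> (snd (prod_decode j))) (d (fst (prod_decode j)))" for j n
  have "norm (a j n) \<le> sqrt (?vol (\<sigma> (snd (prod_decode j)))) * A" for j n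
    unfolding a_def using avg_le[OF v \<sigma>, of n "snd (prod_decode j)"] ball_vol_pos[OF \<sigma>, of "TYPE('n)"]
    by (intro order_trans[OF _ mult_left_mono[OF A[of n]]]) (auto intro: less_imp_le)
  from diagonal_convergent_subsequence[of a, OF this]
  obtain r where r: "strict_mono r" and cv: "\<And>j. convergent (\<lambda>n. a j (r n))" by blast
  let ?b = "\<lambda>k n. avg (v (r n)) (\<sigma> k)" and ?I = "\<lambda>R. indicat_real (ball (0::real^'n) R)"
  have conv_all: "convergent (\<lambda>n. ?b k n x)" for k x
  proof -
    have "Cauchy (\<lambda>n. ?b k n x)"
    proof (rule metric_CauchyI)
      fix e :: real assume e: "e > 0"
      \<comment> \<open>The 1 keeps this Lipschitz constant positive even when
        \<open>K = 0\<close>.\<close>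
      define Q where "Q = sqrt (?vol (\<sigma> k)) * K + 1"
      have Q: "Q > 0" unfolding Q_def using K(2) ball_vol_pos[OF \<sigma>, of "TYPE('n)" k] by (intro add_nonneg_pos mult_nonneg_nonneg) auto
      obtain z where z: "z \<in> D" "dist x z < e / (3 * Q)"
      proof -
        have "0 < e / (3 * Q)" using e Q by simp
        then have "ball x (e / (3 * Q)) \<noteq> {}" by simp
        then show thesis using D(2)[of "ball x (e / (3 * Q))"] that by auto
      qed
      then obtain i where i: "z = d i" using d by auto
      have near: "norm (avg (v n) (\<sigma> k) x - avg (v n) (\<sigma> k) z) < e / 3" for n
      proof -
        have "norm (avg (v n) (\<sigma> k) x - avg (v n) (\<sigma> k) z) \<le> sqrt (?vol (\<sigma> k)) * (K * norm (x - z))"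
          by (rule avg_Lipschitz[OF v K(1) \<sigma>])
        also have "\<dots> \<le> Q * norm (x - z)" by (simp add: Q_def distrib_right mult.assoc)
        also have "\<dots> < Q * (e / (3 * Q))" using z(2) Q by (intro mult_strict_left_mono) (auto simp: dist_norm)
        also have "\<dots> = e / 3" using Q by simp
        finally show ?thesis .
      qed
      have "convergent (\<lambda>n. ?b k n z)" using cv[of "prod_encode (i, k)"] by (simp add: a_def i)
      then have "Cauchy (\<lambda>n. ?b k n z)" by (rule convergent_Cauchy)
      then obtain M where M: "\<And>m n. m \<ge> M \<Longrightarrow> n \<ge> M \<Longrightarrow> dist (?b k m z) (?b k n z) < e / 3"
        using e by (metis metric_CauchyD divide_pos_pos zero_less_numeral)
      show "\<exists>M. \<forall>m\<ge>M. \<forall>n\<ge>M. dist (?b k m x) (?b k n x) < e"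
      proof (intro exI[of _ M] allI impI)
        fix m n assume mn: "M \<le> m" "M \<le> n"
        have "?b k m x - ?b k n x
          = (?b k m x - ?b k m z) + (?b k m z - ?b k n z)
            - (?b k n x - ?b k n z)" by simp
        also have "norm \<dots> \<le> norm (?b k m x - ?b k m z) + norm (?b k m z - ?b k n z)
            + norm (?b k n x - ?b k n z)"
          by (intro order_trans[OF norm_triangle_ineq4] add_mono norm_triangle_ineq order_refl)
        finally show "dist (?b k m x) (?b k n x) < e"
          using near[of "r m"] near[of "r n"] M[OF mn] by (simp add: dist_norm)
      qed
    qed
    then show ?thesis by (simp add: Cauchy_convergent_iff)
  qed
  have ball_conv: "\<exists>M. \<forall>m\<ge>M. \<forall>n\<ge>M. (LINT x|lborel. ?I R x * (norm (avg (\<lambda>x. v (r m) x - v (r n) x) (\<sigma> k) x))\<^sup>2) < e"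
    if e: "e > 0" and R: "R > 0" for e R k
  proof -
    define l where "l x = lim (\<lambda>n. ?b k n x)" for x
    have l: "(\<lambda>n. ?b k n x) \<longlonglongrightarrow> l x" for x
      unfolding l_def using conv_all[of k x] by (simp add: convergent_LIMSEQ_iff)
    note [measurable] = avg_measurable[OF v]
    have [measurable]: "l \<in> borel_measurable borel"
      by (rule borel_measurable_LIMSEQ_metric[OF _ l]) measurable
    define B where "B = sqrt (?vol (\<sigma> k)) * A"
    have aB: "norm (avg (v n) (\<sigma> k) x) \<le> B" for n x
      unfolding B_def using avg_le[OF v \<sigma>, of n k x] ball_vol_pos[OF \<sigma>, of "TYPE('n)" k]
      by (intro order_trans[OF _ mult_left_mono[OF A[of n]]]) (auto intro: less_imp_le)
    have lB: "norm (l x) \<le> B" for x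
      using tendsto_norm[OF l[of x]] aB by (intro Lim_bounded[of _ _ 0]) auto
    define I where "I n = (LINT x|lborel. ?I R x * (norm (?b k n x - l x))\<^sup>2)" for n
    have dom: "?I R x * (norm (?b k n x - l x))\<^sup>2 \<le> ?I R x * (2 * B)\<^sup>2" for x n
    proof (intro mult_left_mono power_mono)
      show "norm (?b k n x - l x) \<le> 2 * B"
        using norm_triangle_ineq4[of "?b k n x" "l x"] aB[of "r n" x] lB[of x] by linarith
    qed auto
    have ib: "integrable lborel (\<lambda>x::real^'n. ?I R x * (2 * B)\<^sup>2)"
      using emeasure_ball_vol[of R "0::real^'n"] R by (intro integrable_mult_left) simp
    have ii: "integrable lborel (\<lambda>x. ?I R x * (norm (?b k n x - l x))\<^sup>2)" for n
      by (rule Bochner_Integration.integrable_bound[OF ib]) (use dom in auto)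
    have "I \<longlonglongrightarrow> (LINT x::real^'n|lborel. 0)"
      unfolding I_def
    proof (rule integral_dominated_convergence[where w="\<lambda>x. ?I R x * (2 * B)\<^sup>2"])
      show "AE x in lborel. (\<lambda>n. ?I R x * (norm (?b k n x - l x))\<^sup>2) \<longlonglongrightarrow> 0"
      proof (rule AE_I2)
        fix x
        have "(\<lambda>n. ?I R x * (norm (?b k n x - l x))\<^sup>2) \<longlonglongrightarrow> ?I R x * (norm (l x - l x))\<^sup>2"
          by (intro tendsto_intros l)
        then show "(\<lambda>n. ?I R x * (norm (?b k n x - l x))\<^sup>2) \<longlonglongrightarrow> 0" by simp
      qed
      show "AE x in lborel. norm (?I R x * (norm (?b k n x - l x))\<^sup>2) \<le> ?I R x * (2 * B)\<^sup>2" for n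
        using dom by simp
      show "integrable lborel (\<lambda>x::real^'n. ?I R x * (2 * B)\<^sup>2)" by (rule ib)
    qed auto
    then have "I \<longlonglongrightarrow> 0" by simp
    then obtain M where M: "\<And>n. n \<ge> M \<Longrightarrow> I n < e / 4" 
      using e by (metis (no_types, lifting) LIMSEQ_D[of I 0 "e/4"] abs_less_iff diff_zero real_norm_def divide_pos_pos zero_less_numeral)
    show ?thesis
    proof (intro exI[of _ M] allI impI)
      fix m n assume mn: "M \<le> m" "M \<le> n"
      have "(LINT x|lborel. ?I R x * (norm (avg (\<lambda>x. v (r m) x - v (r n) x) (\<sigma> k) x))\<^sup>2)
        \<le> (LINT x|lborel. 2 * (?I R x * (norm (?b k m x - l x))\<^sup>2) + 2 * (?I R x * (norm (?b k n x - l x))\<^sup>2))"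
      proof (intro integral_mono Bochner_Integration.integrable_add integrable_mult_right ii avg_square_integrable L2_diff v \<sigma> R)
        fix x
        have "(norm (avg (\<lambda>x. v (r m) x - v (r n) x) (\<sigma> k) x))\<^sup>2 \<le> 2 * (norm (?b k m x - l x))\<^sup>2 + 2 * (norm (?b k n x - l x))\<^sup>2"
          using norm_add_square_le[of "?b k m x - l x" "- (?b k n x - l x)"]
          by (simp add: avg_diff v \<sigma> norm_minus_commute)
        then have "?I R x * (norm (avg (\<lambda>x. v (r m) x - v (r n) x) (\<sigma> k) x))\<^sup>2
           \<le> ?I R x * (2 * (norm (?b k m x - l x))\<^sup>2 + 2 * (norm (?b k n x - l x))\<^sup>2)"
          by (rule mult_left_mono) simp
        then show "?I R x * (norm (avg (\<lambda>x. v (r m) x - v (r n) x) (\<sigma> k) x))\<^sup>2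
           \<le> 2 * (?I R x * (norm (?b k m x - l x))\<^sup>2) + 2 * (?I R x * (norm (?b k n x - l x))\<^sup>2)"
          by (simp add: algebra_simps)
      qed
      also have "\<dots> = 2 * I m + 2 * I n" by (simp add: I_def ii)
      also have "\<dots> < e" using M[OF mn(1)] M[OF mn(2)] by linarith
      finally show "(LINT x|lborel. ?I R x * (norm (avg (\<lambda>x. v (r m) x - v (r n) x) (\<sigma> k) x))\<^sup>2) < e" .
    qed
  qed
  have main: "\<exists>M. \<forall>m\<ge>M. \<forall>n\<ge>M. l2norm (\<lambda>x. v (r m) x - v (r n) x) < e" if e: "e > 0" for e
  proof -
    \<comment> \<open>The ball contributes less than \<open>2 * \<delta>\<close> and its complement
      at most \<open>4 * \<delta>\<close> to the squared norm, so a sixteenth of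
      \<open>e\<^sup>2\<close> leaves room.\<close>
    define \<delta> where "\<delta> = e\<^sup>2 / 16"
    have \<delta>: "\<delta> > 0" using e by (simp add: \<delta>_def)
    obtain R N where R: "R > 0" and N: "\<And>n. n \<ge> N \<Longrightarrow> (l2norm (v n))\<^sup>2 - ball_mass (v n) 0 R \<le> \<delta>"
      using tight[OF \<delta>] by (auto simp: eventually_sequentially)
    \<comment> \<open>A difference of two members has translation constant \<open>2 * K\<close>; the
      radius of the averages is made small for that constant.\<close>
    have "(\<lambda>k. 2 * (2 * K * \<sigma> k)\<^sup>2) \<longlonglongrightarrow> 2 * (2 * K * 0)\<^sup>2"
      unfolding \<sigma>_def by (intro tendsto_intros LIMSEQ_Suc[OF lim_1_over_n])
    then have "\<forall>\<^sub>F k in sequentially. 2 * (2 * K * \<sigma> k)\<^sup>2 < \<delta>" using \<delta> by (intro order_tendstoD(2)) auto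
    then obtain k where k: "2 * (2 * K * \<sigma> k)\<^sup>2 < \<delta>" by (auto simp: eventually_sequentially)
    define V where "V = ?vol (\<sigma> k)"
    have V: "V > 0" unfolding V_def by (rule ball_vol_pos[OF \<sigma>])
    obtain M where M: "\<And>m n. m \<ge> M \<Longrightarrow> n \<ge> M \<Longrightarrow>
       (LINT x|lborel. ?I R x * (norm (avg (\<lambda>x. v (r m) x - v (r n) x) (\<sigma> k) x))\<^sup>2) < \<delta> * V\<^sup>2 / 2"
      using ball_conv[of "\<delta> * V\<^sup>2 / 2" R k] \<delta> V R by auto
    show ?thesis
    proof (intro exI[of _ "max M N"] allI impI)
      fix m n assume mn: "max M N \<le> m" "max M N \<le> n"
      define w where "w x = v (r m) x - v (r n) x" for x
      have w: "w \<in> L2" unfolding w_def by (intro L2_diff v)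
      have wK: "l2norm (\<lambda>x. w (x + h) - w x) \<le> 2 * K * norm h" for h
      proof -
        have "l2norm (\<lambda>x. w (x + h) - w x) = l2norm (\<lambda>x. (v (r m) (x + h) - v (r m) x) - (v (r n) (x + h) - v (r n) x))"
          by (simp add: w_def algebra_simps)
        also have "\<dots> \<le> l2norm (\<lambda>x. v (r m) (x + h) - v (r m) x) + l2norm (\<lambda>x. v (r n) (x + h) - v (r n) x)"
          by (intro l2norm_triangle_diff L2_diff L2_translate v)
        also have "\<dots> \<le> 2 * K * norm h" using K(1)[of "r m" h] K(1)[of "r n" h] by linarith
        finally show ?thesis .
      qed
      have rr: "r m \<ge> N" "r n \<ge> N" using mn seq_suble[OF r, of m] seq_suble[OF r, of n] by linarith+
      have "ball_mass w 0 R \<le> 2 / V\<^sup>2 * (LINT x|lborel. ?I R x * (norm (avg w (\<sigma> k) x))\<^sup>2) + 2 * (2 * K * \<sigma> k)\<^sup>2"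
        unfolding V_def using K(2) by (intro local_Poincare w wK \<sigma> R) auto
      also have "2 / V\<^sup>2 * (LINT x|lborel. ?I R x * (norm (avg w (\<sigma> k) x))\<^sup>2) \<le> 2 / V\<^sup>2 * (\<delta> * V\<^sup>2 / 2)"
        unfolding w_def using M[of m n] mn by (intro mult_left_mono) auto
      also have "2 / V\<^sup>2 * (\<delta> * V\<^sup>2 / 2) = \<delta>" using V by simp
      finally have inner: "ball_mass w 0 R < 2 * \<delta>" using k by simp
      have "(l2norm w)\<^sup>2 - ball_mass w 0 R \<le> 2 * ((l2norm (v (r m)))\<^sup>2 - ball_mass (v (r m)) 0 R) + 2 * ((l2norm (v (r n)))\<^sup>2 - ball_mass (v (r n)) 0 R)"
      proof -
        have out: "(l2norm f)\<^sup>2 - ball_mass f 0 R = (LINT x|lborel. (norm (f x))\<^sup>2 - indicator (ball 0 R) x * (norm (f x))\<^sup>2)"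
          and outi: "integrable lborel (\<lambda>x. (norm (f x))\<^sup>2 - indicator (ball 0 R) x * (norm (f x))\<^sup>2)"
          if "f \<in> L2" for f :: "real^'n \<Rightarrow> 'b"
          unfolding l2norm_square ball_mass_def using L2_integrable[OF that] ball_mass_integrable[OF that] by auto
        have "(LINT x|lborel. (norm (w x))\<^sup>2 - indicator (ball 0 R) x * (norm (w x))\<^sup>2)
           \<le> (LINT x|lborel. 2 * ((norm (v (r m) x))\<^sup>2 - indicator (ball 0 R) x * (norm (v (r m) x))\<^sup>2) + 2 * ((norm (v (r n) x))\<^sup>2 - indicator (ball 0 R) x * (norm (v (r n) x))\<^sup>2))"
        proof (intro integral_mono Bochner_Integration.integrable_add integrable_mult_right outi w v)
          fix x
          show "(norm (w x))\<^sup>2 - indicator (ball 0 R) x * (norm (w x))\<^sup>2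
             \<le> 2 * ((norm (v (r m) x))\<^sup>2 - indicator (ball 0 R) x * (norm (v (r m) x))\<^sup>2) + 2 * ((norm (v (r n) x))\<^sup>2 - indicator (ball 0 R) x * (norm (v (r n) x))\<^sup>2)"
            using norm_add_square_le[of "v (r m) x" "- v (r n) x"] by (cases "x \<in> ball 0 R") (auto simp: w_def)
        qed
        also have "\<dots> = 2 * (LINT x|lborel. (norm (v (r m) x))\<^sup>2 - indicator (ball 0 R) x * (norm (v (r m) x))\<^sup>2) + 2 * (LINT x|lborel. (norm (v (r n) x))\<^sup>2 - indicator (ball 0 R) x * (norm (v (r n) x))\<^sup>2)"
          by (subst Bochner_Integration.integral_add[OF integrable_mult_right[OF outi[OF v]] integrable_mult_right[OF outi[OF v]]]) (simp only: integral_mult_right_zero)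
        finally show ?thesis by (simp only: out w v)
      qed
      also have "\<dots> \<le> 2 * \<delta> + 2 * \<delta>" by (intro add_mono mult_left_mono N rr) auto
      finally have "(l2norm w)\<^sup>2 < 6 * \<delta>" using inner by linarith
      also have "\<dots> < e\<^sup>2" using e by (simp add: \<delta>_def)
      finally have "l2norm w < e" using e by (intro power2_less_imp_less[of "l2norm w" e]) auto
      then show "l2norm (\<lambda>x. v (r m) x - v (r n) x) < e" by (simp add: w_def[abs_def])
    qed
  qed
  show thesis by (rule that[OF r]) (rule main)
qed

section \<open>Compactness of minimizing sequences\<close>

lemma l2norm_parallelogram:
  fixes f g :: "real^'n \<Rightarrow> 'b::euclidean_space"
  assumes "f \<in> L2" "g \<in> L2"
  shows "(l2norm (\<lambda>x. f x - g x))\<^sup>2 + (l2norm (\<lambda>x. f x + g x))\<^sup>2 = 2 * (l2norm f)\<^sup>2 + 2 * (l2norm g)\<^sup>2"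
proof -
  have pt: "(norm (a - b))\<^sup>2 + (norm (a + b))\<^sup>2 = 2 * (norm a)\<^sup>2 + 2 * (norm b)\<^sup>2" for a b :: 'b
    by (simp add: power2_norm_eq_inner inner_simps inner_commute)
  have "(l2norm (\<lambda>x. f x - g x))\<^sup>2 + (l2norm (\<lambda>x. f x + g x))\<^sup>2 = (LINT x|lborel. (norm (f x - g x))\<^sup>2 + (norm (f x + g x))\<^sup>2)"
    unfolding l2norm_square by (intro Bochner_Integration.integral_add[symmetric] L2_integrable L2_diff L2_add assms)
  also have "\<dots> = 2 * (l2norm f)\<^sup>2 + 2 * (l2norm g)\<^sup>2"
    unfolding pt l2norm_square by (simp add: L2_integrable assms)
  finally show ?thesis .
qed

lemma L2_tendsto_integral:
  fixes f :: "nat \<Rightarrow> real^'n \<Rightarrow> 'b::euclidean_space"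
  assumes "\<And>n. f n \<in> L2" "g \<in> L2" "(\<lambda>n. l2norm (\<lambda>x. f n x - g x)) \<longlonglongrightarrow> 0" and \<psi>: "test_function \<psi>"
  shows "(\<lambda>n. LINT x|lborel. \<psi> x *\<^sub>R f n x) \<longlonglongrightarrow> (LINT x|lborel. \<psi> x *\<^sub>R g x)"
proof (rule LIM_zero_cancel, rule tendsto_norm_zero_cancel, rule tendsto_sandwich[OF _ _ tendsto_const])
  note [measurable] = test_function_measurable[OF \<psi>] L2_measurable[OF assms(1)] L2_measurable[OF assms(2)]
  show "\<forall>\<^sub>F n in sequentially. norm ((LINT x|lborel. \<psi> x *\<^sub>R f n x) - (LINT x|lborel. \<psi> x *\<^sub>R g x)) \<le> l2norm \<psi> * l2norm (\<lambda>x. f n x - g x)"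
  proof (rule always_eventually, rule allI)
    fix n
    have "(LINT x|lborel. \<psi> x *\<^sub>R f n x) - (LINT x|lborel. \<psi> x *\<^sub>R g x) = (LINT x|lborel. \<psi> x *\<^sub>R (f n x - g x))"
      unfolding scaleR_diff_right
      by (intro Bochner_Integration.integral_diff[symmetric] test_function_mult_integrable \<psi> assms)
    also have "norm \<dots> \<le> l2norm \<psi> * l2norm (\<lambda>x. f n x - g x)"
      by (rule L2_bilinear_le[OF test_function_L2[OF \<psi>] L2_diff[OF assms(1,2)]]) auto
    finally show "norm ((LINT x|lborel. \<psi> x *\<^sub>R f n x) - (LINT x|lborel. \<psi> x *\<^sub>R g x)) \<le> l2norm \<psi> * l2norm (\<lambda>x. f n x - g x)" .
  qed
  show "(\<lambda>n. l2norm \<psi> * l2norm (\<lambda>x. f n x - g x)) \<longlonglongrightarrow> 0"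
    using tendsto_mult[OF tendsto_const[of "l2norm \<psi>"] assms(3)] by simp
qed simp

lemma L2_tendsto_l2norm:
  assumes "\<And>n. f n \<in> L2" "g \<in> L2" "(\<lambda>n. l2norm (\<lambda>x. f n x - g x)) \<longlonglongrightarrow> 0"
  shows "(\<lambda>n. l2norm (f n)) \<longlonglongrightarrow> l2norm g"
proof (rule LIM_zero_cancel, rule tendsto_rabs_zero_cancel, rule tendsto_sandwich[OF _ _ tendsto_const assms(3)])
  show "\<forall>\<^sub>F n in sequentially. \<bar>l2norm (f n) - l2norm g\<bar> \<le> l2norm (\<lambda>x. f n x - g x)"
    by (intro always_eventually allI l2norm_diff_le assms)
qed simp

text \<open>Tested against a fixed function, both sides of the defining identity are continuous in
  \<open>L2\<close>.\<close>

lemma has_weak_gradient_limit: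
  assumes U: "\<And>n. U n \<in> L2" "\<And>n. g n \<in> L2" "\<And>n. has_weak_gradient (U n) (g n)"
    and v: "v \<in> L2" "(\<lambda>n. l2norm (\<lambda>x. U n x - v x)) \<longlonglongrightarrow> 0"
    and h: "h \<in> L2" "(\<lambda>n. l2norm (\<lambda>x. g n x - h x)) \<longlonglongrightarrow> 0"
  shows "has_weak_gradient v h"
  unfolding has_weak_gradient_def
proof (intro allI impI)
  fix \<phi> :: "real^'a \<Rightarrow> real" and i assume \<phi>: "test_function \<phi>"
  have hi: "(\<lambda>n. l2norm (\<lambda>x. g n x $ i - h x $ i)) \<longlonglongrightarrow> 0"
  proof (rule tendsto_sandwich[OF _ _ tendsto_const h(2)])
    show "\<forall>\<^sub>F n in sequentially. l2norm (\<lambda>x. g n x $ i - h x $ i) \<le> l2norm (\<lambda>x. g n x - h x)"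
    proof (intro always_eventually allI)
      fix n
      have "l2norm (\<lambda>x. g n x $ i - h x $ i) \<le> 1 * l2norm (\<lambda>x. g n x - h x)"
        by (rule l2norm_dominated[OF L2_diff[OF L2_nth[OF U(2)] L2_nth[OF h(1)]] L2_diff[OF U(2) h(1)]])
           (use Finite_Cartesian_Product.norm_nth_le[of "g n _ - h _" i] in auto)
      then show "l2norm (\<lambda>x. g n x $ i - h x $ i) \<le> l2norm (\<lambda>x. g n x - h x)" by simp
    qed
  qed simp
  have "(\<lambda>n. LINT x|lborel. frechet_derivative \<phi> (at x) (axis i 1) *\<^sub>R U n x) \<longlonglongrightarrow> (LINT x|lborel. frechet_derivative \<phi> (at x) (axis i 1) *\<^sub>R v x)"
    by (rule L2_tendsto_integral[OF U(1) v test_function_derivative[OF \<phi>]])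
  then have l: "(\<lambda>n. - (LINT x|lborel. \<phi> x *\<^sub>R (g n x $ i))) \<longlonglongrightarrow> (LINT x|lborel. frechet_derivative \<phi> (at x) (axis i 1) *\<^sub>R v x)"
    using U(3) \<phi> by (simp add: has_weak_gradient_def)
  have "(\<lambda>n. - (LINT x|lborel. \<phi> x *\<^sub>R (g n x $ i))) \<longlonglongrightarrow> - (LINT x|lborel. \<phi> x *\<^sub>R (h x $ i))"
    by (intro tendsto_minus L2_tendsto_integral[OF L2_nth[OF U(2)] L2_nth[OF h(1)] hi \<phi>])
  from LIMSEQ_unique[OF l this]
  show "(LINT x|lborel. frechet_derivative \<phi> (at x) (axis i 1) *\<^sub>R v x) = - (LINT x|lborel. \<phi> x *\<^sub>R (h x $ i))" .
qed

context riesz_pair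
begin

lemma minimizing_gradient_bound:
  assumes c: "c > 0" and u: "\<And>n. u n \<in> S c" and lim: "(\<lambda>n. E (u n)) \<longlonglongrightarrow> m c"
  obtains K where "K \<ge> 0" "\<And>n. G (u n) \<le> K"
proof -
  obtain B where B: "\<And>u. u \<in> S c \<Longrightarrow> (G u)\<^sup>2 \<le> 4 * E u + B" using energy_coercive[OF c] by blast
  have "Bseq (\<lambda>n. E (u n))" using lim by (intro convergent_imp_Bseq convergentI)
  then obtain Q where Q: "\<And>n. \<bar>E (u n)\<bar> \<le> Q" by (auto simp: Bseq_def)
  show thesis
  proof (rule that[of "sqrt \<bar>4 * Q + B\<bar>"])
    fix n
    have "(G (u n))\<^sup>2 \<le> \<bar>4 * Q + B\<bar>" using B[OF u[of n]] Q[of n] by linarith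
    then show "G (u n) \<le> sqrt \<bar>4 * Q + B\<bar>" by (rule real_le_rsqrt)
  qed simp
qed

text \<open>If every ball of radius \<open>R\<close> had at most the fraction
  \<open>1 - \<delta>\<close> of the mass, \<open>cutoff_energy_inequality\<close> would keep the
  energy a fixed distance above \<open>m c\<close>.\<close>

lemma minimizing_concentrates:
  assumes c: "c > 0" and m: "m c < 0" and u: "\<And>n. u n \<in> S c" and lim: "(\<lambda>n. E (u n)) \<longlonglongrightarrow> m c"
    and \<delta>: "0 < \<delta>" "\<delta> \<le> 1"
  shows "\<exists>R>0. \<forall>\<^sub>F n in sequentially. \<exists>x. (1 - \<delta>) * c < ball_mass (u n) x R"
proof -
  obtain K where K: "K \<ge> 0" "\<And>n. G (u n) \<le> K" using minimizing_gradient_bound[OF c u lim] by blast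
  obtain C where C: "C > 0" and ineq:
    "\<And>u R \<eta> M. u \<in> S c \<Longrightarrow> R > 0 \<Longrightarrow> \<eta> > 0 \<Longrightarrow> M \<ge> 0 \<Longrightarrow> (\<And>x. ball_mass u x R \<le> M) \<Longrightarrow>
      - 4 * E u \<le> C * R powr (- \<gamma>1) * c\<^sup>2 + 2 * \<eta> * (G u)\<^sup>2 + 2 * (1 + 1 / \<eta>) * (c * (C / R\<^sup>2)) + 4 * (- m c) * M / c"
    using cutoff_energy_inequality[OF c m] by blast
  \<comment> \<open>Under the contrary assumption the mass term is \<open>- 4 * m c - 16 * e\<close>
    and the remaining errors total at most \<open>2 * e\<close>, while the left-hand side exceeds
    \<open>- 4 * m c - 4 * e\<close>.\<close>
  define e where "e = (- m c) * \<delta> / 4"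
  have e: "e > 0" using m \<delta> by (simp add: e_def mult_neg_pos)
  define \<eta> where "\<eta> = e / (2 * K\<^sup>2 + 1)"
  have K1: "2 * K\<^sup>2 + 1 > 0" by (simp add: add_nonneg_pos)
  have \<eta>: "\<eta> > 0" using e K1 by (simp add: \<eta>_def)
  have \<eta>K: "2 * \<eta> * K\<^sup>2 \<le> e" using e K1 by (simp add: \<eta>_def field_simps)
  have "((\<lambda>R. C * R powr (- \<gamma>1) * c\<^sup>2 + 2 * (1 + 1 / \<eta>) * (c * (C / R\<^sup>2))) \<longlongrightarrow> C * 0 * c\<^sup>2 + 2 * (1 + 1 / \<eta>) * (c * 0)) at_top"
    using \<gamma>2 \<gamma>21
    by (intro tendsto_intros tendsto_neg_powr filterlim_ident tendsto_divide_0[OF tendsto_const]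
        filterlim_at_top_imp_at_infinity filterlim_pow_at_top) auto
  then have "\<forall>\<^sub>F R in at_top. C * R powr (- \<gamma>1) * c\<^sup>2 + 2 * (1 + 1 / \<eta>) * (c * (C / R\<^sup>2)) < e"
    using e by (intro order_tendstoD(2)) auto
  then have "\<forall>\<^sub>F R in at_top. C * R powr (- \<gamma>1) * c\<^sup>2 + 2 * (1 + 1 / \<eta>) * (c * (C / R\<^sup>2)) < e \<and> R > 0"
    using eventually_gt_at_top[of "0::real"] by (rule eventually_conj)
  from eventually_happens'[OF trivial_limit_at_top_linorder this]
  obtain R where R: "C * R powr (- \<gamma>1) * c\<^sup>2 + 2 * (1 + 1 / \<eta>) * (c * (C / R\<^sup>2)) < e" "R > 0" by blast
  have "\<forall>\<^sub>F n in sequentially. E (u n) < m c + e"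
    using lim e by (intro order_tendstoD(2)) auto
  then have "\<forall>\<^sub>F n in sequentially. \<exists>x. (1 - \<delta>) * c < ball_mass (u n) x R"
  proof eventually_elim
    case (elim n)
    show ?case
    proof (rule ccontr)
      assume "\<not> ?case"
      then have *: "ball_mass (u n) x R \<le> (1 - \<delta>) * c" for x by (auto simp: not_less)
      have "0 \<le> (1 - \<delta>) * c" using \<delta> c by simp
      from ineq[OF u R(2) \<eta> this *]
      have "- 4 * E (u n) \<le> C * R powr (- \<gamma>1) * c\<^sup>2 + 2 * \<eta> * (G (u n))\<^sup>2 + 2 * (1 + 1 / \<eta>) * (c * (C / R\<^sup>2)) + 4 * (- m c) * ((1 - \<delta>) * c) / c" .
      also have "4 * (- m c) * ((1 - \<delta>) * c) / c = 4 * (- m c) * (1 - \<delta>)" using c by simp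
      also have "\<dots> = - 4 * m c - 16 * e" by (simp add: e_def algebra_simps)
      also have "2 * \<eta> * (G (u n))\<^sup>2 \<le> 2 * \<eta> * K\<^sup>2" using \<eta> K(2) by (intro mult_left_mono power_mono) auto
      finally show False using elim R(1) \<eta>K e by linarith
    qed
  qed
  with R(2) show ?thesis by blast
qed

text \<open>Two balls that each carry more than half of the mass must meet. The centres are
  therefore fixed once, for the fraction 2/3, and a ball with a larger fraction lies in an enlarged
  ball around the same centre.\<close>

lemma minimizing_tight:
  assumes c: "c > 0" and m: "m c < 0" and u: "\<And>n. u n \<in> S c" and lim: "(\<lambda>n. E (u n)) \<longlonglongrightarrow> m c"
  obtains y where "\<And>\<delta>. \<delta> > 0 \<Longrightarrow> \<exists>R>0. \<forall>\<^sub>F n in sequentially. c - ball_mass (u n) (y n) R \<le> \<delta>"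
proof -
  have uL: "u n \<in> L2" and uc: "(l2norm (u n))\<^sup>2 = c" for n using u[of n] by (auto simp: mass_sphere_iff H1_L2)
  obtain R0 where R0: "R0 > 0" "\<forall>\<^sub>F n in sequentially. \<exists>x. (1 - 1/3) * c < ball_mass (u n) x R0"
    using minimizing_concentrates[OF c m u lim, of "1/3"] by auto
  \<comment> \<open>The choice is meaningful for large \<open>n\<close> only; every conclusion drawn
    from it is eventual.\<close>
  define y where "y n = (SOME x. (1 - 1/3) * c < ball_mass (u n) x R0)" for n
  have y: "\<forall>\<^sub>F n in sequentially. (1 - 1/3) * c < ball_mass (u n) (y n) R0"
    using R0(2) by eventually_elim (unfold y_def, rule someI_ex)
  show thesis
  proof (rule that[of y])
    fix \<delta> :: real assume \<delta>: "\<delta> > 0"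
    \<comment> \<open>The cap 1/3 makes the balls intersect, and \<open>\<delta> / c\<close>
      converts a fraction of the mass into \<delta>.\<close>
    define \<delta>' where "\<delta>' = min (1/3) (\<delta> / c)"
    have \<delta>': "0 < \<delta>'" "\<delta>' \<le> 1/3" "\<delta>' * c \<le> \<delta>" using \<delta> c by (auto simp: \<delta>'_def min_def field_simps)
    obtain R where R: "R > 0" "\<forall>\<^sub>F n in sequentially. \<exists>x. (1 - \<delta>') * c < ball_mass (u n) x R"
      using minimizing_concentrates[OF c m u lim \<delta>'(1)] \<delta>'(2) by auto
    have "\<forall>\<^sub>F n in sequentially. c - ball_mass (u n) (y n) (R0 + 2 * R) \<le> \<delta>"
      using y R(2)
    proof eventually_elim
      case (elim n)
      then obtain x where x: "(1 - \<delta>') * c < ball_mass (u n) x R" by blast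
      have "ball (y n) R0 \<inter> ball x R \<noteq> {}"
      proof
        assume "ball (y n) R0 \<inter> ball x R = {}"
        from ball_mass_disjoint[OF uL this]
        have "ball_mass (u n) (y n) R0 + ball_mass (u n) x R \<le> c" by (simp add: uc)
        moreover have "(1 - 1/3) * c \<le> (1 - \<delta>') * c" using \<delta>' c by (intro mult_right_mono) auto
        ultimately show False using x elim(1) c by (simp add: algebra_simps)
      qed
      then obtain z where z: "dist (y n) z < R0" "dist x z < R" by auto
      have "ball x R \<subseteq> ball (y n) (R0 + 2 * R)"
      proof
        fix t assume "t \<in> ball x R"
        then have "dist x t < R" by simp
        moreover have "dist (y n) t \<le> dist (y n) z + dist x z + dist x t"
          using dist_triangle[of "y n" t z] dist_triangle[of z t x] by (simp add: dist_commute)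
        ultimately show "t \<in> ball (y n) (R0 + 2 * R)" using z by simp
      qed
      then have "ball_mass (u n) x R \<le> ball_mass (u n) (y n) (R0 + 2 * R)" by (rule ball_mass_mono[OF uL])
      then show ?case using x \<delta>'(3) by (simp add: algebra_simps)
    qed
    then show "\<exists>R>0. \<forall>\<^sub>F n in sequentially. c - ball_mass (u n) (y n) R \<le> \<delta>"
      using R0(1) R(1) by (intro exI[of _ "R0 + 2 * R"]) simp
  qed
qed

lemma translate_mass_sphere:
  assumes "u \<in> S c" shows "(\<lambda>x. u (x + y)) \<in> S c" "E (\<lambda>x. u (x + y)) = E u" "G (\<lambda>x. u (x + y)) = G u"
  using assms weak_gradient_translate[of u y] l2norm_translate[OF H1_L2, of u y]
  by (auto simp: mass_sphere_iff energy_altdef D_energy_translate L2_measurable H1_L2)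

text \<open>Combine the parallelogram law for the gradients with \<open>m c \<le> E\<close> at the midpoint of \<open>u\<close> and \<open>v\<close>, whose
  mass is at most \<open>c\<close>.\<close>

lemma gradient_distance_bound:
  assumes c: "c > 0" and m: "m c < 0" and K: "K \<ge> 0"
  obtains B where "B \<ge> 0" "\<And>u v. u \<in> S c \<Longrightarrow> v \<in> S c \<Longrightarrow> G u \<le> K \<Longrightarrow> G v \<le> K \<Longrightarrow>
    (l2norm (\<lambda>x. weak_gradient u x - weak_gradient v x))\<^sup>2 \<le> 4 * (E u - m c) + 4 * (E v - m c) + B * l2norm (\<lambda>x. u x - v x)"
proof -
  \<comment> \<open>Between the midpoint and an endpoint each double integral changes by at most
    \<open>2 * P \<gamma> c K * sqrt c\<close> times the distance of \<open>u\<close> and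
    \<open>v\<close>; a quarter of the two changes together gives this \<open>B\<close>.\<close>
  define B where "B = (P \<gamma>1 c K + P \<gamma>2 c K) * sqrt c / 2"
  have P0: "P \<gamma>1 c K \<ge> 0" "P \<gamma>2 c K \<ge> 0" using CR(1) c by (simp_all add: less_imp_le)
  have B0: "B \<ge> 0" using P0 c by (simp add: B_def)
  have main: "(l2norm (\<lambda>x. weak_gradient u x - weak_gradient v x))\<^sup>2 \<le> 4 * (E u - m c) + 4 * (E v - m c) + (8 * B) * l2norm (\<lambda>x. u x - v x)"
    if uS: "u \<in> S c" and vS: "v \<in> S c" and uK: "G u \<le> K" and vK: "G v \<le> K" for u v
  proof -
    have u: "u \<in> H1" "(l2norm u)\<^sup>2 = c" and v: "v \<in> H1" "(l2norm v)\<^sup>2 = c" using uS vS by (auto simp: mass_sphere_iff)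
    note uL = H1_L2[OF u(1)] and vL = H1_L2[OF v(1)]
    define w where "w x = (1/2) *\<^sub>R (u x + v x)" for x
    define d where "d = l2norm (\<lambda>x. u x - v x)"
    have un: "l2norm u = sqrt c" "l2norm v = sqrt c" using u(2) v(2) by (metis l2norm_nonneg real_sqrt_unique)+
    have wH: "w \<in> H1" unfolding w_def[abs_def] by (intro weak_gradient_scaleR weak_gradient_add u v)
    note wL = H1_L2[OF wH]
    have wG: "G w = l2norm (\<lambda>x. weak_gradient u x + weak_gradient v x) / 2"
      unfolding w_def[abs_def] using weak_gradient_scaleR(2)[OF weak_gradient_add(1)[OF u(1) v(1)], of "1/2"] weak_gradient_add(2)[OF u(1) v(1)] by simp
    have "l2norm (\<lambda>x. weak_gradient u x + weak_gradient v x) \<le> G u + G v"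
      by (intro l2norm_triangle H1_weak_gradient u v)
    then have wK: "G w \<le> K" using uK vK wG by simp
    have "l2norm w = l2norm (\<lambda>x. u x + v x) / 2" unfolding w_def[abs_def] using l2norm_scaleR[of "1/2" "\<lambda>x. u x + v x"] by simp
    then have wn: "l2norm w \<le> sqrt c" using l2norm_triangle[OF uL vL] un by simp
    then have wc: "(l2norm w)\<^sup>2 \<le> c" using power_mono[OF wn l2norm_nonneg, of 2] c by simp
    have "((l2norm w)\<^sup>2 / c)\<^sup>2 \<le> 1" using wc c by (intro power_le_one) auto
    then have "m c \<le> ((l2norm w)\<^sup>2 / c)\<^sup>2 * m c" using m by (simp add: mult_le_cancel_right1)
    also have "\<dots> \<le> E w" by (rule energy_ge_square[OF wH wc c])
    finally have Ew: "m c \<le> E w" .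
    have Dd: "\<bar>D_energy \<gamma> w - D_energy \<gamma> z\<bar> \<le> 2 * P \<gamma> c K * sqrt c * d"
      if g: "\<gamma> \<in> {\<gamma>1, \<gamma>2}" and z: "z = u \<or> z = v" for \<gamma> z
    proof -
      have zz: "z \<in> H1" "(l2norm z)\<^sup>2 \<le> c" "G z \<le> K" "l2norm z = sqrt c" using z u v uK vK un by auto
      have "\<bar>D_energy \<gamma> w - D_energy \<gamma> z\<bar> \<le> (P \<gamma> c K + P \<gamma> c K) * (l2norm (\<lambda>x. w x - z x) * (l2norm w + l2norm z))"
        by (intro D_energy_diff_le H1_L2 wH zz P g wc wK)
      also have "\<dots> \<le> (P \<gamma> c K + P \<gamma> c K) * (d / 2 * (2 * sqrt c))"
      proof (intro mult_left_mono mult_mono)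
        have "w x - u x = (1/2) *\<^sub>R (v x - u x)" "w x - v x = (1/2) *\<^sub>R (u x - v x)" for x
          by (simp_all add: w_def scaleR_conv_of_real field_simps)
        then have "l2norm (\<lambda>x. w x - u x) = d / 2" "l2norm (\<lambda>x. w x - v x) = d / 2"
          using l2norm_scaleR[of "1/2" "\<lambda>x. v x - u x"] l2norm_scaleR[of "1/2" "\<lambda>x. u x - v x"]
          by (simp_all add: d_def l2norm_minus_commute[of v u])
        then show "l2norm (\<lambda>x. w x - z x) \<le> d / 2" using z by auto
        show "l2norm w + l2norm z \<le> 2 * sqrt c" using wn zz by simp
        show "0 \<le> P \<gamma> c K + P \<gamma> c K" using P0 g by auto
      qed (auto simp: d_def)
      finally show ?thesis by (simp add: mult_ac)
    qed
    \<comment> \<open>Since \<open>E w \<ge> m c\<close>, the gradient of the midpoint cannot be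
      much smaller than those at the ends. Four times this inequality, added for \<open>u\<close>
      and \<open>v\<close>, meets the parallelogram law and produces the factor 8 of
      \<open>B\<close>.\<close>
    have *: "(G z)\<^sup>2 / 2 - E z + m c - B * d \<le> (G w)\<^sup>2 / 2 " if z: "z = u \<or> z = v" for z
    proof -
      have "2 * P \<gamma>1 c K * sqrt c * d + 2 * P \<gamma>2 c K * sqrt c * d = 4 * B * d" by (simp add: B_def algebra_simps)
      moreover have "0 \<le> B * d" using B0 by (simp add: d_def)
      ultimately show ?thesis
        using Dd[of \<gamma>1 z] Dd[of \<gamma>2 z] z Ew unfolding energy_altdef by (simp add: abs_le_iff)
    qed
    have "(l2norm (\<lambda>x. weak_gradient u x - weak_gradient v x))\<^sup>2 = 2 * (G u)\<^sup>2 + 2 * (G v)\<^sup>2 - 4 * (G w)\<^sup>2"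
      using l2norm_parallelogram[OF H1_weak_gradient(1)[OF u(1)] H1_weak_gradient(1)[OF v(1)]]
      by (simp add: wG power_divide)
    also have "\<dots> \<le> 4 * (E u - m c) + 4 * (E v - m c) + (8 * B) * d"
      using *[of u] *[of v] by simp
    finally show ?thesis by (simp only: d_def)
  qed
  show thesis by (rule that[of "8 * B"]) (use B0 main in auto)
qed

text \<open>Once values and gradients are Cauchy in \<open>L2\<close>, completeness yields both
  limits, and every term of the energy converges. The limit is recorded as a minimizer so that
  existence follows by applying this to any one minimizing sequence.\<close>

lemma minimizing_sequence_compact:
  assumes c: "c > 0" and m: "m c < 0" and u: "\<And>n. u n \<in> S c" and lim: "(\<lambda>n. E (u n)) \<longlonglongrightarrow> m c"
  shows "\<exists>y (r :: nat \<Rightarrow> nat) v. strict_mono r \<and> converges_in_H1 ((\<lambda>n x. u n (x + y n)) \<circ> r) v \<and> v \<in> S c \<and> E v = m c"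
proof -
  obtain y where y: "\<And>\<delta>. \<delta> > 0 \<Longrightarrow> \<exists>R>0. \<forall>\<^sub>F n in sequentially. c - ball_mass (u n) (y n) R \<le> \<delta>"
    using minimizing_tight[OF c m u lim] by blast
  obtain K where K: "K \<ge> 0" "\<And>n. G (u n) \<le> K" using minimizing_gradient_bound[OF c u lim] by blast
  define w where "w n x = u n (x + y n)" for n x
  have wS: "w n \<in> S c" and wE: "E (w n) = E (u n)" and wG: "G (w n) \<le> K" for n
    unfolding w_def using translate_mass_sphere[OF u, of n "y n"] K(2)[of n] by auto
  have wH: "w n \<in> H1" and wc: "(l2norm (w n))\<^sup>2 = c" for n using wS[of n] by (auto simp: mass_sphere_iff)
  note wL = H1_L2[OF wH]
  have wn: "l2norm (w n) = sqrt c" for n using wc[of n] by (metis l2norm_nonneg real_sqrt_unique)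
  have uL: "u n \<in> L2" for n using u[of n] by (auto simp: mass_sphere_iff H1_L2)
  have wtr: "l2norm (\<lambda>x. w n (x + h) - w n x) \<le> K * norm h" for n h
    by (rule order_trans[OF H1_translation_estimate[OF wH] mult_right_mono[OF wG]]) simp
  have tight: "\<exists>R>0. \<forall>\<^sub>F n in sequentially. (l2norm (w n))\<^sup>2 - ball_mass (w n) 0 R \<le> \<delta>" if "\<delta> > 0" for \<delta>
    unfolding wc w_def using y[OF that] by (simp add: ball_mass_translate[OF uL])
  obtain r :: "nat \<Rightarrow> nat" where r: "strict_mono r" and Cau: "\<And>e. e > 0 \<Longrightarrow> \<exists>M. \<forall>m\<ge>M. \<forall>n\<ge>M. l2norm (\<lambda>x. w (r m) x - w (r n) x) < e"
    by (rule L2_precompact[of w "sqrt c" K, OF wL _ wtr K(1) tight]) (auto simp: wn)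
  define U where "U n = w (r n)" for n
  define g where "g n = weak_gradient (U n)" for n
  have UH: "U n \<in> H1" and UL: "U n \<in> L2" and US: "U n \<in> S c" and UG: "G (U n) \<le> K" and Uc: "(l2norm (U n))\<^sup>2 = c" for n
    by (simp_all add: U_def wH wL wS wG wc)
  have gL: "g n \<in> L2" and gw: "has_weak_gradient (U n) (g n)" for n
    unfolding g_def by (rule H1_weak_gradient[OF UH])+
  have UE: "(\<lambda>n. E (U n)) \<longlonglongrightarrow> m c"
    using LIMSEQ_subseq_LIMSEQ[OF lim r] by (simp add: U_def wE o_def)
  obtain v where v: "v \<in> L2" "(\<lambda>n. l2norm (\<lambda>x. U n x - v x)) \<longlonglongrightarrow> 0"
    using L2_complete[of U, OF UL] Cau unfolding U_def by blast
  obtain B where B: "B \<ge> 0" and gB: "\<And>u v. u \<in> S c \<Longrightarrow> v \<in> S c \<Longrightarrow> G u \<le> K \<Longrightarrow> G v \<le> K \<Longrightarrow>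
    (l2norm (\<lambda>x. weak_gradient u x - weak_gradient v x))\<^sup>2 \<le> 4 * (E u - m c) + 4 * (E v - m c) + B * l2norm (\<lambda>x. u x - v x)"
    using gradient_distance_bound[OF c m K(1)] by blast
  have "\<exists>M. \<forall>i\<ge>M. \<forall>n\<ge>M. l2norm (\<lambda>x. g i x - g n x) < e" if e: "e > 0" for e
  proof -
    \<comment> \<open>Two energy excesses weighted by 4 and a distance weighted by \<open>B\<close>
      sum to \<open>(8 + B) * e'\<close>; the further 1 makes the comparison with
      \<open>e\<^sup>2\<close> strict.\<close>
    define e' where "e' = e\<^sup>2 / (8 + B + 1)"
    have e': "e' > 0" using e B by (simp add: e'_def)
    have "\<forall>\<^sub>F n in sequentially. E (U n) < m c + e'" using UE e' by (intro order_tendstoD(2)) auto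
    then obtain M1 where M1: "\<And>n. n \<ge> M1 \<Longrightarrow> E (U n) < m c + e'" by (auto simp: eventually_sequentially)
    obtain M2 where M2: "\<And>i n. i \<ge> M2 \<Longrightarrow> n \<ge> M2 \<Longrightarrow> l2norm (\<lambda>x. U i x - U n x) < e'"
      using Cau[OF e'] unfolding U_def by blast
    show ?thesis
    proof (intro exI[of _ "max M1 M2"] allI impI)
      fix i n assume "max M1 M2 \<le> i" "max M1 M2 \<le> n"
      then have in1: "i \<ge> M1" "n \<ge> M1" "i \<ge> M2" "n \<ge> M2" by auto
      have "(l2norm (\<lambda>x. g i x - g n x))\<^sup>2 \<le> 4 * (E (U i) - m c) + 4 * (E (U n) - m c) + B * l2norm (\<lambda>x. U i x - U n x)"
        unfolding g_def by (rule gB[OF US US UG UG])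
      also have "\<dots> \<le> 4 * e' + 4 * e' + B * e'"
        using M1[OF in1(1)] M1[OF in1(2)] M2[OF in1(3,4)] B by (intro add_mono mult_left_mono) auto
      also have "\<dots> < (8 + B + 1) * e'" using e' by (simp add: algebra_simps)
      also have "\<dots> = e\<^sup>2" using B by (simp add: e'_def)
      finally show "l2norm (\<lambda>x. g i x - g n x) < e" using e by (intro power2_less_imp_less[of "l2norm (\<lambda>x. g i x - g n x)" e]) auto
    qed
  qed
  then obtain h where h: "h \<in> L2" "(\<lambda>n. l2norm (\<lambda>x. g n x - h x)) \<longlonglongrightarrow> 0"
    using L2_complete[of g, OF gL] by blast
  have vh: "has_weak_gradient v h" by (rule has_weak_gradient_limit[OF UL gL gw v h])
  have vH: "v \<in> H1" by (rule H1_I[OF v(1) h(1) vh])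
  have vG: "G v = l2norm h" by (rule weak_gradient_l2norm[OF h(1) vh])
  have lnorm: "(\<lambda>n. l2norm (U n)) \<longlonglongrightarrow> l2norm v" by (rule L2_tendsto_l2norm[OF UL v])
  then have "(\<lambda>n::nat. sqrt c) \<longlonglongrightarrow> l2norm v" by (simp add: U_def wn)
  then have vn: "l2norm v = sqrt c" by (simp add: LIMSEQ_const_iff)
  then have vc: "(l2norm v)\<^sup>2 = c" using c by simp
  have gnorm: "(\<lambda>n. G (U n)) \<longlonglongrightarrow> G v"
    unfolding vG using L2_tendsto_l2norm[OF gL h] by (simp add: g_def)
  have vK: "G v \<le> K" by (rule Lim_bounded[OF gnorm, of 0]) (use UG in auto)
  have Dlim: "(\<lambda>n. D_energy \<gamma> (U n)) \<longlonglongrightarrow> D_energy \<gamma> v" if g: "\<gamma> \<in> {\<gamma>1, \<gamma>2}" for \<gamma>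
  proof (rule LIM_zero_cancel, rule tendsto_rabs_zero_cancel, rule tendsto_sandwich[OF _ _ tendsto_const])
    show "\<forall>\<^sub>F n in sequentially. \<bar>D_energy \<gamma> (U n) - D_energy \<gamma> v\<bar> \<le> (P \<gamma> c K + P \<gamma> c K) * (l2norm (\<lambda>x. U n x - v x) * (sqrt c + sqrt c))"
    proof (intro always_eventually allI)
      fix n
      have "\<bar>D_energy \<gamma> (U n) - D_energy \<gamma> v\<bar> \<le> (P \<gamma> c K + P \<gamma> c K) * (l2norm (\<lambda>x. U n x - v x) * (l2norm (U n) + l2norm v))"
        by (rule D_energy_diff_le[OF UL P[OF g UH _ UG] v(1) P[OF g vH _ vK]]) (simp_all add: Uc vc)
      then show "\<bar>D_energy \<gamma> (U n) - D_energy \<gamma> v\<bar> \<le> (P \<gamma> c K + P \<gamma> c K) * (l2norm (\<lambda>x. U n x - v x) * (sqrt c + sqrt c))"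
        by (simp add: U_def wn vn)
    qed
    have "(\<lambda>n. (P \<gamma> c K + P \<gamma> c K) * (l2norm (\<lambda>x. U n x - v x) * (sqrt c + sqrt c))) \<longlonglongrightarrow> (P \<gamma> c K + P \<gamma> c K) * (0 * (sqrt c + sqrt c))"
      by (intro tendsto_mult tendsto_const v)
    then show "(\<lambda>n. (P \<gamma> c K + P \<gamma> c K) * (l2norm (\<lambda>x. U n x - v x) * (sqrt c + sqrt c))) \<longlonglongrightarrow> 0" by simp
  qed simp
  have "(\<lambda>n. E (U n)) \<longlonglongrightarrow> E v"
    unfolding energy_altdef by (intro tendsto_add tendsto_diff tendsto_divide tendsto_power tendsto_const gnorm Dlim) auto
  then have Ev: "E v = m c" using UE LIMSEQ_unique by blast
  have conv: "converges_in_H1 U v"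
    unfolding converges_in_H1_def
  proof (intro conjI allI UH vH)
    have "l2norm (weak_gradient (\<lambda>x. U n x - v x)) = l2norm (\<lambda>x. g n x - h x)" for n
      by (rule weak_gradient_l2norm) (intro L2_diff gL h has_weak_gradient_diff UL gw v vh)+
    then have "H1_norm (\<lambda>x. U n x - v x) = sqrt ((l2norm (\<lambda>x. g n x - h x))\<^sup>2 + (l2norm (\<lambda>x. U n x - v x))\<^sup>2)" for n
      by (simp add: H1_norm_altdef)
    moreover have "(\<lambda>n. sqrt ((l2norm (\<lambda>x. g n x - h x))\<^sup>2 + (l2norm (\<lambda>x. U n x - v x))\<^sup>2)) \<longlonglongrightarrow> sqrt (0\<^sup>2 + 0\<^sup>2)"
      by (intro tendsto_real_sqrt tendsto_add tendsto_power h v)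
    ultimately show "(\<lambda>n. H1_norm (\<lambda>x. U n x - v x)) \<longlonglongrightarrow> 0" by simp
  qed
  have U: "(\<lambda>n x. u n (x + y n)) \<circ> r = U" by (simp add: U_def w_def[abs_def] o_def fun_eq_iff)
  have vS: "v \<in> S c" using vH vc by (simp add: mass_sphere_iff)
  show ?thesis
    by (intro exI[of _ y] exI[of _ r] exI[of _ v] conjI r vS Ev) (simp only: U conv)
qed

lemma minimizing_sequence_ex:
  assumes "c > 0" shows "\<exists>u. (\<forall>n. u n \<in> S c) \<and> (\<lambda>n. E (u n)) \<longlonglongrightarrow> m c"
proof -
  have "\<exists>u\<in>S c. E u < m c + 1 / real (Suc n)" for n
    using cINF_less_iff[OF mass_sphere_nonempty[OF assms] energy_bdd_below[OF assms], of "m c + 1 / real (Suc n)"]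
    by (simp add: min_energy_def)
  then obtain u where u: "\<And>n. u n \<in> S c" "\<And>n. E (u n) < m c + 1 / real (Suc n)" by metis
  have "(\<lambda>n. m c + 1 / real (Suc n)) \<longlonglongrightarrow> m c + 0"
    by (intro tendsto_intros LIMSEQ_Suc[OF lim_1_over_n])
  then have up: "(\<lambda>n. m c + 1 / real (Suc n)) \<longlonglongrightarrow> m c" by simp
  have "(\<lambda>n. E (u n)) \<longlonglongrightarrow> m c"
  proof (rule tendsto_sandwich[OF _ _ tendsto_const up])
    show "\<forall>\<^sub>F n in sequentially. m c \<le> E (u n)"
      by (intro always_eventually allI min_energy_le assms u)
    show "\<forall>\<^sub>F n in sequentially. E (u n) \<le> m c + 1 / real (Suc n)"
      by (intro always_eventually allI less_imp_le u)
  qed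
  then show ?thesis using u(1) by blast
qed

end

theorem theorem1p2:
  fixes \<gamma>1 \<gamma>2 :: real
  assumes "0 < \<gamma>2" and "\<gamma>2 < \<gamma>1" and "\<gamma>1 < min (real CARD('n::finite)) 2"
  shows "\<exists>c0>0. \<forall>c>c0.
    min_energy TYPE('n) \<gamma>1 \<gamma>2 c < 0 \<and>
    (\<forall>c1 c2. c = c1 + c2 \<and> 0 < c1 \<and> c1 < c \<and> 0 < c2 \<and> c2 < c \<longrightarrow>
       min_energy TYPE('n) \<gamma>1 \<gamma>2 c < min_energy TYPE('n) \<gamma>1 \<gamma>2 c1 + min_energy TYPE('n) \<gamma>1 \<gamma>2 c2) \<and>
    (\<forall>u :: nat \<Rightarrow> real^'n \<Rightarrow> complex.
       minimizing_sequence \<gamma>1 \<gamma>2 c u \<longrightarrow> compact_up_to_translations u) \<and>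
    (\<exists>u :: real^'n \<Rightarrow> complex. u \<in> mass_sphere c \<and> energy \<gamma>1 \<gamma>2 u = min_energy TYPE('n) \<gamma>1 \<gamma>2 c)"
proof -
  interpret riesz_pair \<gamma>1 \<gamma>2 "TYPE('n)" by unfold_locales (use assms in auto)
  obtain c0 where c0: "c0 > 0" "\<And>c. c > c0 \<Longrightarrow> m c < 0" using min_energy_negative by blast
  show ?thesis
  proof (intro exI[of _ c0] conjI c0 allI impI)
    fix c assume "c0 < c"
    then have c: "c > 0" and m: "m c < 0" using c0 by auto
    show "m c < m c1 + m c2" if "c = c1 + c2 \<and> 0 < c1 \<and> c1 < c \<and> 0 < c2 \<and> c2 < c" for c1 c2
      by (rule strict_subadditivity) (use that m in auto)
    show "compact_up_to_translations u" if "minimizing_sequence \<gamma>1 \<gamma>2 c u" for u :: "nat \<Rightarrow> real^'n \<Rightarrow> complex"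
      using minimizing_sequence_compact[OF c m, of u] that
      unfolding minimizing_sequence_def compact_up_to_translations_def by blast
    show "\<exists>u. u \<in> S c \<and> E u = m c"
      using minimizing_sequence_ex[OF c] minimizing_sequence_compact[OF c m] by blast
  qed
qed

end
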